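(* For every fixed $c\in(1,\tfrac{149}{87})$ and every sufficiently small $\varepsilon>0$ (in terms of $c$), $$ \#\{n\le x:\lfloor n^c\rfloor\text{ is squarefree}\} =\frac{6}{\pi^2}\,x+O(x^{1-\varepsilon}), $$ where $n$ runs over natural numbers and the implied constant depends only on $c$ and $\varepsilon$.
   Context: $\lfloor t\rfloor$ is the integer part of the real number $t$; $x\ge 1$ is real. *)

theory Defs
  imports Complex_Main "HOL-Computational_Algebra.Squarefree"
begin

definition squarefree_floor_count :: "real \<Rightarrow> real \<Rightarrow> nat" where
  "squarefree_floor_count c x =
     card {n::nat. 1 \<le> n \<and> real n \<le> x \<and> squarefree \<lfloor>real n powr c\<rfloor>}"

end

theory Submission
imports Defs "HOL-Analysis.Analysis"
begin

text \<open>
  By Moebius inversion it suffices to estimate, for each \<open>d\<close>, the number of \<open>n \<le> x\<close> with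
  \<open>d\<^sup>2\<close> dividing \<open>\<lfloor>n powr c\<rfloor>\<close>.  For \<open>d\<close> up to a small power of \<open>x\<close> this is an equidistribution statement for
  \<open>n powr c / d\<^sup>2\<close> modulo 1, obtained by replacing the phase on short blocks by a linear one whose slope has a
  rational approximation of large denominator.

  For larger \<open>d\<close> only an upper bound for the number of pairs \<open>(n, d)\<close> is needed.
  Write \<open>\<lfloor>n powr c\<rfloor> = m * d\<^sup>2\<close> and fix whichever of \<open>d\<close> and \<open>m\<close> has the smaller range.  This gives a family of curves
  \<open>z = w y * x powr r\<close>, and the number of lattice points very close to them is bounded as follows.  Three consecutive
  points near one curve yield two integer difference vectors spanning a parallelogram of small nonzero area, so there are
  few such pairs of vectors; and a pair of vectors determines the point, and even the curve, almost uniquely.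
  No exponential sums enter, and the argument works for all \<open>c < 12 / 7\<close>.
\<close>

section \<open>Differences of power functions\<close>

text \<open>Origin of 12/7: on a box where \<open>n\<close> has size \<open>N\<close> and
  \<open>d\<close> has size \<open>N powr \<theta>\<close>, the decisive cost is the number of
  admissible pairs of difference vectors, of order \<open>s\<^sup>2 * L ^ 5 / X\<close> for slope
  \<open>s\<close>, range \<open>X\<close> and block length \<open>L\<close>. Up to multiples of
  \<eta> it is \<open>N\<close> to the power 2c - 3 + \<theta> if the curves are indexed by
  \<open>d\<close>, and to the power 5c - 3 - 8\<theta> if they are indexed by the cofactor. The
  first exponent grows with \<theta>, the second falls; they meet at \<theta> = c/3 with common
  value 7c/3 - 3, which is below 1 exactly for c < 12/7. The obstacle is that this cost may be paid
  only once for the whole family, not once per curve. A pair of vectors must therefore reveal two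
  unknowns, the position and the coefficient of the curve; its slope and its area supply two
  equations. They are accurate enough only if both gaps of the triple exceed a threshold
  \<open>B\<close>, since otherwise the tolerance swamps the area. Triples with a shorter gap are
  counted by a separate argument that uses one difference vector only.\<close>

text \<open>With \<open>g = gcd a b\<close>, the values \<open>u * b - a * v\<close> are multiples
  of \<open>g\<close>: at most \<open>2 * (Z div g)\<close> nonzero ones are available, and each
  fixes \<open>v\<close> modulo \<open>b div g\<close>, which leaves \<open>g\<close> choices among
  1, ..., \<open>b\<close>. The gcd cancels, so the first vector may be imprimitive.\<close>

lemma card_lattice_points_near_line:
  fixes a b Z :: int
  assumes b: "1 \<le> b" and Z: "0 \<le> Z"
  defines "S \<equiv> {(v, u). 1 \<le> v \<and> v \<le> b \<and> u * b - a * v \<noteq> 0 \<and> \<bar>u * b - a * v\<bar> \<le> Z}"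
  shows "finite S" "int (card S) \<le> 2 * Z"
proof -
  define g where "g = gcd a b"
  define h where "h = b div g"
  have g: "g \<ge> 1" using b by (simp add: g_def) (metis gcd_pos_int not_one_le_zero zero_less_iff_neq_zero int_one_le_iff_zero_less)
  have bh: "b = g * h" by (simp add: h_def g_def)
  have h: "h \<ge> 1" using bh b g by (metis int_one_le_iff_zero_less less_le_trans zero_less_mult_pos zero_less_one)
  obtain a' where a': "a = g * a'" by (metis g_def gcd_dvd1 dvdE)
  have cop: "coprime a' h"
  proof -
    have "gcd a' h = 1" using gcd_mult_distrib_int[of g a' h] g g_def a' bh
      by (metis abs_of_nonneg mult_cancel_left2 not_one_le_zero order_trans zero_le_one)
    thus ?thesis by (simp add: coprime_iff_gcd_eq_1)
  qed
  define \<phi> where "\<phi> = (\<lambda>(v, u). (u * h - a' * v, (v - 1) div h))"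
  define R where "R = (({- (Z div g)..Z div g} - {0}) \<times> {0..g - 1})"
  have inj: "inj_on \<phi> S"
  proof (rule inj_onI, clarify)
    fix v u v2 u2
    assume "(v, u) \<in> S" "(v2, u2) \<in> S" and eq: "\<phi> (v, u) = \<phi> (v2, u2)"
    have e1: "u * h - a' * v = u2 * h - a' * v2" and e2: "(v - 1) div h = (v2 - 1) div h"
      using eq by (auto simp: \<phi>_def)
    have "a' * (v - v2) = h * (u - u2)" using e1 by (simp add: algebra_simps)
    hence "h dvd a' * (v - v2)" by simp
    hence dv: "h dvd v - v2" using cop by (meson coprime_commute coprime_dvd_mult_right_iff)
    have "(v - 1) mod h = (v2 - 1) mod h" using dv by (simp add: mod_eq_dvd_iff)
    hence vv: "v = v2" using e2 by (metis diff_add_cancel div_mult_mod_eq)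
    hence "u * h = u2 * h" using e1 by simp
    thus "v = v2 \<and> u = u2" using vv h by simp
  qed
  have sub: "\<phi> ` S \<subseteq> R"
  proof clarify
    fix v u p q assume "(v, u) \<in> S" and pq: "(p, q) = \<phi> (v, u)"
    hence S: "1 \<le> v" "v \<le> b" "u * b - a * v \<noteq> 0" "\<bar>u * b - a * v\<bar> \<le> Z" by (auto simp: S_def)
    have p: "u * b - a * v = g * p" using pq unfolding bh a' by (simp add: \<phi>_def right_diff_distrib mult.commute mult.left_commute)
    have q: "q = (v - 1) div h" using pq by (auto simp: \<phi>_def)
    have p0: "p \<noteq> 0" using S p by auto
    have "g * \<bar>p\<bar> \<le> Z" using S p g by (simp add: abs_mult)
    hence "\<bar>p\<bar> \<le> Z div g" using g by (metis mult.commute nonzero_mult_div_cancel_right less_irrefl zdiv_mono1 int_one_le_iff_zero_less)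
    moreover have "0 \<le> q" using q S h by (simp add: pos_imp_zdiv_nonneg_iff)
    moreover have "q < g"
    proof (rule ccontr)
      assume "\<not> q < g"
      hence "g * h \<le> (v - 1) div h * h" using q h by (simp add: mult_right_mono)
      moreover have "(v - 1) div h * h \<le> v - 1"
        using pos_mod_sign[of h "v - 1"] h div_mult_mod_eq[of "v - 1" h] by linarith
      ultimately show False using S bh by linarith
    qed
    ultimately show "(p, q) \<in> R" using p0 by (auto simp: R_def abs_le_iff)
  qed
  have fR: "finite R" by (simp add: R_def)
  show "finite S" using inj sub fR by (meson finite_imageD finite_subset)
  have "int (card S) = int (card (\<phi> ` S))" using inj by (simp add: card_image)
  also have "\<dots> \<le> int (card R)" using sub fR by (simp add: card_mono)
  also have "\<dots> = 2 * (Z div g) * g"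
  proof -
    have "0 \<le> Z div g" using Z g by (simp add: pos_imp_zdiv_nonneg_iff)
    moreover from this have "card ({- (Z div g)..Z div g} - {0}) = nat (2 * (Z div g))"
      by (subst card_Diff_singleton) auto
    ultimately show ?thesis using g by (simp add: R_def card_cartesian_product)
  qed
  also have "\<dots> \<le> 2 * Z"
  proof -
    have "Z div g * g \<le> Z" using pos_mod_sign[of g Z] g div_mult_mod_eq[of Z g] by linarith
    thus ?thesis by simp
  qed
  finally show "int (card S) \<le> 2 * Z" .
qed

text \<open>Convexity with unequal steps: the mean value theorem turns both slopes into values of
  \<open>h'\<close> at ordered points. Clearing denominators leaves a determinant, the form needed
  for \<open>sdiff\<close>.\<close>

lemma second_difference_nonneg:
  fixes h h' h'' :: "real \<Rightarrow> real"
  assumes b: "0 < b" "0 < b'"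
    and d1: "\<And>t. p \<le> t \<Longrightarrow> t \<le> p + b + b' \<Longrightarrow> (h has_real_derivative h' t) (at t)"
    and d2: "\<And>t. p \<le> t \<Longrightarrow> t \<le> p + b + b' \<Longrightarrow> (h' has_real_derivative h'' t) (at t)"
    and nn: "\<And>t. p \<le> t \<Longrightarrow> t \<le> p + b + b' \<Longrightarrow> 0 \<le> h'' t"
  shows "(h (p + b) - h p) * b' \<le> (h (p + b + b') - h (p + b)) * b"
proof -
  obtain \<xi> where x: "p < \<xi>" "\<xi> < p + b" "h (p + b) - h p = (p + b - p) * h' \<xi>"
    using MVT2[of p "p + b" h h'] d1 b by (smt (verit))
  obtain \<eta> where y: "p + b < \<eta>" "\<eta> < p + b + b'" "h (p + b + b') - h (p + b) = (p + b + b' - (p + b)) * h' \<eta>"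
    using MVT2[of "p + b" "p + b + b'" h h'] d1 b by (smt (verit))
  have "h' \<xi> \<le> h' \<eta>"
  proof (rule DERIV_nonneg_imp_nondecreasing[where f = h'])
    show "\<xi> \<le> \<eta>" using x y by simp
    fix t assume "\<xi> \<le> t" "t \<le> \<eta>"
    hence t: "p \<le> t" "t \<le> p + b + b'" using x y by auto
    show "\<exists>y. (h' has_real_derivative y) (at t) \<and> 0 \<le> y" using d2[OF t] nn[OF t] by blast
  qed
  thus ?thesis using x y b by simp
qed


definition fdiff :: "real \<Rightarrow> real \<Rightarrow> real \<Rightarrow> real" where
  "fdiff r b x = (x + b) powr r - x powr r"

text \<open>The determinant of the consecutive difference vectors \<open>(b, fdiff r b x)\<close>
  and \<open>(b', fdiff r b' (x + b))\<close> of the graph of \<open>x powr r\<close>, that is, the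
  signed area of the parallelogram they span.\<close>

definition sdiff :: "real \<Rightarrow> real \<Rightarrow> real \<Rightarrow> real \<Rightarrow> real" where
  "sdiff r b b' x = fdiff r b' (x + b) * b - fdiff r b x * b'"

lemma powr_le_twice:
  assumes "0 < X" "X \<le> x" "x \<le> 2 * X" "0 \<le> a" "a \<le> (1::real)"
  shows "X powr a \<le> x powr a" "x powr a \<le> 2 * X powr a"
proof -
  show "X powr a \<le> x powr a" using assms by (intro powr_mono2) auto
  have "x powr a \<le> (2 * X) powr a" using assms by (intro powr_mono2) auto
  also have "\<dots> = 2 powr a * X powr a" using assms by (simp add: powr_mult)
  also have "\<dots> \<le> 2 powr 1 * X powr a" using assms by (intro mult_right_mono powr_mono) auto
  finally show "x powr a \<le> 2 * X powr a" by simp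
qed

lemma powr_neg_half_le:
  assumes "0 < X" "X \<le> x" "x \<le> 2 * X" "- 1 \<le> a" "a \<le> (0::real)"
  shows "X powr a / 2 \<le> x powr a" "x powr a \<le> X powr a"
proof -
  have *: "X powr (-a) \<le> x powr (-a)" "x powr (-a) \<le> 2 * X powr (-a)"
    using powr_le_twice[of X x "-a"] assms by auto
  have p: "X powr (-a) > 0" "x powr (-a) > 0" using assms by auto
  have e: "X powr a = 1 / X powr (-a)" "x powr a = 1 / x powr (-a)"
    by (simp_all add: powr_minus divide_simps)
  show "X powr a / 2 \<le> x powr a" "x powr a \<le> X powr a"
    unfolding e using * p by (simp_all add: field_simps)
qed

lemma powr_shift_deriv:
  "0 < a + t \<Longrightarrow> ((\<lambda>t. (a + t) powr r) has_real_derivative r * (a + t) powr (r - 1)) (at (t::real))"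
  using DERIV_chain2[of "\<lambda>z. z powr r" _ "\<lambda>t. a + t" t 1 UNIV] has_real_derivative_powr[of "a + t" r]
  by (auto intro!: derivative_eq_intros)

lemma fdiff_bounds:
  assumes "1 < r" "r < 2" "0 < X" "X \<le> x" "0 < b" "x + b \<le> 2 * X"
  shows "b * X powr (r - 1) \<le> fdiff r b x" "fdiff r b x \<le> 4 * b * X powr (r - 1)"
proof -
  obtain z where z: "x < z" "z < x + b" "(x + b) powr r - x powr r = (x + b - x) * (r * z powr (r - 1))"
    using MVT2[of x "x + b" "\<lambda>t. t powr r" "\<lambda>t. r * t powr (r - 1)"]
      has_real_derivative_powr[of _ r] assms by (smt (verit))
  have w: "X powr (r - 1) \<le> z powr (r - 1)" "z powr (r - 1) \<le> 2 * X powr (r - 1)"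
    using powr_le_twice[of X z "r - 1"] assms z by auto
  have f: "fdiff r b x = b * (r * z powr (r - 1))" using z by (simp add: fdiff_def)
  have "1 * X powr (r - 1) \<le> r * z powr (r - 1)" using assms w by (intro mult_mono) auto
  thus "b * X powr (r - 1) \<le> fdiff r b x" unfolding f using assms by (intro mult_left_mono) auto
  have "r * z powr (r - 1) \<le> 2 * (2 * X powr (r - 1))" using assms w by (intro mult_mono) auto
  hence "b * (r * z powr (r - 1)) \<le> b * (2 * (2 * X powr (r - 1)))" using assms by (intro mult_left_mono) auto
  thus "fdiff r b x \<le> 4 * b * X powr (r - 1)" unfolding f by simp
qed

lemma fdiff_increment:
  assumes "1 < r" "r < 2" "0 < X" "X \<le> x" "x \<le> y" "0 < b" "y + b \<le> 2 * X"
  shows "(r - 1) / 2 * b * X powr (r - 2) * (y - x) \<le> fdiff r b y - fdiff r b x"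
proof (cases "x = y")
  case False
  hence xy: "x < y" using assms by simp
  let ?d = "\<lambda>t. r * (t + b) powr (r - 1) - r * t powr (r - 1)"
  have "\<exists>z>x. z < y \<and> fdiff r b y - fdiff r b x = (y - x) * ?d z"
    unfolding fdiff_def
  proof (rule MVT2[OF xy])
    fix t assume t: "x \<le> t" "t \<le> y"
    have "((\<lambda>t. (b + t) powr r - (0 + t) powr r) has_real_derivative r * (b + t) powr (r - 1) - r * (0 + t) powr (r - 1)) (at t)"
      using t assms by (intro DERIV_diff powr_shift_deriv) auto
    thus "((\<lambda>t. (t + b) powr r - t powr r) has_real_derivative ?d t) (at t)" by (simp add: add.commute)
  qed
  then obtain z where z: "x < z" "z < y" "fdiff r b y - fdiff r b x = (y - x) * ?d z" by blast
  have "\<exists>v>z. v < z + b \<and> (z + b) powr (r - 1) - z powr (r - 1) = (z + b - z) * ((r - 1) * v powr (r - 1 - 1))"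
  proof (rule MVT2)
    fix t assume "z \<le> t" "t \<le> z + b"
    thus "((\<lambda>t. t powr (r - 1)) has_real_derivative (r - 1) * t powr (r - 1 - 1)) (at t)"
      using assms z by (intro has_real_derivative_powr) auto
  qed (use assms in auto)
  then obtain v where v: "z < v" "v < z + b" "(z + b) powr (r - 1) - z powr (r - 1) = b * ((r - 1) * v powr (r - 2))"
    by (auto simp: )
  have w: "X powr (r - 2) / 2 \<le> v powr (r - 2)" using powr_neg_half_le[of X v "r - 2"] assms z v by auto
  have "?d z = r * (b * ((r - 1) * v powr (r - 2)))" unfolding v(3)[symmetric] by (rule right_diff_distrib[symmetric])
  also have "\<dots> \<ge> 1 * (b * ((r - 1) * (X powr (r - 2) / 2)))" using assms w
    by (intro mult_mono mult_left_mono) auto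
  finally have "?d z \<ge> (r - 1) / 2 * b * X powr (r - 2)" by (simp add: algebra_simps)
  hence "(y - x) * ?d z \<ge> (y - x) * ((r - 1) / 2 * b * X powr (r - 2))" using xy by (intro mult_left_mono) auto
  thus ?thesis using z by (simp add: algebra_simps)
qed simp

lemma le_iff_le_if_diff_eq: "q - p = q' - p' \<Longrightarrow> p \<le> q \<longleftrightarrow> p' \<le> (q'::real)"
  by auto

text \<open>On the parabola \<open>k * t^2\<close> the determinant equals
  \<open>k * (b * b' * (b + b'))\<close> at every \<open>x\<close>. Subtracting a parabola thus
  turns a convexity statement into a numerical bound for the determinant.\<close>

lemma second_difference_square:
  fixes A B C x b b' k :: real
  shows "((A - k * (x + b)\<^sup>2) - (B - k * x\<^sup>2)) * b' \<le> ((C - k * (x + b + b')\<^sup>2) - (A - k * (x + b)\<^sup>2)) * b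
    \<longleftrightarrow> k * (b * b' * (b + b')) \<le> (C - A) * b - (A - B) * b'"
    and "((k * (x + b)\<^sup>2 - A) - (k * x\<^sup>2 - B)) * b' \<le> ((k * (x + b + b')\<^sup>2 - C) - (k * (x + b)\<^sup>2 - A)) * b
    \<longleftrightarrow> (C - A) * b - (A - B) * b' \<le> k * (b * b' * (b + b'))"
  by (rule le_iff_le_if_diff_eq, algebra)+

text \<open>The second derivative of \<open>t powr r\<close> between \<open>X\<close> and
  \<open>2 * X\<close> lies between those of two parabolas,
  \<open>(r - 1) / 2 * X powr (r - 2)\<close> and \<open>2 * X powr (r - 2)\<close>. Convexity of
  the power minus the first, and of the second minus the power, gives the two bounds.\<close>

lemma sdiff_bounds:
  assumes "1 < r" "r < 2" "0 < X" "X \<le> x" "0 < b" "0 < b'" "x + b + b' \<le> 2 * X"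
  shows "(r - 1) / 4 * X powr (r - 2) * (b * b' * (b + b')) \<le> sdiff r b b' x"
    and "sdiff r b b' x \<le> X powr (r - 2) * (b * b' * (b + b'))"
proof -
  have d: "((\<lambda>t. t powr r) has_real_derivative r * t powr (r - 1)) (at t)"
          "((\<lambda>t. r * t powr (r - 1)) has_real_derivative r * ((r - 1) * t powr (r - 2))) (at t)"
    if "x \<le> t" for t
    using that assms has_real_derivative_powr[of t r] DERIV_cmult[OF has_real_derivative_powr[of t "r - 1"], of r]
    by auto
  have bd: "X powr (r - 2) / 2 \<le> t powr (r - 2)" "t powr (r - 2) \<le> X powr (r - 2)" 
    if "x \<le> t" "t \<le> x + b + b'" for t
    using powr_neg_half_le[of X t "r - 2"] that assms by auto
  let ?k = "(r - 1) / 2 * X powr (r - 2)"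
  have "((\<lambda>t. t powr r - ?k / 2 * t^2) (x + b) - (\<lambda>t. t powr r - ?k / 2 * t^2) x) * b'
      \<le> ((\<lambda>t. t powr r - ?k / 2 * t^2) (x + b + b') - (\<lambda>t. t powr r - ?k / 2 * t^2) (x + b)) * b"
  proof (rule second_difference_nonneg[where h' = "\<lambda>t. r * t powr (r - 1) - ?k * t" and h'' = "\<lambda>t. r * ((r - 1) * t powr (r - 2)) - ?k"])
    fix t assume t: "x \<le> t" "t \<le> x + b + b'"
    show "((\<lambda>t. t powr r - ?k / 2 * t^2) has_real_derivative r * t powr (r - 1) - ?k * t) (at t)"
      by (rule derivative_eq_intros d(1)[OF t(1)] refl)+ simp
    show "((\<lambda>t. r * t powr (r - 1) - ?k * t) has_real_derivative r * ((r - 1) * t powr (r - 2)) - ?k) (at t)"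
      by (rule derivative_eq_intros d(2)[OF t(1)] refl)+ simp
    have "1 * ((r - 1) * (X powr (r - 2) / 2)) \<le> r * ((r - 1) * t powr (r - 2))"
      using assms bd[OF t] by (intro mult_mono mult_left_mono) auto
    thus "0 \<le> r * ((r - 1) * t powr (r - 2)) - ?k" by simp
  qed (use assms in auto)
  thus "(r - 1) / 4 * X powr (r - 2) * (b * b' * (b + b')) \<le> sdiff r b b' x"
    unfolding second_difference_square sdiff_def fdiff_def by simp
  let ?k = "2 * X powr (r - 2)"
  have "((\<lambda>t. ?k / 2 * t^2 - t powr r) (x + b) - (\<lambda>t. ?k / 2 * t^2 - t powr r) x) * b'
      \<le> ((\<lambda>t. ?k / 2 * t^2 - t powr r) (x + b + b') - (\<lambda>t. ?k / 2 * t^2 - t powr r) (x + b)) * b"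
  proof (rule second_difference_nonneg[where h' = "\<lambda>t. ?k * t - r * t powr (r - 1)" and h'' = "\<lambda>t. ?k - r * ((r - 1) * t powr (r - 2))"])
    fix t assume t: "x \<le> t" "t \<le> x + b + b'"
    show "((\<lambda>t. ?k / 2 * t^2 - t powr r) has_real_derivative ?k * t - r * t powr (r - 1)) (at t)"
      by (rule derivative_eq_intros d(1)[OF t(1)] refl)+ simp
    show "((\<lambda>t. ?k * t - r * t powr (r - 1)) has_real_derivative ?k - r * ((r - 1) * t powr (r - 2))) (at t)"
      by (rule derivative_eq_intros d(2)[OF t(1)] refl)+ simp
    have "r * ((r - 1) * t powr (r - 2)) \<le> 2 * (1 * X powr (r - 2))"
      using assms bd[OF t] by (intro mult_mono) auto
    thus "0 \<le> ?k - r * ((r - 1) * t powr (r - 2))" by simp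
  qed (use assms in auto)
  thus "sdiff r b b' x \<le> X powr (r - 2) * (b * b' * (b + b'))"
    unfolding second_difference_square sdiff_def fdiff_def by simp
qed

lemma shift_ratio_mono:
  assumes "0 < x" "x \<le> (y::real)" "0 \<le> t" "t \<le> V"
  shows "(y + V) / (x + V) \<le> (y + t) / (x + t)" "(x + t) / (y + t) \<le> (x + V) / (y + V)"
proof -
  have "0 \<le> (V - t) * (y - x)" using assms by simp
  hence "V * x + t * y \<le> V * y + t * x" by (simp add: algebra_simps)
  thus "(y + V) / (x + V) \<le> (y + t) / (x + t)" "(x + t) / (y + t) \<le> (x + V) / (y + V)"
    using assms by (simp_all add: divide_simps) (simp_all add: algebra_simps)
qed

text \<open>The step length is the variable: the derivatives of the two differences have ratio
  \<open>((y + t) / (x + t)) powr (r - 1)\<close>, which decreases in \<open>t\<close>. The lower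
  bound is stated with the shift \<open>V\<close> so that it involves the same ratio as
  \<open>sdiff_ratio\<close>; the exponents \<open>r - 1\<close> and \<open>2 - r\<close> then add
  up to 1.\<close>

lemma fdiff_ratio:
  assumes "1 < r" "r < 2" "0 < x" "x \<le> y" "0 < b" "b \<le> V"
  shows "((y + V) / (x + V)) powr (r - 1) * fdiff r b x \<le> fdiff r b y"
    and "fdiff r b y \<le> (y / x) powr (r - 1) * fdiff r b x"
proof -
  have d: "((\<lambda>t. (a + t) powr r) has_real_derivative r * (a + t) powr (r - 1)) (at t)"
    if "0 < a" "0 \<le> t" for t a
    using that by (intro powr_shift_deriv) auto
  let ?k = "((y + V) / (x + V)) powr (r - 1)"
  let ?h = "\<lambda>t. (y + t) powr r - ?k * (x + t) powr r"
  have "?h 0 \<le> ?h b"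
  proof (rule DERIV_nonneg_imp_nondecreasing[where f = ?h])
    fix t assume t: "0 \<le> t" "t \<le> b"
    have "(y + V) / (x + V) \<le> (y + t) / (x + t)" using assms t by (intro shift_ratio_mono) auto
    hence "?k \<le> ((y + t) / (x + t)) powr (r - 1)" using assms t by (intro powr_mono2) auto
    hence "?k * (x + t) powr (r - 1) \<le> ((y + t) / (x + t)) powr (r - 1) * (x + t) powr (r - 1)"
      by (intro mult_right_mono) auto
    also have "\<dots> = (y + t) powr (r - 1)" using assms t by (simp add: powr_divide)
    finally have "0 \<le> r * (y + t) powr (r - 1) - ?k * (r * (x + t) powr (r - 1))"
      using assms by (simp add: algebra_simps)
    moreover have "(?h has_real_derivative r * (y + t) powr (r - 1) - ?k * (r * (x + t) powr (r - 1))) (at t)"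
      using assms t by (intro DERIV_diff DERIV_cmult d) auto
    ultimately show "\<exists>y. (?h has_real_derivative y) (at t) \<and> 0 \<le> y" by blast
  qed (use assms in auto)
  thus "?k * fdiff r b x \<le> fdiff r b y" by (simp add: fdiff_def algebra_simps)
  let ?k = "(y / x) powr (r - 1)"
  let ?h = "\<lambda>t. ?k * (x + t) powr r - (y + t) powr r"
  have "?h 0 \<le> ?h b"
  proof (rule DERIV_nonneg_imp_nondecreasing[where f = ?h])
    fix t assume t: "0 \<le> t" "t \<le> b"
    have "(y + t) / (x + t) \<le> y / x" using assms t shift_ratio_mono(1)[of x y 0 t] by simp
    hence "((y + t) / (x + t)) powr (r - 1) \<le> ?k" using assms t by (intro powr_mono2) auto
    hence "((y + t) / (x + t)) powr (r - 1) * (x + t) powr (r - 1) \<le> ?k * (x + t) powr (r - 1)"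
      by (intro mult_right_mono) auto
    moreover have "((y + t) / (x + t)) powr (r - 1) * (x + t) powr (r - 1) = (y + t) powr (r - 1)" 
      using assms t by (simp add: powr_divide)
    ultimately have "0 \<le> ?k * (r * (x + t) powr (r - 1)) - r * (y + t) powr (r - 1)"
      using assms by (simp add: algebra_simps)
    moreover have "(?h has_real_derivative ?k * (r * (x + t) powr (r - 1)) - r * (y + t) powr (r - 1)) (at t)"
      using assms t by (intro DERIV_diff DERIV_cmult d) auto
    ultimately show "\<exists>y. (?h has_real_derivative y) (at t) \<and> 0 \<le> y" by blast
  qed (use assms in auto)
  thus "fdiff r b y \<le> ?k * fdiff r b x" by (simp add: fdiff_def algebra_simps)
qed

text \<open>The second difference decays where the first one grows. Convexity is applied in the step
  length, starting at 0, to a multiple of the graph seen from \<open>x\<close> minus the graph seen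
  from \<open>y\<close>.\<close>

lemma sdiff_ratio:
  assumes "1 < r" "r < 2" "0 < x" "x \<le> y" "0 < b" "0 < b'"
  shows "sdiff r b b' y \<le> ((x + (b + b')) / (y + (b + b'))) powr (2 - r) * sdiff r b b' x"
proof -
  define V where "V = b + b'"
  have d: "((\<lambda>t. (a + t) powr r) has_real_derivative r * (a + t) powr (r - 1)) (at t)"
          "((\<lambda>t. r * (a + t) powr (r - 1)) has_real_derivative r * ((r - 1) * (a + t) powr (r - 2))) (at t)"
    if "0 < a" "0 \<le> t" for t a
    using that powr_shift_deriv[of a t r] DERIV_cmult[OF powr_shift_deriv[of a t "r - 1"], of r] by auto
  let ?k = "((x + V) / (y + V)) powr (2 - r)"
  let ?h = "\<lambda>t. ?k * (x + t) powr r - (y + t) powr r"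
  have "(?h (0 + b) - ?h 0) * b' \<le> (?h (0 + b + b') - ?h (0 + b)) * b"
  proof (rule second_difference_nonneg[where h = ?h and h' = "\<lambda>t. ?k * (r * (x + t) powr (r - 1)) - r * (y + t) powr (r - 1)" 
        and h'' = "\<lambda>t. ?k * (r * ((r - 1) * (x + t) powr (r - 2))) - r * ((r - 1) * (y + t) powr (r - 2))"])
    fix t assume t: "0 \<le> t" "t \<le> 0 + b + b'"
    show "(?h has_real_derivative ?k * (r * (x + t) powr (r - 1)) - r * (y + t) powr (r - 1)) (at t)"
      using assms t by (intro DERIV_diff DERIV_cmult d) auto
    show "((\<lambda>t. ?k * (r * (x + t) powr (r - 1)) - r * (y + t) powr (r - 1)) has_real_derivative
        ?k * (r * ((r - 1) * (x + t) powr (r - 2))) - r * ((r - 1) * (y + t) powr (r - 2))) (at t)"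
      using assms t by (intro DERIV_diff DERIV_cmult d) auto
    have "(x + t) / (y + t) \<le> (x + V) / (y + V)" using assms t unfolding V_def by (intro shift_ratio_mono) auto
    hence "((x + t) / (y + t)) powr (2 - r) \<le> ?k" using assms t by (intro powr_mono2) auto
    hence "((x + t) / (y + t)) powr (2 - r) * (x + t) powr (r - 2) \<le> ?k * (x + t) powr (r - 2)"
      by (intro mult_right_mono) auto
    moreover have "((x + t) / (y + t)) powr (2 - r) * (x + t) powr (r - 2) = (y + t) powr (r - 2)"
    proof -
      have "(x + t) powr (2 - r) * (x + t) powr (r - 2) = 1" using assms t by (simp flip: powr_add)
      moreover have "1 / (y + t) powr (2 - r) = (y + t) powr (r - 2)"
        using powr_minus_divide[of "y + t" "2 - r"] by simp
      ultimately show ?thesis using assms t by (simp add: powr_divide)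
    qed
    ultimately have "(y + t) powr (r - 2) \<le> ?k * (x + t) powr (r - 2)" by simp
    hence "(r * (r - 1)) * (y + t) powr (r - 2) \<le> (r * (r - 1)) * (?k * (x + t) powr (r - 2))"
      using assms by (intro mult_left_mono) auto
    thus "0 \<le> ?k * (r * ((r - 1) * (x + t) powr (r - 2))) - r * ((r - 1) * (y + t) powr (r - 2))"
      by (simp add: algebra_simps)
  qed (use assms in auto)
  thus ?thesis by (simp add: sdiff_def fdiff_def V_def algebra_simps)
qed

section \<open>Consecutive elements and determination of the curve\<close>

lemma card_le_mult_fibres:
  fixes m :: real
  assumes "finite J" "f ` B \<subseteq> J" "\<And>j. j \<in> J \<Longrightarrow> finite {x \<in> B. f x = j}"
    "\<And>j. j \<in> J \<Longrightarrow> real (card {x \<in> B. f x = j}) \<le> m"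
  shows "finite B" "real (card B) \<le> m * real (card J)"
proof -
  have eq: "B = (\<Union>j\<in>J. {x \<in> B. f x = j})" using assms(2) by auto
  show "finite B" by (subst eq) (use assms in auto)
  have "card B \<le> (\<Sum>j\<in>J. card {x \<in> B. f x = j})" by (subst eq) (rule card_UN_le[OF assms(1)])
  hence "real (card B) \<le> (\<Sum>j\<in>J. real (card {x \<in> B. f x = j}))" by (metis of_nat_le_iff of_nat_sum)
  also have "\<dots> \<le> (\<Sum>j\<in>J. m)" using assms by (intro sum_mono) auto
  finally show "real (card B) \<le> m * real (card J)" by (simp add: mult.commute)
qed

lemma card_spaced_le:
  fixes F :: "nat set" and b V :: real
  assumes fin: "finite F" and b: "0 < b" and V: "0 \<le> V"
    and sp: "\<And>m n. m \<in> F \<Longrightarrow> n \<in> F \<Longrightarrow> m < n \<Longrightarrow> b \<le> real n - real m \<and> real n - real m \<le> V"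
  shows "real (card F) \<le> 1 + V / b"
proof (cases "F = {}")
  case False
  define m where "m = Min F"
  have m: "m \<in> F" "\<And>n. n \<in> F \<Longrightarrow> m \<le> n" using fin False by (auto simp: m_def)
  define \<phi> where "\<phi> = (\<lambda>n::nat. \<lfloor>(real n - real m) / b\<rfloor>)"
  have lt: "\<phi> n < \<phi> n'" if "n \<in> F" "n' \<in> F" "n < n'" for n n'
  proof -
    have "(real n - real m) / b + 1 \<le> (real n' - real m) / b"
      using sp[OF that] b divide_right_mono[of "real n - real m + b" "real n' - real m" b] by (simp add: add_divide_distrib)
    thus ?thesis unfolding \<phi>_def by linarith
  qed
  have "inj_on \<phi> F" by (rule inj_onI) (metis lt less_irrefl nat_neq_iff)
  moreover have "\<phi> ` F \<subseteq> {0..\<lfloor>V / b\<rfloor>}"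
  proof clarify
    fix n assume n: "n \<in> F"
    have "real n - real m \<le> V" using sp[OF m(1) n] m(2)[OF n] V by (cases "m = n") auto
    thus "\<phi> n \<in> {0..\<lfloor>V / b\<rfloor>}" using m(2)[OF n] b by (auto simp: \<phi>_def intro!: floor_mono divide_right_mono)
  qed
  ultimately have "card F \<le> card {0..\<lfloor>V / b\<rfloor>}" by (metis card_inj_on_le finite_atLeastAtMost_int)
  moreover have "0 \<le> \<lfloor>V / b\<rfloor>" using V b by simp
  ultimately have "int (card F) \<le> \<lfloor>V / b\<rfloor> + 1" by (simp del: zero_le_floor)
  thus ?thesis by linarith
qed (use b V in simp)

lemma three_increasing_elements:
  fixes F :: "'a::linorder set"
  assumes "finite F" "2 < card F"
  obtains k l m where "k \<in> F" "l \<in> F" "m \<in> F" "k < l" "l < m"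
proof -
  define k where "k = Min F"
  have ne: "F \<noteq> {}" using assms by auto
  have k: "k \<in> F" using assms ne by (simp add: k_def)
  define F' where "F' = F - {k}"
  have F': "finite F'" "1 < card F'" using assms k by (auto simp: F'_def)
  have ne': "F' \<noteq> {}" using F' by auto
  define l where "l = Min F'"
  have l: "l \<in> F'" using F' ne' by (simp add: l_def)
  define F'' where "F'' = F' - {l}"
  have F'': "finite F''" "0 < card F''" using F' l by (auto simp: F''_def)
  then obtain m where m: "m \<in> F''" by (metis card_gt_0_iff ex_in_conv)
  have "k \<le> l" using l assms by (auto simp: k_def F'_def)
  moreover have "k \<noteq> l" using l by (auto simp: F'_def)
  moreover have "l \<le> m" using m F' by (auto simp: l_def F''_def)
  moreover have "l \<noteq> m" using m by (auto simp: F''_def)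
  ultimately have "k < l" "l < m" by auto
  moreover have "l \<in> F" using l by (auto simp: F'_def)
  moreover have "m \<in> F" using m by (auto simp: F''_def F'_def)
  ultimately show ?thesis using that k by blast
qed

text \<open>\<open>Min\<close> of the empty set is unspecified, which is why the sets built from
  \<open>nxt\<close> carry a nonemptiness condition.\<close>

definition nxt :: "nat set \<Rightarrow> nat \<Rightarrow> nat" where "nxt A n = Min {k \<in> A. n < k}"

lemma nxt:
  assumes "finite A" "{k \<in> A. n < k} \<noteq> {}"
  shows "nxt A n \<in> A" "n < nxt A n" "\<And>k. k \<in> A \<Longrightarrow> n < k \<Longrightarrow> nxt A n \<le> k"
proof -
  have "nxt A n \<in> {k \<in> A. n < k}" unfolding nxt_def using assms by (intro Min_in) auto
  thus "nxt A n \<in> A" "n < nxt A n" by auto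
  show "nxt A n \<le> k" if "k \<in> A" "n < k" for k
    unfolding nxt_def using that assms by (intro Min_le) auto
qed

definition triple_starts :: "nat set \<Rightarrow> real \<Rightarrow> nat set" where
  "triple_starts A L = {n \<in> A. {k \<in> A. n < k} \<noteq> {} \<and> {k \<in> A. nxt A n < k} \<noteq> {} \<and> real (nxt A (nxt A n)) \<le> real n + L}"

text \<open>Cut the range into cells of length \<open>L\<close>. Among three elements of one cell
  the least has its next two successors in that cell and is a triple start, so each cell contains at
  most two other elements.\<close>

lemma card_not_triple_starts:
  fixes X L :: real
  assumes fin: "finite A" and X: "0 \<le> X" and L: "0 < L" and A: "\<And>n. n \<in> A \<Longrightarrow> X \<le> real n \<and> real n \<le> 2 * X"
  shows "real (card (A - triple_starts A L)) \<le> 2 * (X / L + 1)"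
proof -
  define f where "f = (\<lambda>n::nat. \<lfloor>(real n - X) / L\<rfloor>)"
  let ?J = "{0..\<lfloor>X / L\<rfloor>}"
  have "real (card (A - triple_starts A L)) \<le> 2 * real (card ?J)"
  proof (rule card_le_mult_fibres(2)[where f = f])
    show "f ` (A - triple_starts A L) \<subseteq> ?J"
    proof clarify
      fix n assume "n \<in> A"
      from A[OF this] L show "f n \<in> ?J" unfolding f_def by (auto intro!: floor_mono divide_right_mono)
    qed
    fix j assume "j \<in> ?J"
    let ?F = "{x \<in> A - triple_starts A L. f x = j}"
    show fF: "finite ?F" using fin by auto
    have "\<not> 2 < card ?F"
    proof
      assume "2 < card ?F"
      from three_increasing_elements[OF fF this] obtain k l m where
        klm: "k \<in> ?F" "l \<in> ?F" "m \<in> ?F" "k < l" "l < m" .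
      have kA: "k \<in> A" "l \<in> A" "m \<in> A" "f k = f m" using klm by auto
      have ne1: "{i \<in> A. k < i} \<noteq> {}" using kA klm by auto
      note n1 = nxt[OF fin ne1]
      have "nxt A k \<le> l" using n1(3) kA klm by auto
      hence ne2: "{i \<in> A. nxt A k < i} \<noteq> {}" using kA klm by auto
      have "nxt A (nxt A k) \<le> m" using nxt(3)[OF fin ne2, of m] \<open>nxt A k \<le> l\<close> kA klm by auto
      moreover have "real m \<le> real k + L"
      proof -
        have "(real m - X) / L < (real k - X) / L + 1" using kA(4) unfolding f_def by linarith
        thus ?thesis using L by (simp add: field_simps)
      qed
      ultimately have "k \<in> triple_starts A L" using kA ne1 ne2 by (auto simp: triple_starts_def)
      thus False using klm by auto
    qed
    thus "real (card ?F) \<le> 2" by simp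
  qed auto
  also have "\<dots> \<le> 2 * (X / L + 1)"
  proof -
    define q where "q = X / L"
    have "0 \<le> q" using X L by (simp add: q_def)
    hence "real (card {0..\<lfloor>q\<rfloor>}) = of_int \<lfloor>q\<rfloor> + 1" by simp
    hence "real (card {0..\<lfloor>q\<rfloor>}) \<le> q + 1" using of_int_floor_le[of q] by simp
    thus ?thesis by (simp add: q_def)
  qed
  finally show ?thesis .
qed

section \<open>Comparing two curves through the logarithms of their differences\<close>

lemma ln_powr_mult: "0 < r \<Longrightarrow> 0 < q \<Longrightarrow> ln (r powr p * q) = p * ln r + ln (q::real)"
  by (simp add: ln_mult_pos ln_powr)

lemma ln_le_ln_powr_mult:
  assumes "0 < r" "0 < q" "0 < (e::real)"
  shows "r powr p * q \<le> e \<Longrightarrow> p * ln r + ln q \<le> ln e"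
    and "e \<le> r powr p * q \<Longrightarrow> ln e \<le> p * ln r + ln q"
  using assms by (auto simp flip: ln_powr_mult intro!: ln_mono)

lemma abs_ln_diff_le:
  fixes a e \<epsilon> :: real
  assumes "0 < e" "0 \<le> \<epsilon>" "\<epsilon> \<le> 1 / 2" "\<bar>a - e\<bar> \<le> \<epsilon> * e"
  shows "0 < a" "\<bar>ln a - ln e\<bar> \<le> 2 * \<epsilon>"
proof -
  have lo: "(1 - \<epsilon>) * e \<le> a" and hi: "a \<le> (1 + \<epsilon>) * e" using assms by (auto simp: abs_le_iff algebra_simps)
  have "0 < (1 - \<epsilon>) * e" using assms by simp
  thus a: "0 < a" using lo by linarith
  have q: "1 - \<epsilon> \<le> a / e" "a / e \<le> 1 + \<epsilon>" using lo hi assms by (simp_all add: field_simps)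
  have "ln (a / e) \<le> a / e - 1" using a assms by (intro ln_le_minus_one) auto
  moreover have "ln (e / a) \<le> e / a - 1" using a assms by (intro ln_le_minus_one) auto
  moreover have "e / a \<le> 1 / (1 - \<epsilon>)" using lo a assms by (simp add: field_simps)
  moreover have "1 / (1 - \<epsilon>) \<le> 1 + 2 * \<epsilon>"
  proof -
    have "0 \<le> \<epsilon> * (1 - 2 * \<epsilon>)" using assms by simp
    thus ?thesis using assms by (simp add: field_simps)
  qed
  moreover have "ln (a / e) = ln a - ln e" "ln (e / a) = ln e - ln a" using a assms by (simp_all add: ln_div)
  ultimately show "\<bar>ln a - ln e\<bar> \<le> 2 * \<epsilon>" using q assms by linarith
qed

lemma half_le_ln_one_plus:
  assumes "0 \<le> t" "t \<le> (1::real)"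
  shows "t / 2 \<le> ln (1 + t)"
proof -
  have "exp (t / 2) \<le> 1 + t / 2 + (t / 2)\<^sup>2" using exp_bound[of "t / 2"] assms by auto
  also have "\<dots> \<le> 1 + t" using assms mult_left_le[of t t] by (simp add: power2_eq_square)
  finally show ?thesis using assms by (subst ln_ge_iff) auto
qed

text \<open>Here \<open>w1, w2\<close> are the coefficients of two curves, and \<open>a, D\<close> approximate the first and second differences
  on both of them.  The quotient \<open>D / a\<close> depends on the position like \<open>1 / x\<close> and not at all on the coefficient,
  so it locates \<open>x\<close>; then \<open>a\<close> determines the coefficient.\<close>

lemma curve_determined_by_differences:
  fixes x1 x2 w1 w2 :: real
  assumes r: "1 < r" "r < 2" and x: "0 < x1" "x1 \<le> x2" "x2 \<le> 2 * x1"
    and b: "0 < b" "0 < b'" "b + b' \<le> x1" and w: "0 < w1" "0 < w2"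
    and pos: "0 < sdiff r b b' x1" "0 < sdiff r b b' x2" "0 < fdiff r b x1" "0 < fdiff r b x2"
    and \<epsilon>: "0 \<le> \<epsilon>" "\<epsilon> \<le> 1 / 2"
    and a: "\<bar>a - w1 * fdiff r b x1\<bar> \<le> \<epsilon> * (w1 * fdiff r b x1)" "\<bar>a - w2 * fdiff r b x2\<bar> \<le> \<epsilon> * (w2 * fdiff r b x2)"
    and D: "\<bar>D - w1 * sdiff r b b' x1\<bar> \<le> \<epsilon> * (w1 * sdiff r b b' x1)" "\<bar>D - w2 * sdiff r b b' x2\<bar> \<le> \<epsilon> * (w2 * sdiff r b b' x2)"
  shows "\<bar>ln (w1 / w2)\<bar> \<le> 36 * \<epsilon>"
proof -
  let ?S1 = "sdiff r b b' x1" and ?S2 = "sdiff r b b' x2" and ?E1 = "fdiff r b x1" and ?E2 = "fdiff r b x2"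
  let ?V = "b + b'"
  have l1: "\<bar>ln a - (ln w1 + ln ?E1)\<bar> \<le> 2 * \<epsilon>" using abs_ln_diff_le(2)[OF _ \<epsilon> a(1)] w pos by (simp add: ln_mult_pos)
  have l2: "\<bar>ln a - (ln w2 + ln ?E2)\<bar> \<le> 2 * \<epsilon>" using abs_ln_diff_le(2)[OF _ \<epsilon> a(2)] w pos by (simp add: ln_mult_pos)
  have l3: "\<bar>ln D - (ln w1 + ln ?S1)\<bar> \<le> 2 * \<epsilon>" using abs_ln_diff_le(2)[OF _ \<epsilon> D(1)] w pos by (simp add: ln_mult_pos)
  have l4: "\<bar>ln D - (ln w2 + ln ?S2)\<bar> \<le> 2 * \<epsilon>" using abs_ln_diff_le(2)[OF _ \<epsilon> D(2)] w pos by (simp add: ln_mult_pos)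
  define l where "l = ln ((x2 + ?V) / (x1 + ?V))"
  have rp: "0 < (x2 + ?V) / (x1 + ?V)" "0 < (x1 + ?V) / (x2 + ?V)" "0 < x2 / x1" using x b by auto
  have "ln ?S2 \<le> (2 - r) * ln ((x1 + ?V) / (x2 + ?V)) + ln ?S1"
    by (rule ln_le_ln_powr_mult(2)[OF rp(2) pos(1,2) sdiff_ratio[OF r x(1,2) b(1,2)]])
  also have "ln ((x1 + ?V) / (x2 + ?V)) = - l" using x b unfolding l_def by (simp add: ln_div)
  finally have s: "ln ?S2 \<le> ln ?S1 - (2 - r) * l" by simp
  have bV: "b \<le> ?V" using b by simp
  have e1: "(r - 1) * l + ln ?E1 \<le> ln ?E2" unfolding l_def
    by (rule ln_le_ln_powr_mult(1)[OF rp(1) pos(3,4) fdiff_ratio(1)[OF r x(1,2) b(1) bV]])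
  have e2: "ln ?E2 \<le> (r - 1) * ln (x2 / x1) + ln ?E1"
    by (rule ln_le_ln_powr_mult(2)[OF rp(3) pos(3,4) fdiff_ratio(2)[OF r x(1,2) b(1) bV]])
  have "l = (r - 1) * l + (2 - r) * l" by (simp add: algebra_simps)
  \<comment> \<open>From \<open>x1\<close> to \<open>x2\<close>, \<open>ln\<close> of the second
    difference falls by at least \<open>(2 - r) * l\<close> and \<open>ln\<close> of the first rises
    by at least \<open>(r - 1) * l\<close>. In the difference of the two the coefficients cancel,
    and the four measurements allow it to move by at most
    \<open>4 * (2 * \<epsilon>)\<close>.\<close>
  hence l8: "l \<le> 8 * \<epsilon>" using l1 l2 l3 l4 s e1 by (simp only: abs_le_iff) linarith
  define t where "t = (x2 - x1) / (x1 + ?V)"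
  have t: "0 \<le> t" "t \<le> 1" using x b by (auto simp: t_def field_simps)
  have "(x2 + ?V) / (x1 + ?V) = 1 + t" using x b by (simp add: t_def field_simps)
  hence "t / 2 \<le> l" using half_le_ln_one_plus[OF t] by (simp add: l_def)
  hence t16: "t \<le> 16 * \<epsilon>" using l8 by simp
  have l0: "0 \<le> l" unfolding l_def using x b by (intro ln_ge_zero) (auto simp: field_simps)
  have "ln (x2 / x1) \<le> x2 / x1 - 1" using rp by (intro ln_le_minus_one)
  also have "\<dots> = (x2 - x1) / x1" using x by (simp add: field_simps)
  also have "\<dots> \<le> 2 * t"
  proof -
    have "(x2 - x1) * (x1 + ?V) \<le> (x2 - x1) * (2 * x1)" using x b by (intro mult_left_mono) auto
    thus ?thesis using x b by (simp add: t_def field_simps)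
  qed
  finally have "ln (x2 / x1) \<le> 32 * \<epsilon>" using t16 by simp
  moreover have lx0: "0 \<le> ln (x2 / x1)" using x by (intro ln_ge_zero) (auto simp: field_simps)
  moreover have "(r - 1) * ln (x2 / x1) \<le> 1 * ln (x2 / x1)" using lx0 r by (intro mult_right_mono) auto
  moreover have "0 \<le> (r - 1) * l" using r l0 by simp
  \<comment> \<open>36 = 4 + 32: two measurement errors of \<open>2 * \<epsilon>\<close> in
    \<open>a\<close>, and the change of the first difference between the two positions, which are
    now known to be close.\<close>
  ultimately have "\<bar>ln w1 - ln w2\<bar> \<le> 36 * \<epsilon>" using l1 l2 e1 e2 by (simp only: abs_le_iff) linarith
  thus ?thesis using w by (simp add: ln_div)
qed

lemma sum_inverse_le_ln: "(\<Sum>b = 1..n. 1 / real b) \<le> 1 + ln (real n)" if "1 \<le> n"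
  using that
proof (induction n rule: dec_induct)
  case (step n)
  have "ln (real n / real (Suc n)) \<le> real n / real (Suc n) - 1" using step by (intro ln_le_minus_one) auto
  hence "1 / real (Suc n) \<le> ln (real (Suc n)) - ln (real n)" using step by (simp add: ln_div field_simps)
  thus ?case using step by simp
qed simp

section \<open>Lattice points close to a family of curves\<close>

text \<open>\<open>G y\<close> collects abscissas at which curve \<open>y\<close> passes within
  \<delta> of the lattice point of height \<open>z y x\<close>. The assumption
  \<open>separated\<close> converts closeness of coefficients into closeness of indices, hence into
  a bound for the number of curves involved. The last assumption makes the heights strictly increase
  along each curve.\<close>

locale near_curves =
  fixes r X W \<delta> Y :: real and ys :: "nat set" and G :: "nat \<Rightarrow> nat set"
    and w :: "nat \<Rightarrow> real" and z :: "nat \<Rightarrow> nat \<Rightarrow> int"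
  assumes r: "1 < r" "r < 2" and X: "1 \<le> X" and W: "0 < W"
    and fin_ys: "finite ys" and card_ys: "real (card ys) \<le> Y"
    and G: "\<And>y x. y \<in> ys \<Longrightarrow> x \<in> G y \<Longrightarrow> X \<le> real x \<and> real x \<le> 2 * X"
    and w: "\<And>y. y \<in> ys \<Longrightarrow> W \<le> w y \<and> w y \<le> 16 * W"
    and near: "\<And>y x. y \<in> ys \<Longrightarrow> x \<in> G y \<Longrightarrow> \<bar>w y * real x powr r - of_int (z y x)\<bar> \<le> \<delta>"
    and separated: "\<And>y y'. y \<in> ys \<Longrightarrow> y' \<in> ys \<Longrightarrow> \<bar>real y - real y'\<bar> \<le> Y * \<bar>ln (w y / w y')\<bar>"
    and \<delta>: "0 < \<delta>" "4 * \<delta> \<le> W * X powr (r - 1)"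
begin

text \<open>Up to constants, \<open>s\<close> is the slope of the curves, \<open>s / X\<close> their second derivative, and \<open>\<tau>\<close> is the
  tolerance \<open>\<delta>\<close> divided by the second derivative.\<close>

definition s where "s = W * X powr (r - 1)"
definition g where "g = (r - 1) / 2"
definition \<tau> where "\<tau> = \<delta> * X / s"

lemma s_pos: "0 < s" using W X by (simp add: s_def)
lemma g_pos: "0 < g" "g \<le> 1 / 2" using r by (auto simp: g_def)
lemma \<tau>_pos: "0 < \<tau>" using s_pos X \<delta> by (simp add: \<tau>_def)
lemma \<delta>_eq: "\<delta> = \<tau> * (s / X)" using s_pos X by (simp add: \<tau>_def)
lemma \<delta>_le: "4 * \<delta> \<le> s" using \<delta> by (simp add: s_def)
lemma Y_nonneg: "0 \<le> Y" using card_ys by linarith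

lemma W_powr: "W * X powr (r - 2) = s / X"
proof -
  have "X powr (r - 1) = X powr (r - 2) * X powr 1" unfolding powr_add[symmetric] by simp
  thus ?thesis using X by (simp add: s_def)
qed

lemma fin_G: "y \<in> ys \<Longrightarrow> finite (G y)"
proof -
  assume "y \<in> ys"
  hence "G y \<subseteq> {..nat \<lfloor>2 * X\<rfloor>}" using G by (force simp: le_nat_floor)
  thus ?thesis by (rule finite_subset) simp
qed

lemma gap_bounds:
  assumes y: "y \<in> ys" and x: "n \<in> G y" "n + b \<in> G y" and b: "1 \<le> b"
  shows "\<bar>w y * fdiff r (real b) (real n) - of_int (z y (n + b) - z y n)\<bar> \<le> 2 * \<delta>"
    and "s * real b \<le> w y * fdiff r (real b) (real n)"
    and "1 \<le> z y (n + b) - z y n" "of_int (z y (n + b) - z y n) \<le> 66 * s * real b"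
proof -
  let ?a = "z y (n + b) - z y n" and ?e = "w y * fdiff r (real b) (real n)"
  have "?e = w y * real (n + b) powr r - w y * real n powr r" by (simp add: fdiff_def algebra_simps)
  thus 1: "\<bar>?e - of_int ?a\<bar> \<le> 2 * \<delta>" using near[OF y x(1)] near[OF y x(2)] by simp
  have X': "X \<le> real n" "real n + real b \<le> 2 * X" using G[OF y x(1)] G[OF y x(2)] by auto
  have f: "real b * X powr (r - 1) \<le> fdiff r (real b) (real n)" "fdiff r (real b) (real n) \<le> 4 * real b * X powr (r - 1)"
    using fdiff_bounds[of r X "real n" "real b"] r X X' b by auto
  have "W * (real b * X powr (r - 1)) \<le> ?e" using f w[OF y] W by (intro mult_mono) auto
  thus 2: "s * real b \<le> ?e" by (simp add: s_def algebra_simps)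
  have fp: "0 \<le> fdiff r (real b) (real n)" using f(1) by (rule order_trans[rotated]) simp
  have "?e \<le> (16 * W) * (4 * real b * X powr (r - 1))" using f fp w[OF y] W by (intro mult_mono) auto
  hence 3: "?e \<le> 64 * (s * real b)" by (simp add: s_def algebra_simps)
  have sb: "s \<le> s * real b" using s_pos b by simp
  \<comment> \<open>66 = 16 * 4 + 2: the spread of the coefficients, the constant of
    \<open>fdiff_bounds\<close>, and room for the error \<open>2 * \<delta>\<close>.\<close>
  show "of_int ?a \<le> 66 * s * real b" using 1 3 sb \<delta>_le s_pos
    unfolding abs_le_iff mult.assoc by linarith
  have "0 < (of_int ?a :: real)" using 1 2 sb \<delta>_le s_pos unfolding abs_le_iff by linarith
  thus "1 \<le> ?a" by (simp add: ) 
qed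

text \<open>For fixed step \<open>b\<close> the first difference grows in the position at rate at
  least \<open>g * b * s / X\<close>, while at both places it lies within
  \<open>2 * \<delta>\<close> of the same integer.\<close>

lemma gap_spread:
  assumes y: "y \<in> ys" and x: "n \<in> G y" "n + b \<in> G y" "n' \<in> G y" "n' + b \<in> G y" and b: "1 \<le> b" and nn: "n < n'"
    and eq: "z y (n + b) - z y n = z y (n' + b) - z y n'"
  shows "real n' - real n \<le> 4 * \<tau> / (g * real b)"
proof -
  let ?e = "\<lambda>n. fdiff r (real b) (real n)"
  have X': "X \<le> real n" "real n' + real b \<le> 2 * X" using G[OF y x(1)] G[OF y x(4)] by auto
  have "g * real b * X powr (r - 2) * (real n' - real n) \<le> ?e n' - ?e n"
    using fdiff_increment[of r X "real n" "real n'" "real b"] r X X' b nn by (simp add: g_def)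
  hence "W * (g * real b * X powr (r - 2) * (real n' - real n)) \<le> w y * (?e n' - ?e n)"
    using w[OF y] W X g_pos nn by (intro mult_mono) auto
  hence 1: "g * real b * (s / X) * (real n' - real n) \<le> w y * (?e n' - ?e n)"
    unfolding W_powr[symmetric] by (simp add: algebra_simps)
  have "w y * (?e n' - ?e n) \<le> 4 * \<delta>"
    using gap_bounds(1)[OF y x(1,2) b] gap_bounds(1)[OF y x(3,4) b] eq by (simp add: abs_le_iff algebra_simps)
  hence "g * real b * (s / X) * (real n' - real n) \<le> 4 * \<tau> * (s / X)" using 1 \<delta>_eq by simp
  moreover have "g * real b * (s / X) * (real n' - real n) = (s / X) * (g * real b * (real n' - real n))"
    "4 * \<tau> * (s / X) = (s / X) * (4 * \<tau>)" by (simp_all only: mult_ac)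
  ultimately have "(s / X) * (g * real b * (real n' - real n)) \<le> (s / X) * (4 * \<tau>)" by metis
  hence "g * real b * (real n' - real n) \<le> 4 * \<tau>" using s_pos X by (subst (asm) mult_le_cancel_left_pos) auto
  moreover have "0 < g * real b" using g_pos b by simp
  ultimately show ?thesis by (simp add: pos_le_divide_eq mult.commute)
qed

definition gaps where
  "gaps y b = {n \<in> G y. {k \<in> G y. n < k} \<noteq> {} \<and> nxt (G y) n = n + b}"

text \<open>Starts of gaps of length \<open>b\<close> are at least \<open>b\<close> apart, because
  each gap joins consecutive elements; \<open>gap_spread\<close> confines those with a common height
  difference to a short interval.\<close>

lemma card_gaps_fixed_difference:
  assumes y: "y \<in> ys" and b: "1 \<le> b"
  shows "real (card {n \<in> gaps y b. z y (n + b) - z y n = a}) \<le> 1 + 4 * \<tau> / (g * (real b)\<^sup>2)"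
proof -
  have "real (card {n \<in> gaps y b. z y (n + b) - z y n = a}) \<le> 1 + (4 * \<tau> / (g * real b)) / real b"
  proof (rule card_spaced_le)
    show "finite {n \<in> gaps y b. z y (n + b) - z y n = a}" using fin_G[OF y] by (auto simp: gaps_def)
    show "0 < real b" using b by simp
    show "0 \<le> 4 * \<tau> / (g * real b)" using \<tau>_pos g_pos by simp
    fix m n assume "m \<in> {n \<in> gaps y b. z y (n + b) - z y n = a}" "n \<in> {n \<in> gaps y b. z y (n + b) - z y n = a}" and mn: "m < n"
    hence mn': "m \<in> gaps y b" "n \<in> gaps y b" and e: "z y (m + b) - z y m = z y (n + b) - z y n" by auto
    hence m: "m \<in> G y" "m + b \<in> G y" and n: "n \<in> G y" "n + b \<in> G y" and mb: "nxt (G y) m = m + b"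
      using nxt(1)[OF fin_G[OF y]] by (auto simp: gaps_def) metis+
    have "m + b \<le> n" using nxt(3)[OF fin_G[OF y], of m n] mn n mb by auto
    hence "real b \<le> real n - real m" by linarith
    thus "real b \<le> real n - real m \<and> real n - real m \<le> 4 * \<tau> / (g * real b)"
      using gap_spread[OF y m n b mn e] by auto
  qed
  thus ?thesis by (simp add: power2_eq_square)
qed

lemma card_gaps:
  assumes y: "y \<in> ys" and b: "1 \<le> b"
  shows "finite (gaps y b)" "real (card (gaps y b)) \<le> 66 * s * (real b + (4 * \<tau> / g) * (1 / real b))"
proof -
  show fin: "finite (gaps y b)" using fin_G[OF y] by (auto simp: gaps_def)
  let ?J = "{1..\<lfloor>66 * s * real b\<rfloor>}"
  have "real (card (gaps y b)) \<le> (1 + 4 * \<tau> / (g * (real b)\<^sup>2)) * real (card ?J)"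
  proof (rule card_le_mult_fibres(2)[where f = "\<lambda>n. z y (n + b) - z y n"])
    show "(\<lambda>n. z y (n + b) - z y n) ` gaps y b \<subseteq> ?J"
    proof clarify
      fix n assume n: "n \<in> gaps y b"
      hence "n \<in> G y" "n + b \<in> G y" using nxt(1)[OF fin_G[OF y]] by (auto simp: gaps_def) metis+
      from gap_bounds(3,4)[OF y this b] show "z y (n + b) - z y n \<in> ?J" by (simp add: le_floor_iff)
    qed
  qed (use fin card_gaps_fixed_difference[OF y b] in auto)
  also have "real (card ?J) \<le> 66 * s * real b"
  proof -
    define q where "q = 66 * s * real b"
    have "0 \<le> q" using s_pos by (simp add: q_def)
    hence "real (card {1..\<lfloor>q\<rfloor>}) \<le> q" by simp
    thus ?thesis by (simp add: q_def)
  qed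
  also have "(1 + 4 * \<tau> / (g * (real b)\<^sup>2)) * (66 * s * real b) = 66 * s * (real b + (4 * \<tau> / g) * (1 / real b))"
    using b g_pos by (simp add: field_simps power2_eq_square)
  finally show "real (card (gaps y b)) \<le> 66 * s * (real b + (4 * \<tau> / g) * (1 / real b))"
    using \<tau>_pos g_pos by (simp add: mult_left_mono)
qed

text \<open>For a gap length \<open>b\<close> there are at most \<open>66 * s * b\<close> height
  differences, each occurring boundedly often up to a term \<tau> / b^2. Summation over
  \<open>b\<close> gives \<open>B\<^sup>2\<close> from the first part and a harmonic sum, hence the
  logarithm, from the second.\<close>

lemma card_small_gaps:
  assumes y: "y \<in> ys" and B: "0 < B" "B \<le> X"
  defines "S \<equiv> {n \<in> G y. {k \<in> G y. n < k} \<noteq> {} \<and> real (nxt (G y) n) - real n \<le> B}"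
  shows "finite S" "real (card S) \<le> 66 * s * (B\<^sup>2 + 4 * \<tau> / g * (1 + ln X))"
proof -
  define N where "N = nat \<lfloor>B\<rfloor>"
  have N: "real N \<le> B" using B by (simp add: N_def)
  show fS: "finite S" using fin_G[OF y] by (auto simp: S_def)
  have sub: "S \<subseteq> (\<Union>b\<in>{1..N}. gaps y b)"
  proof
    fix n assume n: "n \<in> S"
    hence ne: "{k \<in> G y. n < k} \<noteq> {}" and le: "real (nxt (G y) n) - real n \<le> B" and nG: "n \<in> G y" by (auto simp: S_def)
    define b where "b = nxt (G y) n - n"
    have b: "nxt (G y) n = n + b" "1 \<le> b" using nxt(2)[OF fin_G[OF y] ne] by (auto simp: b_def)
    have "b \<le> N" using le b by (simp add: N_def le_nat_floor)
    thus "n \<in> (\<Union>b\<in>{1..N}. gaps y b)" using b ne nG by (auto simp: gaps_def)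
  qed
  have "card S \<le> (\<Sum>b\<in>{1..N}. card (gaps y b))"
    by (rule order_trans[OF card_mono[OF _ sub] card_UN_le]) (auto intro: card_gaps(1)[OF y])
  hence "real (card S) \<le> (\<Sum>b\<in>{1..N}. real (card (gaps y b)))" by (metis of_nat_le_iff of_nat_sum)
  also have "\<dots> \<le> (\<Sum>b\<in>{1..N}. 66 * s * (real b + (4 * \<tau> / g) * (1 / real b)))"
    using card_gaps(2)[OF y] by (intro sum_mono) auto
  also have "\<dots> = 66 * s * ((\<Sum>b\<in>{1..N}. real b) + (4 * \<tau> / g) * (\<Sum>b\<in>{1..N}. 1 / real b))"
    by (simp add: sum_distrib_left sum.distrib distrib_left)
  also have "\<dots> \<le> 66 * s * (B\<^sup>2 + 4 * \<tau> / g * (1 + ln X))"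
  proof (intro mult_left_mono add_mono)
    have "(\<Sum>b\<in>{1..N}. real b) \<le> (\<Sum>b\<in>{1..N}. real N)" by (intro sum_mono) auto
    also have "\<dots> = (real N)\<^sup>2" by (simp add: power2_eq_square)
    also have "\<dots> \<le> B\<^sup>2" using N by (intro power_mono) auto
    finally show "(\<Sum>b\<in>{1..N}. real b) \<le> B\<^sup>2" .
    show "(\<Sum>b\<in>{1..N}. 1 / real b) \<le> 1 + ln X"
    proof (cases "1 \<le> N")
      case True
      have "ln (real N) \<le> ln X" using True N B by (intro ln_mono) auto
      thus ?thesis using sum_inverse_le_ln[OF True] by linarith
    next
      case False
      thus ?thesis using X by (simp add: not_less_eq_eq)
    qed
  qed (use s_pos \<tau>_pos g_pos in auto)
  finally show "real (card S) \<le> 66 * s * (B\<^sup>2 + 4 * \<tau> / g * (1 + ln X))" .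
qed

section \<open>Triples of consecutive points with both gaps larger than \<open>B\<close>\<close>

context
  fixes B L :: real
  assumes B: "0 < B" "B \<le> X" "8 * \<tau> \<le> g * B\<^sup>2" and L: "0 < L" "L \<le> X"
begin

text \<open>The relative accuracy to which integer differences determine the true first and second
  differences when both gaps exceed \<open>B\<close>. The condition
  \<open>8 * \<tau> \<le> g * B\<^sup>2\<close> of the context says that it is at most 1/2.\<close>

definition \<epsilon> where "\<epsilon> = 4 * \<tau> / (g * B\<^sup>2)"

lemma \<epsilon>_bounds: "0 \<le> \<epsilon>" "\<epsilon> \<le> 1 / 2"
  using B \<tau>_pos g_pos by (auto simp: \<epsilon>_def pos_divide_le_eq)

text \<open>The integer determinant approximates \<open>w y * sdiff\<close>, which is positive by
  convexity, with relative error at most 1/2. Being a positive integer it is at least 1: three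
  consecutive points are never collinear here.\<close>

lemma triple_bounds:
  assumes y: "y \<in> ys" and n: "n \<in> G y" "n + b \<in> G y" "n + b + b' \<in> G y"
    and b: "B < real b" "B < real b'" "real (b + b') \<le> L"
  defines "a \<equiv> z y (n + b) - z y n" and "a' \<equiv> z y (n + b + b') - z y (n + b)"
  shows "0 < fdiff r (real b) (real n)" "0 < sdiff r (real b) (real b') (real n)"
    and "\<bar>of_int a - w y * fdiff r (real b) (real n)\<bar> \<le> \<epsilon> * (w y * fdiff r (real b) (real n))"
    and "\<bar>of_int (a' * int b - a * int b') - w y * sdiff r (real b) (real b') (real n)\<bar>
           \<le> \<epsilon> * (w y * sdiff r (real b) (real b') (real n))"
    and "1 \<le> a' * int b - a * int b'" "of_int (a' * int b - a * int b') \<le> 48 * (s / X) * L ^ 3"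
proof -
  let ?E = "fdiff r (real b) (real n)" and ?S = "sdiff r (real b) (real b') (real n)"
  let ?D = "a' * int b - a * int b'"
  have b1: "1 \<le> b" "1 \<le> b'" using b B by (auto intro: Suc_leI gr0I)
  have wy: "0 < w y" using w[OF y] W by auto
  note gb = gap_bounds[OF y n(1,2) b1(1), folded a_def] and gb' = gap_bounds[OF y n(2,3) b1(2), folded a'_def]
  have X': "X \<le> real n" "real n + real b + real b' \<le> 2 * X" using G[OF y n(1)] G[OF y n(3)] by auto
  have "0 < s * real b" using s_pos b1 by simp
  hence "0 < w y * ?E" using gb(2) by linarith
  thus "0 < ?E" using wy by (simp add: zero_less_mult_iff)
  have sX: "0 < s / X" using s_pos X by simp
  define Q where "Q = real b * real b' * (real b + real b')"
  have Q: "0 < Q" using b1 by (simp add: Q_def)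
  have sd: "(r - 1) / 4 * X powr (r - 2) * Q \<le> ?S" "?S \<le> X powr (r - 2) * Q"
    using sdiff_bounds[of r X "real n" "real b" "real b'"] r X X' b1 by (auto simp: Q_def)
  have "0 < (r - 1) / 4 * X powr (r - 2) * Q" using r X Q by simp
  thus S0: "0 < ?S" using sd(1) by linarith
  have "W * ((r - 1) / 4 * X powr (r - 2) * Q) \<le> w y * ?S" using sd(1) w[OF y] W S0 r Q by (intro mult_mono) auto
  hence S1: "g / 2 * (s / X) * Q \<le> w y * ?S" unfolding W_powr[symmetric] by (simp add: g_def algebra_simps)
  have "w y * ?S \<le> (16 * W) * (X powr (r - 2) * Q)" using sd(2) w[OF y] W S0 by (intro mult_mono) auto
  hence S2: "w y * ?S \<le> 16 * ((s / X) * Q)" unfolding W_powr[symmetric] by (simp add: algebra_simps)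
  have "2 * \<delta> \<le> \<epsilon> * (s * real b)"
  proof -
    have "g * B\<^sup>2 \<le> 1 * (real b * X)"
    proof (intro mult_mono)
      have "B * B \<le> real b * X" using b B by (intro mult_mono) auto
      thus "B\<^sup>2 \<le> real b * X" by (simp add: power2_eq_square)
    qed (use g_pos in auto)
    hence "g * B\<^sup>2 \<le> 2 * (real b * X)" using b1 X by (simp add: order_trans)
    hence "(2 * \<tau> * s) * (g * B\<^sup>2) \<le> (2 * \<tau> * s) * (2 * (real b * X))"
      using \<tau>_pos s_pos by (intro mult_left_mono) auto
    moreover define q where "q = g * B\<^sup>2"
    moreover have q: "0 < q" using g_pos B by (simp add: q_def)
    ultimately have "(2 * \<tau> * s) * q / (q * X) \<le> (2 * \<tau> * s) * (2 * (real b * X)) / (q * X)"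
      using X by (intro divide_right_mono) auto
    moreover have "2 * \<delta> = (2 * \<tau> * s) * q / (q * X)" using q X \<delta>_eq by simp
    moreover have "\<epsilon> * (s * real b) = (2 * \<tau> * s) * (2 * (real b * X)) / (q * X)"
      using X by (simp add: \<epsilon>_def q_def)
    ultimately show ?thesis by simp
  qed
  also have "\<dots> \<le> \<epsilon> * (w y * ?E)" using gb(2) \<epsilon>_bounds by (intro mult_left_mono) auto
  finally show "\<bar>of_int a - w y * ?E\<bar> \<le> \<epsilon> * (w y * ?E)" using gb(1) by linarith
  have "w y * ?S = (w y * fdiff r (real b') (real (n + b))) * real b - (w y * ?E) * real b'"
    by (simp add: sdiff_def algebra_simps)
  hence "of_int ?D - w y * ?S = (of_int a' - w y * fdiff r (real b') (real (n + b))) * real b + (w y * ?E - of_int a) * real b'"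
    by (simp add: algebra_simps)
  also have "\<bar>\<dots>\<bar> \<le> 2 * \<delta> * real b + 2 * \<delta> * real b'"
  proof (rule order_trans[OF abs_triangle_ineq add_mono])
    show "\<bar>(of_int a' - w y * fdiff r (real b') (real (n + b))) * real b\<bar> \<le> 2 * \<delta> * real b"
      using gb'(1) by (simp add: abs_mult abs_minus_commute mult_right_mono)
    show "\<bar>(w y * ?E - of_int a) * real b'\<bar> \<le> 2 * \<delta> * real b'"
      using gb(1) by (simp add: abs_mult mult_right_mono)
  qed
  also have "\<dots> = 2 * \<delta> * (real b + real b')" by (simp add: distrib_left)
  also have "2 * \<delta> = 2 * \<tau> * (s / X)" using \<delta>_eq by simp
  \<comment> \<open>The factor \<open>b + b'\<close> occurs both in the error and in the true area,
    so their quotient is governed by \<open>1 / (b * b')\<close>, which is below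
    \<open>1 / B\<^sup>2\<close>.\<close>
  also have "2 * \<tau> * (s / X) * (real b + real b') \<le> \<epsilon> * (g / 2 * (s / X) * Q)"
  proof -
    have "B * B \<le> real b * real b'" using b B by (intro mult_mono) auto
    moreover define A where "A = 2 * \<tau> * (s / X) * (real b + real b')"
    moreover have "0 \<le> A" using \<tau>_pos s_pos X by (simp add: A_def)
    ultimately have "A * (B * B) \<le> A * (real b * real b')" by (intro mult_left_mono)
    hence "A \<le> A * (real b * real b') / (B * B)" using B by (simp add: pos_le_divide_eq)
    also have "\<dots> = \<epsilon> * (g / 2 * (s / X) * Q)"
      using g_pos B by (simp add: \<epsilon>_def Q_def A_def power2_eq_square mult_ac)
    finally show ?thesis by (simp add: A_def)
  qed
  also have "\<dots> \<le> \<epsilon> * (w y * ?S)" using S1 \<epsilon>_bounds by (intro mult_left_mono) auto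
  finally show D: "\<bar>of_int ?D - w y * ?S\<bar> \<le> \<epsilon> * (w y * ?S)" .
  have wS: "0 < w y * ?S" using S0 wy by simp
  hence "\<epsilon> * (w y * ?S) \<le> 1 / 2 * (w y * ?S)" using \<epsilon>_bounds by (intro mult_right_mono) auto
  hence D': "0 < (of_int ?D :: real)" "of_int ?D \<le> 2 * (w y * ?S)" using D wS by linarith+
  from D'(1) show "1 \<le> ?D" by linarith
  have "Q \<le> L * L * L" unfolding Q_def using b by (intro mult_mono) auto
  hence "(s / X) * Q \<le> (s / X) * L ^ 3" using sX by (intro mult_left_mono) (auto simp: power3_eq_cube)
  moreover have "0 \<le> (s / X) * L ^ 3" using s_pos X L by simp
  ultimately show "of_int ?D \<le> 48 * (s / X) * L ^ 3" using D'(2) S2 by linarith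
qed

text \<open>The longer difference vector \<open>(b, a)\<close> comes first, because \<open>card_lattice_points_near_line\<close> bounds the number
  of companions \<open>(v, u)\<close> only for \<open>v \<le> b\<close>; the other order is obtained by \<open>swap_shape\<close>.\<close>

definition shapes where
  "shapes = (\<Union>b\<in>{1..\<lfloor>L\<rfloor>}. \<Union>a\<in>{1..\<lfloor>66 * s * L\<rfloor>}.
     (\<lambda>(v, u). (b, a, v, u)) ` {(v, u). 1 \<le> v \<and> v \<le> b \<and> u * b - a * v \<noteq> 0 \<and> \<bar>u * b - a * v\<bar> \<le> \<lfloor>48 * (s / X) * L ^ 3\<rfloor>})"

text \<open>There are \<open>L\<close> choices of \<open>b\<close>, \<open>66 * s * L\<close> of
  \<open>a\<close>, and \<open>2 * 48 * (s / X) * L ^ 3\<close> companions by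
  \<open>card_lattice_points_near_line\<close>; 6336 = 66 * 2 * 48.\<close>

lemma card_shapes: "finite shapes" "real (card shapes) \<le> 6336 * s\<^sup>2 * L ^ 5 / X"
proof -
  let ?Z = "\<lfloor>48 * (s / X) * L ^ 3\<rfloor>"
  let ?S = "\<lambda>b a. {(v, u). 1 \<le> v \<and> v \<le> b \<and> u * b - a * v \<noteq> 0 \<and> \<bar>u * b - a * v\<bar> \<le> ?Z}"
  have Z: "0 \<le> ?Z" using s_pos X L by simp
  have *: "finite (?S b a)" "int (card (?S b a)) \<le> 2 * ?Z" if "1 \<le> b" for a b
    using card_lattice_points_near_line[OF that Z, of a] by auto
  show "finite shapes" unfolding shapes_def using * by auto
  have "card shapes \<le> (\<Sum>b\<in>{1..\<lfloor>L\<rfloor>}. card (\<Union>a\<in>{1..\<lfloor>66 * s * L\<rfloor>}. (\<lambda>(v, u). (b, a, v, u)) ` ?S b a))"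
    unfolding shapes_def by (rule card_UN_le) simp
  also have "\<dots> \<le> (\<Sum>b\<in>{1..\<lfloor>L\<rfloor>}. \<Sum>a\<in>{1..\<lfloor>66 * s * L\<rfloor>}. card ((\<lambda>(v, u). (b, a, v, u)) ` ?S b a))"
    by (intro sum_mono card_UN_le) simp
  also have "\<dots> \<le> (\<Sum>b\<in>{1..\<lfloor>L\<rfloor>}. \<Sum>a\<in>{1..\<lfloor>66 * s * L\<rfloor>}. nat (2 * ?Z))"
  proof (intro sum_mono)
    fix b a assume "b \<in> {1..\<lfloor>L\<rfloor>}"
    hence b: "1 \<le> b" by simp
    have "card ((\<lambda>(v, u). (b, a, v, u)) ` ?S b a) \<le> card (?S b a)" by (rule card_image_le[OF *(1)[OF b]])
    thus "card ((\<lambda>(v, u). (b, a, v, u)) ` ?S b a) \<le> nat (2 * ?Z)" using *(2)[OF b, of a] by linarith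
  qed
  also have "\<dots> = nat \<lfloor>L\<rfloor> * (nat \<lfloor>66 * s * L\<rfloor> * nat (2 * ?Z))" by simp
  finally have "real (card shapes) \<le> real (nat \<lfloor>L\<rfloor>) * (real (nat \<lfloor>66 * s * L\<rfloor>) * real (nat (2 * ?Z)))"
    by (metis of_nat_le_iff of_nat_mult)
  also have "\<dots> \<le> L * ((66 * s * L) * (2 * (48 * (s / X) * L ^ 3)))"
  proof (intro mult_mono)
    have "real (nat (2 * ?Z)) = 2 * of_int ?Z" using Z by (subst of_nat_nat) auto
    thus "real (nat (2 * ?Z)) \<le> 2 * (48 * (s / X) * L ^ 3)" using of_int_floor_le[of "48 * (s / X) * L ^ 3"] by linarith
  qed (use Z L s_pos X in auto)
  also have "\<dots> = 6336 * s\<^sup>2 * L ^ 5 / X" by (simp add: power2_eq_square eval_nat_numeral)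
  finally show "real (card shapes) \<le> 6336 * s\<^sup>2 * L ^ 5 / X" .
qed

definition swap_shape :: "int \<times> int \<times> int \<times> int \<Rightarrow> int \<times> int \<times> int \<times> int" where
  "swap_shape = (\<lambda>(b, a, v, u). (v, u, b, a))"

definition wide where
  "wide = {(y, n). y \<in> ys \<and> n \<in> triple_starts (G y) L \<and> B < real (nxt (G y) n) - real n
     \<and> B < real (nxt (G y) (nxt (G y) n)) - real (nxt (G y) n)}"

definition shape :: "nat \<times> nat \<Rightarrow> int \<times> int \<times> int \<times> int" where
  "shape = (\<lambda>(y, n). let n' = nxt (G y) n; n'' = nxt (G y) n' in
     (int n' - int n, z y n' - z y n, int n'' - int n', z y n'' - z y n'))"

lemma wideE:
  assumes "(y, n) \<in> wide"
  obtains b b' where "y \<in> ys" "n \<in> gaps y b" "n \<in> G y" "n + b \<in> G y" "n + b + b' \<in> G y" "B < real b" "B < real b'" "real (b + b') \<le> L"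
    "1 \<le> b" "1 \<le> b'"
    "shape (y, n) = (int b, z y (n + b) - z y n, int b', z y (n + b + b') - z y (n + b))"
proof -
  let ?A = "G y"
  have y: "y \<in> ys" and n: "n \<in> ?A" and ne: "{k \<in> ?A. n < k} \<noteq> {}" "{k \<in> ?A. nxt ?A n < k} \<noteq> {}"
    and le: "real (nxt ?A (nxt ?A n)) \<le> real n + L"
    and B1: "B < real (nxt ?A n) - real n" "B < real (nxt ?A (nxt ?A n)) - real (nxt ?A n)"
    using assms by (auto simp: wide_def triple_starts_def)
  note n1 = nxt[OF fin_G[OF y] ne(1)] and n2 = nxt[OF fin_G[OF y] ne(2)]
  define b where "b = nxt ?A n - n"
  define b' where "b' = nxt ?A (nxt ?A n) - nxt ?A n"
  have e: "nxt ?A n = n + b" "nxt ?A (n + b) = n + b + b'" "1 \<le> b" "1 \<le> b'" using n1(2) n2(2) by (auto simp: b_def b'_def)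
  show ?thesis
  proof (rule that[of b b'])
    show "n \<in> gaps y b" using n ne e by (auto simp: gaps_def)
    show "n + b \<in> G y" "n + b + b' \<in> G y" using n1 n2 e by auto
    show "B < real b" "B < real b'" "real (b + b') \<le> L" using B1 le e by auto
    show "shape (y, n) = (int b, z y (n + b) - z y n, int b', z y (n + b + b') - z y (n + b))"
      using e by (simp add: shape_def Let_def)
  qed (use y n e in auto)
qed

lemma shape_in_shapes:
  assumes "p \<in> wide"
  shows "shape p \<in> shapes \<union> swap_shape ` shapes"
proof -
  obtain y n where p: "p = (y, n)" by force
  from wideE[OF assms[unfolded p]] obtain b b' where
    y: "y \<in> ys" and n: "n \<in> G y" "n + b \<in> G y" "n + b + b' \<in> G y"
    and b: "B < real b" "B < real b'" "real (b + b') \<le> L" and b1: "1 \<le> b" "1 \<le> b'"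
    and sh: "shape (y, n) = (int b, z y (n + b) - z y n, int b', z y (n + b + b') - z y (n + b))" by metis
  define a where "a = z y (n + b) - z y n"
  define a' where "a' = z y (n + b + b') - z y (n + b)"
  note t = triple_bounds(5,6)[OF y n b, folded a_def a'_def]
  have Z: "a' * int b - a * int b' \<le> \<lfloor>48 * (s / X) * L ^ 3\<rfloor>" using t(2) by (simp only: le_floor_iff)
  have bL: "int b \<le> \<lfloor>L\<rfloor>" "int b' \<le> \<lfloor>L\<rfloor>" using b by (auto simp: le_floor_iff)
  have aL: "k \<le> \<lfloor>66 * s * L\<rfloor>" if "of_int k \<le> 66 * s * real m" "real m \<le> L" for k m
  proof -
    have "66 * s * real m \<le> 66 * s * L" using that s_pos by (intro mult_left_mono) auto
    thus ?thesis using that(1) by (simp only: le_floor_iff)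
  qed
  have a: "1 \<le> a" "a \<le> \<lfloor>66 * s * L\<rfloor>" using gap_bounds(3,4)[OF y n(1,2) b1(1), folded a_def] aL[of a b] b by auto
  have a': "1 \<le> a'" "a' \<le> \<lfloor>66 * s * L\<rfloor>" using gap_bounds(3,4)[OF y n(2,3) b1(2), folded a'_def] aL[of a' b'] b by auto
  show ?thesis
  proof (cases "b' \<le> b")
    case True
    have "(int b, a, int b', a') \<in> shapes" unfolding shapes_def using True bL a b1 t(1) Z by force
    thus ?thesis using sh p by (simp add: a_def a'_def)
  next
    case False
    have "\<bar>a * int b' - a' * int b\<bar> \<le> \<lfloor>48 * (s / X) * L ^ 3\<rfloor>" "a * int b' - a' * int b \<noteq> 0"
      using t(1) Z by linarith+
    hence "(int b', a', int b, a) \<in> shapes" unfolding shapes_def using False bL a' b1 by force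
    hence "swap_shape (int b', a', int b, a) \<in> swap_shape ` shapes" by (rule imageI)
    thus ?thesis using sh p by (simp add: swap_shape_def a_def a'_def)
  qed
qed


lemma same_shape_close:
  assumes "(y1, n1) \<in> wide" "(y2, n2) \<in> wide" "shape (y1, n1) = shape (y2, n2)" "n1 \<le> n2"
  shows "\<bar>ln (w y1 / w y2)\<bar> \<le> 36 * \<epsilon>"
proof -
  obtain b b' where 1: "y1 \<in> ys" "n1 \<in> G y1" "n1 + b \<in> G y1" "n1 + b + b' \<in> G y1"
    and bb: "B < real b" "B < real b'" "real (b + b') \<le> L" "1 \<le> b" "1 \<le> b'"
    and sh1: "shape (y1, n1) = (int b, z y1 (n1 + b) - z y1 n1, int b', z y1 (n1 + b + b') - z y1 (n1 + b))"
    using wideE[OF assms(1)] by metis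
  obtain b2 b2' where 2: "y2 \<in> ys" "n2 \<in> G y2" "n2 + b2 \<in> G y2" "n2 + b2 + b2' \<in> G y2"
    and sh2: "shape (y2, n2) = (int b2, z y2 (n2 + b2) - z y2 n2, int b2', z y2 (n2 + b2 + b2') - z y2 (n2 + b2))"
    using wideE[OF assms(2)] by metis
  have eq: "b2 = b" "b2' = b'" "z y2 (n2 + b2) - z y2 n2 = z y1 (n1 + b) - z y1 n1"
    "z y2 (n2 + b2 + b2') - z y2 (n2 + b2) = z y1 (n1 + b + b') - z y1 (n1 + b)"
    using assms(3) sh1 sh2 by auto
  note eq' = eq(3,4)[unfolded eq(1,2)]
  note t1 = triple_bounds[OF 1 bb(1-3)] and t2 = triple_bounds[OF 2(1,2,3,4)[unfolded eq(1,2)] bb(1-3), unfolded eq']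
  have X1: "X \<le> real n1" "real n2 \<le> 2 * X" using G[OF 1(1,2)] G[OF 2(1,2)] by auto
  have wp: "0 < w y1" "0 < w y2" using w[OF 1(1)] w[OF 2(1)] W by auto
  show ?thesis
  proof (rule curve_determined_by_differences[OF r _ _ _ _ _ _ wp t1(2) t2(2) t1(1) t2(1) \<epsilon>_bounds t1(3) t2(3) t1(4) t2(4)])
    show "real n1 \<le> real n2" "real n2 \<le> 2 * real n1" "0 < real n1" using X1 X assms(4) by auto
    show "0 < real b" "0 < real b'" "real b + real b' \<le> real n1" using bb X1 L by auto
  qed
qed

lemma finite_wide: "finite wide"
proof (rule finite_subset)
  show "wide \<subseteq> Sigma ys G" by (auto simp: wide_def triple_starts_def)
  show "finite (Sigma ys G)" using fin_ys fin_G by auto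
qed

text \<open>A shape belongs to curves whose indices differ by at most
  \<open>36 * \<epsilon> * Y\<close>, hence to at most \<open>1 + 36 * \<epsilon> * Y\<close> of
  them. On each curve it occurs at most \<open>1 + \<epsilon>\<close>, so at most 2, times. The
  remaining factor 2 accounts for both orders of the two vectors.\<close>

lemma card_wide: "real (card wide) \<le> 25344 * s\<^sup>2 * L ^ 5 / X * (1 + 36 * \<epsilon> * Y)"
proof -
  let ?J = "shapes \<union> swap_shape ` shapes"
  have "real (card wide) \<le> (2 * (1 + 36 * \<epsilon> * Y)) * real (card ?J)"
  proof (rule card_le_mult_fibres(2)[where f = shape])
    show "finite ?J" using card_shapes(1) by auto
    show "shape ` wide \<subseteq> ?J" by (rule image_subsetI) (erule shape_in_shapes)
    fix j
    let ?F = "{p \<in> wide. shape p = j}"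
    show fF: "finite ?F" using finite_wide by auto
    have "real (card ?F) \<le> 2 * real (card (fst ` ?F))"
    proof (rule card_le_mult_fibres(2)[where f = fst])
      fix y assume "y \<in> fst ` ?F"
      let ?H = "{p \<in> ?F. fst p = y}"
      show fH: "finite ?H" by (rule finite_subset[OF _ fF]) auto
      have "\<exists>n. (y, n) \<in> ?F" using \<open>y \<in> fst ` ?F\<close> by force
      then obtain n0 where n0: "(y, n0) \<in> wide" "shape (y, n0) = j" by auto
      obtain b b' where y: "y \<in> ys" and b: "B < real b" "1 \<le> b"
        and j: "shape (y, n0) = (int b, z y (n0 + b) - z y n0, int b', z y (n0 + b + b') - z y (n0 + b))"
        using wideE[OF n0(1)] by metis
      define a where "a = z y (n0 + b) - z y n0"
      let ?K = "{n \<in> gaps y b. z y (n + b) - z y n = a}"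
      have "snd ` ?H \<subseteq> ?K"
      proof (rule image_subsetI)
        fix p assume p: "p \<in> ?H"
        then obtain n where pn: "p = (y, n)" by (cases p) auto
        have yn: "(y, n) \<in> wide" "shape (y, n) = shape (y, n0)" using p pn n0 by auto
        obtain b2 b2' where "n \<in> gaps y b2"
          "shape (y, n) = (int b2, z y (n + b2) - z y n, int b2', z y (n + b2 + b2') - z y (n + b2))"
          using wideE[OF yn(1)] by metis
        thus "snd p \<in> ?K" using yn(2) j pn by (auto simp: a_def)
      qed
      moreover have "finite ?K" using card_gaps(1)[OF y b(2)] by auto
      moreover have "inj_on snd ?H" by (auto intro!: inj_onI simp: prod_eq_iff)
      ultimately have "card ?H \<le> card ?K" by (meson card_inj_on_le)
      also have "real (card ?K) \<le> 1 + 4 * \<tau> / (g * (real b)\<^sup>2)" by (rule card_gaps_fixed_difference[OF y b(2)])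
      also have "\<dots> \<le> 1 + \<epsilon>" unfolding \<epsilon>_def
        using b B g_pos \<tau>_pos by (intro add_left_mono divide_left_mono mult_left_mono power_mono) auto
      finally show "real (card ?H) \<le> 2" using \<epsilon>_bounds by simp
    qed (use fF in auto)
    also have "real (card (fst ` ?F)) \<le> 1 + (36 * \<epsilon> * Y) / 1"
    proof (rule card_spaced_le)
      fix m n assume "m \<in> fst ` ?F" "n \<in> fst ` ?F" and mn: "m < n"
      have "\<exists>k. (m, k) \<in> ?F" using \<open>m \<in> fst ` ?F\<close> by force
      then obtain k where k: "(m, k) \<in> wide" "shape (m, k) = j" by auto
      have "\<exists>k. (n, k) \<in> ?F" using \<open>n \<in> fst ` ?F\<close> by force
      then obtain l where l: "(n, l) \<in> wide" "shape (n, l) = j" by auto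
      have mny: "m \<in> ys" "n \<in> ys" using k l by (auto simp: wide_def)
      have wp: "0 < w m" "0 < w n" using w[OF mny(1)] w[OF mny(2)] W by auto
      have "\<bar>ln (w m / w n)\<bar> \<le> 36 * \<epsilon>"
      proof (cases "k \<le> l")
        case True
        thus ?thesis using same_shape_close[OF k(1) l(1)] k l by simp
      next
        case False
        hence "\<bar>ln (w n / w m)\<bar> \<le> 36 * \<epsilon>" using same_shape_close[OF l(1) k(1)] k l by simp
        thus ?thesis using wp by (simp add: ln_div abs_minus_commute)
      qed
      hence "Y * \<bar>ln (w m / w n)\<bar> \<le> Y * (36 * \<epsilon>)" using Y_nonneg by (intro mult_left_mono) auto
      hence "\<bar>real m - real n\<bar> \<le> 36 * \<epsilon> * Y" using separated[OF mny] by (simp add: mult_ac)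
      thus "1 \<le> real n - real m \<and> real n - real m \<le> 36 * \<epsilon> * Y" using mn by auto
    qed (use fF \<epsilon>_bounds Y_nonneg in auto)
    finally show "real (card ?F) \<le> 2 * (1 + 36 * \<epsilon> * Y)" by simp
  qed
  also have "\<dots> \<le> (2 * (1 + 36 * \<epsilon> * Y)) * (2 * (6336 * s\<^sup>2 * L ^ 5 / X))"
  proof (intro mult_left_mono)
    have "real (card ?J) \<le> 2 * real (card shapes)"
      using card_Un_le[of shapes "swap_shape ` shapes"] card_image_le[OF card_shapes(1), of swap_shape] by simp
    thus "real (card ?J) \<le> 2 * (6336 * s\<^sup>2 * L ^ 5 / X)" using card_shapes(2) by linarith
  qed (use \<epsilon>_bounds Y_nonneg in auto)
  finally show ?thesis by (simp add: mult_ac)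
qed

text \<open>A point fails to start a short triple, or its first gap is short, or its second gap is
  short, or it starts a wide triple. The first three kinds are counted curve by curve, the last one
  over the whole family.\<close>

theorem sum_card_G_le:
  "(\<Sum>y\<in>ys. real (card (G y))) \<le> 2 * Y * (X / L + 1) + 132 * Y * s * (B\<^sup>2 + 4 * \<tau> / g * (1 + ln X))
     + 25344 * s\<^sup>2 * L ^ 5 / X * (1 + 36 * \<epsilon> * Y)"
proof -
  define H where "H = (\<lambda>y. {n. (y, n) \<in> wide})"
  let ?R = "66 * s * (B\<^sup>2 + 4 * \<tau> / g * (1 + ln X))"
  have fH: "finite (H y)" if "y \<in> ys" for y
    by (rule finite_subset[OF _ fin_G[OF that]]) (auto simp: H_def wide_def triple_starts_def)
  have one: "real (card (G y)) \<le> 2 * (X / L + 1) + 2 * ?R + real (card (H y))" if y: "y \<in> ys" for y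
  proof -
    let ?A = "G y" and ?T = "triple_starts (G y) L"
    define S where "S = {n \<in> ?A. {k \<in> ?A. n < k} \<noteq> {} \<and> real (nxt ?A n) - real n \<le> B}"
    define S2 where "S2 = {n \<in> ?T. nxt ?A n \<in> S}"
    note cs = card_small_gaps[OF y B(1,2), folded S_def]
    have fT: "finite ?T" using fin_G[OF y] by (auto simp: triple_starts_def)
    have fS2: "finite S2" using fT by (auto simp: S2_def)
    have sub: "?A \<subseteq> (?A - ?T) \<union> S \<union> S2 \<union> H y"
    proof
      fix n assume n: "n \<in> ?A"
      show "n \<in> (?A - ?T) \<union> S \<union> S2 \<union> H y"
      proof (cases "n \<in> ?T")
        case True
        hence ne: "{k \<in> ?A. n < k} \<noteq> {}" "{k \<in> ?A. nxt ?A n < k} \<noteq> {}" by (auto simp: triple_starts_def)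
        show ?thesis using nxt(1)[OF fin_G[OF y] ne(1)] ne n True y
          by (auto simp: S_def S2_def H_def wide_def not_le)
      qed (use n in auto)
    qed
    \<comment> \<open>The successor map sends points with a short second gap injectively to points
      with a short first gap, so the same bound serves twice.\<close>
    have "inj_on (nxt ?A) S2"
    proof (rule linorder_inj_onI')
      fix m n assume "m \<in> S2" "n \<in> S2" "m < n"
      hence ne: "{k \<in> ?A. m < k} \<noteq> {}" "{k \<in> ?A. n < k} \<noteq> {}" and n: "n \<in> ?A" by (auto simp: S2_def triple_starts_def)
      have "nxt ?A m \<le> n" using nxt(3)[OF fin_G[OF y] ne(1) n \<open>m < n\<close>] .
      also have "n < nxt ?A n" using nxt(2)[OF fin_G[OF y] ne(2)] .
      finally show "nxt ?A m \<noteq> nxt ?A n" by simp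
    qed
    hence "card S2 \<le> card S" by (rule card_inj_on_le) (use cs(1) in \<open>auto simp: S2_def\<close>)
    hence "real (card S2) \<le> ?R" using cs(2) by linarith
    moreover have "real (card (?A - ?T)) \<le> 2 * (X / L + 1)"
      using card_not_triple_starts[OF fin_G[OF y] _ L(1), of X] X G[OF y] by auto
    moreover have "card ?A \<le> card (?A - ?T) + card S + card S2 + card (H y)"
    proof -
      have "card ?A \<le> card ((?A - ?T) \<union> S \<union> S2 \<union> H y)"
        by (rule card_mono[OF _ sub]) (use fin_G[OF y] cs(1) fS2 fH[OF y] in auto)
      thus ?thesis
        using card_Un_le[of "(?A - ?T) \<union> S \<union> S2" "H y"] card_Un_le[of "(?A - ?T) \<union> S" S2] card_Un_le[of "?A - ?T" S] by linarith
    qed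
    ultimately show ?thesis using cs(2) by linarith
  qed
  have "(\<Sum>y\<in>ys. real (card (G y))) \<le> (\<Sum>y\<in>ys. 2 * (X / L + 1) + 2 * ?R + real (card (H y)))"
    using one by (intro sum_mono) auto
  also have "\<dots> = real (card ys) * (2 * (X / L + 1) + 2 * ?R) + real (\<Sum>y\<in>ys. card (H y))"
    by (simp add: sum.distrib)
  also have "(\<Sum>y\<in>ys. card (H y)) = card (Sigma ys H)"
    by (rule card_SigmaI[symmetric]) (use fin_ys fH in auto)
  also have "Sigma ys H = wide" by (auto simp: H_def wide_def)
  also have "real (card ys) * (2 * (X / L + 1) + 2 * ?R) + real (card wide)
      \<le> Y * (2 * (X / L + 1) + 2 * ?R) + 25344 * s\<^sup>2 * L ^ 5 / X * (1 + 36 * \<epsilon> * Y)"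
    using card_ys card_wide X L s_pos \<tau>_pos g_pos by (intro add_mono mult_right_mono) auto
  finally show ?thesis by (simp add: algebra_simps)
qed

end

end

section \<open>Large square divisors\<close>

abbreviation square_divides :: "real \<Rightarrow> nat \<Rightarrow> nat \<Rightarrow> bool" where
  "square_divides c n d \<equiv> (int d)\<^sup>2 dvd \<lfloor>real n powr c\<rfloor>"

abbreviation square_multiples :: "real \<Rightarrow> real \<Rightarrow> nat \<Rightarrow> nat set" where
  "square_multiples c x d \<equiv> {n. 1 \<le> n \<and> real n \<le> x \<and> square_divides c n d}"

definition square_divisor_pairs :: "real \<Rightarrow> real \<Rightarrow> real \<Rightarrow> (nat \<times> nat) set" where
  "square_divisor_pairs c N D =
     {(n, d). N < real n \<and> real n \<le> 2 * N \<and> D < real d \<and> real d \<le> 2 * D \<and> square_divides c n d}"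

text \<open>Supplies the assumption \<open>separated\<close> for families whose coefficients are
  powers of the index.\<close>

lemma abs_diff_le_ln:
  assumes "0 < a" "0 < b" "a \<le> M" "b \<le> (M::real)"
  shows "\<bar>a - b\<bar> \<le> M * \<bar>ln (a / b)\<bar>"
proof -
  have *: "\<bar>a - b\<bar> \<le> M * \<bar>ln (a / b)\<bar>" if "0 < a" "0 < b" "a \<le> M" "b \<le> a" for a b
  proof -
    have "ln (b / a) \<le> b / a - 1" using that by (intro ln_le_minus_one) auto
    hence "1 - b / a \<le> ln (a / b)" using that by (simp add: ln_div)
    hence "M * (1 - b / a) \<le> M * ln (a / b)" using that by (intro mult_left_mono) auto
    moreover have "a * (1 - b / a) \<le> M * (1 - b / a)" using that by (intro mult_right_mono) auto
    moreover have "a * (1 - b / a) = a - b" using that by (simp add: right_diff_distrib)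
    moreover have "M * ln (a / b) \<le> M * \<bar>ln (a / b)\<bar>" using that by (intro mult_left_mono) auto
    ultimately show ?thesis using that by linarith
  qed
  have "\<bar>ln (a / b)\<bar> = \<bar>ln (b / a)\<bar>" using assms by (simp add: ln_div)
  thus ?thesis using *[of a b] *[of b a] assms by (cases "b \<le> a") (auto simp: abs_minus_commute)
qed

lemma one_plus_ln_le:
  assumes "1 \<le> N" "0 < \<eta>"
  shows "1 + ln N \<le> (1 + 1 / \<eta>) * N powr (\<eta>::real)"
proof -
  have "1 \<le> N powr \<eta>" using assms by (intro ge_one_powr_ge_zero) auto
  thus ?thesis using ln_powr_bound[OF assms] by (simp add: algebra_simps)
qed

lemma card_nat_interval_le:
  assumes "0 \<le> (b::real)" "\<And>n. n \<in> S \<Longrightarrow> 1 \<le> n \<and> real n \<le> b"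
  shows "finite S" "real (card S) \<le> b"
proof -
  have sub: "S \<subseteq> {1..nat \<lfloor>b\<rfloor>}" using assms by (auto simp: le_nat_floor)
  show "finite S" by (rule finite_subset[OF sub]) simp
  have "card S \<le> nat \<lfloor>b\<rfloor>" using card_mono[OF _ sub] by simp
  thus "real (card S) \<le> b" using assms(1) by linarith
qed

lemma powr_calculus:
  fixes N :: real
  assumes "1 \<le> N"
  shows "N powr a * N powr b = N powr (a + b)" "N powr a / N powr b = N powr (a - b)"
    "(N powr a) powr b = N powr (a * b)" "(N powr a) ^ k = N powr (real k * a)"
    "0 < N powr a" "N powr 1 = N" "a \<le> b \<Longrightarrow> N powr a \<le> N powr b"
  using assms by (simp_all add: powr_add powr_diff powr_powr powr_power mult.commute powr_mono)

text \<open>The curves are indexed by \<open>d\<close>, with \<open>z = n powr c / d\<^sup>2\<close>.  The block length is \<open>L = D * N powr \<eta>\<close>, just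
  long enough for the points outside short triples to be negligible, and \<open>B\<^sup>2 = D * N powr (2 - c - 2 * \<eta>)\<close>
  is just small enough for the short gaps to be negligible.\<close>

lemma card_pairs_small_divisor:
  fixes c \<eta> \<theta> N :: real
  assumes c: "1 < c" "c < 12 / 7" and \<eta>: "0 < \<eta>" "7 * \<eta> \<le> 1" "8 * \<eta> \<le> 4 - 7 * c / 3"
    and \<theta>: "3 * \<eta> \<le> \<theta>" "3 * \<theta> \<le> c"
    and N: "1 \<le> N" "16 \<le> N powr (c - 1)" "64 / (c - 1) \<le> N powr \<eta>"
  shows "real (card (square_divisor_pairs c N (N powr \<theta>)))
    \<le> (16 + 132 * (1 + 32 / (c - 1) * (1 + 1 / \<eta>)) + 1584 * (1 + 4608 / (c - 1))) * N powr (1 - \<eta>)"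
proof -
  define P where "P = (\<lambda>e. N powr e)"
  note calc = powr_calculus[OF N(1), folded P_def]
  note PA = calc(1) and Pd = calc(2) and Pr = calc(3) and Pp = calc(4) and P0 = calc(5) and P1 = calc(6) and PM = calc(7)
  define D where "D = P \<theta>"
  have D: "1 \<le> D" using N \<theta> \<eta> by (simp add: D_def P_def ge_one_powr_ge_zero)
  define ys where "ys = {d::nat. D < real d \<and> real d \<le> 2 * D}"
  define G where "G = (\<lambda>d::nat. {n::nat. N < real n \<and> real n \<le> 2 * N \<and> square_divides c n d})"
  define g where "g = (c - 1) / 2"
  have g: "0 < g" using c by (simp add: g_def)
  have ys: "finite ys" "real (card ys) \<le> 2 * D" using card_nat_interval_le[of "2 * D" ys] D by (auto simp: ys_def)
  \<comment> \<open>Taking the floor changes \<open>n powr c\<close> by less than 1, so division by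
    \<open>d\<^sup>2\<close> leaves a tolerance of \<open>1 / D\<^sup>2\<close>. The least
    coefficient \<open>1 / (4 * D\<^sup>2)\<close> belongs to the largest divisor
    \<open>2 * D\<close>.\<close>
  interpret nc: near_curves c N "1 / (4 * D\<^sup>2)" "1 / D\<^sup>2" "2 * D * 2" ys G "\<lambda>d. 1 / (real d)\<^sup>2" "\<lambda>d n. \<lfloor>real n powr c\<rfloor> div (int d)\<^sup>2"
  proof
    fix d assume "d \<in> ys"
    hence d: "D < real d" "real d \<le> 2 * D" by (auto simp: ys_def)
    have "D\<^sup>2 \<le> (real d)\<^sup>2" "(real d)\<^sup>2 \<le> (2 * D)\<^sup>2" using d D power_mono[of D "real d" 2] power_mono[of "real d" "2 * D" 2] by auto
    hence "1 / (4 * D\<^sup>2) \<le> 1 / (real d)\<^sup>2" "1 / (real d)\<^sup>2 \<le> 1 / D\<^sup>2"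
      using D d by (intro divide_left_mono; simp)+
    moreover have "0 \<le> 1 / D\<^sup>2" by simp
    ultimately show "1 / (4 * D\<^sup>2) \<le> 1 / (real d)\<^sup>2 \<and> 1 / (real d)\<^sup>2 \<le> 16 * (1 / (4 * D\<^sup>2))" by simp
    fix n assume n: "n \<in> G d"
    show "N \<le> real n \<and> real n \<le> 2 * N" using n by (auto simp: G_def)
    define k where "k = \<lfloor>real n powr c\<rfloor>"
    have "(int d)\<^sup>2 dvd k" using n by (simp add: G_def k_def)
    then obtain m where m: "k = (int d)\<^sup>2 * m" by (elim dvdE)
    have d0: "0 < (real d)\<^sup>2" using d D by simp
    have "k div (int d)\<^sup>2 = m" using m d0 by simp
    moreover have "\<bar>1 / (real d)\<^sup>2 * real n powr c - of_int m\<bar> \<le> 1 / D\<^sup>2"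
    proof -
      have k: "of_int k \<le> real n powr c" "real n powr c < of_int k + 1" unfolding k_def by linarith+
      have "of_int k = (real d)\<^sup>2 * of_int m" by (simp add: m)
      hence "1 / (real d)\<^sup>2 * real n powr c - of_int m = (real n powr c - of_int k) / (real d)\<^sup>2"
        using d0 by (simp add: field_simps)
      also have "\<bar>\<dots>\<bar> \<le> 1 / (real d)\<^sup>2" using k d0 by (simp add: divide_right_mono)
      also have "\<dots> \<le> 1 / D\<^sup>2" using \<open>D\<^sup>2 \<le> (real d)\<^sup>2\<close> D by (simp add: frac_le)
      finally show ?thesis .
    qed
    ultimately show "\<bar>1 / (real d)\<^sup>2 * real n powr c - of_int (\<lfloor>real n powr c\<rfloor> div (int d)\<^sup>2)\<bar> \<le> 1 / D\<^sup>2"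
      by (simp add: k_def)
  next
    fix d d' assume "d \<in> ys" "d' \<in> ys"
    hence d: "D < real d" "real d \<le> 2 * D" "D < real d'" "real d' \<le> 2 * D" by (auto simp: ys_def)
    have d0: "0 < real d" "0 < real d'" using d D by linarith+
    have "ln (1 / (real d)\<^sup>2 / (1 / (real d')\<^sup>2)) = - 2 * ln (real d / real d')"
      using d0 by (simp add: ln_div ln_realpow)
    moreover have "\<bar>real d - real d'\<bar> \<le> 2 * D * \<bar>ln (real d / real d')\<bar>"
      by (rule abs_diff_le_ln) (use d d0 in auto)
    moreover have "0 \<le> 2 * D * \<bar>ln (real d / real d')\<bar>" using D by simp
    ultimately show "\<bar>real d - real d'\<bar> \<le> 2 * D * 2 * \<bar>ln (1 / (real d)\<^sup>2 / (1 / (real d')\<^sup>2))\<bar>"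
      by (simp add: abs_mult)
  next
    show "4 * (1 / D\<^sup>2) \<le> 1 / (4 * D\<^sup>2) * N powr (c - 1)" using N D by (simp add: field_simps)
  qed (use c N D ys in auto)
  define B where "B = P (\<theta> / 2 + (2 - c) / 2 - \<eta>)"
  define L where "L = P (\<theta> + \<eta>)"
  define sv where "sv = nc.s"
  define tv where "tv = nc.\<tau>"
  define gv where "gv = nc.g"
  define ev where "ev = nc.\<epsilon> B"
  have D2: "D\<^sup>2 = P (2 * \<theta>)" by (simp add: D_def Pp)
  have s: "sv = P (c - 1 - 2 * \<theta>) / 4"
  proof -
    have "sv = 1 / (4 * D\<^sup>2) * P (c - 1)" unfolding sv_def nc.s_def P_def ..
    also have "\<dots> = P (c - 1) / P (2 * \<theta>) / 4" unfolding D2 by simp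
    finally show ?thesis by (simp only: Pd)
  qed
  have ge: "gv = g" by (simp add: gv_def nc.g_def g_def)
  have \<tau>: "tv = 4 * P (2 - c)"
  proof -
    have "tv = 4 * (P 1 / P (2 * \<theta>) / P (c - 1 - 2 * \<theta>))"
      unfolding tv_def nc.\<tau>_def sv_def[symmetric] by (simp add: D2 s P1)
    thus ?thesis by (simp add: Pd)
  qed
  have B2: "B\<^sup>2 = P (\<theta> + (2 - c) - 2 * \<eta>)" unfolding B_def Pp by (rule arg_cong[where f = P]) (simp add: field_simps)
  have BB: "8 * tv \<le> gv * B\<^sup>2"
  proof -
    have "32 / g \<le> P \<eta>" using N c by (simp add: g_def P_def)
    also have "\<dots> \<le> P (\<theta> - 2 * \<eta>)" using \<theta> by (intro PM) auto
    finally have "32 \<le> g * P (\<theta> - 2 * \<eta>)" using g by (simp add: field_simps)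
    hence "32 * P (2 - c) \<le> (g * P (\<theta> - 2 * \<eta>)) * P (2 - c)" using P0[of "2 - c"] by (intro mult_right_mono) auto
    also have "\<dots> = g * B\<^sup>2" unfolding B2 mult.assoc PA by (simp add: algebra_simps)
    finally show ?thesis by (simp add: \<tau> ge)
  qed
  have "\<theta> / 2 + (2 - c) / 2 - \<eta> \<le> 1" "\<theta> + \<eta> \<le> 1" using c \<theta> \<eta> by argo+
  hence BN: "B \<le> N" and LN: "L \<le> N" unfolding B_def L_def P1[symmetric] by (auto intro: PM)
  have Bp: "0 < B" "0 < L" by (simp_all add: B_def L_def P0)
  note conds = Bp(1) BN BB[unfolded tv_def gv_def] Bp(2) LN
  note main = nc.sum_card_G_le[OF conds, folded sv_def tv_def gv_def ev_def]
  have eps: "ev = 16 / g * P (2 * \<eta> - \<theta>)"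
  proof -
    have "ev = 16 / g * (P (2 - c) / P (\<theta> + (2 - c) - 2 * \<eta>))"
      unfolding ev_def nc.\<epsilon>_def[OF conds] tv_def[symmetric] gv_def[symmetric] ge \<tau> B2 by simp
    thus ?thesis by (simp add: Pd)
  qed
  have "real (card (square_divisor_pairs c N D)) = (\<Sum>d\<in>ys. real (card (G d)))"
  proof -
    have "square_divisor_pairs c N D = prod.swap ` Sigma ys G"
      by (auto simp: square_divisor_pairs_def ys_def G_def image_iff)
    hence "card (square_divisor_pairs c N D) = card (Sigma ys G)" by (simp add: card_image)
    also have "\<dots> = (\<Sum>d\<in>ys. card (G d))" using ys nc.fin_G by (intro card_SigmaI) auto
    finally show ?thesis by simp
  qed
  also note main
  also have "2 * (2 * D * 2) * (N / L + 1) \<le> 16 * P (1 - \<eta>)"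
  proof -
    have "2 * (2 * D * 2) * (N / L + 1) = 8 * (D * (P 1 / L)) + 8 * D" unfolding P1 by (simp add: algebra_simps)
    also have "D * (P 1 / L) = P (1 - \<eta>)" unfolding D_def L_def Pd PA by (simp add: algebra_simps)
    also have "D \<le> P (1 - \<eta>)" unfolding D_def using \<theta> \<eta> c by (intro PM) auto
    finally show ?thesis by simp
  qed
  also have "132 * (2 * D * 2) * sv * (B\<^sup>2 + 4 * tv / gv * (1 + ln N)) \<le> 132 * (1 + 16 / g * (1 + 1 / \<eta>)) * P (1 - \<eta>)"
  proof -
    have "132 * (2 * D * 2) * sv * (B\<^sup>2 + 4 * tv / gv * (1 + ln N))
        \<le> 132 * (2 * D * 2) * sv * (B\<^sup>2 + 4 * tv / gv * ((1 + 1 / \<eta>) * P \<eta>))"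
      using one_plus_ln_le[OF N(1) \<eta>(1)] nc.s_pos[folded sv_def] nc.\<tau>_pos[folded tv_def] nc.g_pos[folded gv_def] D unfolding P_def
      by (intro mult_left_mono add_left_mono) auto
    also have "\<dots> = 132 * (P \<theta> * P (c - 1 - 2 * \<theta>) * P (\<theta> + (2 - c) - 2 * \<eta>)
        + 16 / g * (1 + 1 / \<eta>) * (P \<theta> * P (c - 1 - 2 * \<theta>) * P (2 - c) * P \<eta>))"
      unfolding s \<tau> ge B2 D_def by (simp add: algebra_simps)
    also have "\<dots> = 132 * (P (1 - 2 * \<eta>) + 16 / g * (1 + 1 / \<eta>) * P (1 - \<theta> + \<eta>))"
      unfolding PA by (simp add: algebra_simps)
    also have "\<dots> \<le> 132 * (P (1 - \<eta>) + 16 / g * (1 + 1 / \<eta>) * P (1 - \<eta>))"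
      using \<eta> \<theta> g by (intro mult_left_mono add_mono PM) auto
    finally show ?thesis by (simp add: algebra_simps)
  qed
  also have "25344 * sv\<^sup>2 * L ^ 5 / N * (1 + 36 * ev * (2 * D * 2)) \<le> 1584 * (1 + 2304 / g) * P (1 - \<eta>)"
  proof -
    have "25344 * sv\<^sup>2 * L ^ 5 / N * (1 + 36 * ev * (2 * D * 2))
        = 1584 * (P (2 * (c - 1 - 2 * \<theta>)) * P (5 * (\<theta> + \<eta>)) / P 1) * (1 + 2304 / g * (P (2 * \<eta> - \<theta>) * P \<theta>))"
      unfolding eps P1 D_def L_def s by (simp add: Pp power_divide)
    \<comment> \<open>The accuracy is a constant times \<open>P (2 * \<eta> - \<theta>)\<close> and
      the number of curves is of order \<open>P \<theta>\<close>: their product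
      \<open>P (2 * \<eta>)\<close> shows that one shape is shared by very few curves.\<close>
    also have "\<dots> = 1584 * P (2 * c - 3 + \<theta> + 5 * \<eta>) * (1 + 2304 / g * P (2 * \<eta>))"
      unfolding PA Pd by (simp add: algebra_simps)
    also have "\<dots> \<le> 1584 * P (2 * c - 3 + \<theta> + 5 * \<eta>) * ((1 + 2304 / g) * P (2 * \<eta>))"
    proof (intro mult_left_mono)
      have "1 \<le> P (2 * \<eta>)" using N \<eta> by (simp add: P_def ge_one_powr_ge_zero)
      thus "1 + 2304 / g * P (2 * \<eta>) \<le> (1 + 2304 / g) * P (2 * \<eta>)" by (simp add: algebra_simps)
    qed (use P0 in \<open>simp add: less_imp_le\<close>)
    also have "\<dots> = 1584 * (1 + 2304 / g) * P (2 * c - 3 + \<theta> + 7 * \<eta>)"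
      using PA[of "2 * c - 3 + \<theta> + 5 * \<eta>" "2 * \<eta>"] by (simp add: algebra_simps)
    \<comment> \<open>Inserting \<theta> at most c/3 turns the exponent condition into 7c/3 +
      8\<eta> at most 4, which leaves room for a positive \<eta> only if c < 12/7.\<close>
    also have "\<dots> \<le> 1584 * (1 + 2304 / g) * P (1 - \<eta>)" using g \<eta> \<theta> by (intro mult_left_mono PM) auto
    finally show ?thesis .
  qed
  finally show ?thesis using c unfolding D_def P_def g_def by (simp add: algebra_simps)
qed

text \<open>Already \<open>(n + 1) powr c\<close> exceeds \<open>n powr c\<close> by at least 1.
  Consequently the floor determines \<open>n\<close>, so that a pair of cofactor and divisor comes
  from only one \<open>n\<close>.\<close>

lemma powr_floor_strict_mono:
  fixes c :: real
  assumes "1 \<le> c" "1 \<le> n" "n < (n'::nat)"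
  shows "\<lfloor>real n powr c\<rfloor> < \<lfloor>real n' powr c\<rfloor>"
proof -
  have "real n powr c + 1 \<le> real n * real n powr (c - 1) + real n powr (c - 1)"
    using assms ge_one_powr_ge_zero[of "real n" "c - 1"] by (simp add: powr_diff)
  also have "\<dots> = real (n + 1) * real n powr (c - 1)" by (simp add: algebra_simps)
  also have "\<dots> \<le> real (n + 1) * real (n + 1) powr (c - 1)" using assms by (intro mult_left_mono powr_mono2) auto
  also have "\<dots> = real (n + 1) powr c" by (simp add: powr_diff)
  also have "\<dots> \<le> real n' powr c" using assms by (intro powr_mono2) auto
  finally show ?thesis by linarith
qed

lemma powr_diff_ge:
  fixes c u n :: real
  assumes "1 \<le> c" "0 < u" "u \<le> n"
  shows "(n - u) * n powr (c - 1) \<le> n powr c - u powr c"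
proof -
  have "u powr c = u * u powr (c - 1)" using assms by (simp add: powr_diff)
  also have "\<dots> \<le> u * n powr (c - 1)" using assms by (intro mult_left_mono powr_mono2) auto
  finally have "u powr c \<le> u * n powr (c - 1)" .
  moreover have "n powr c = n * n powr (c - 1)" using assms by (simp add: powr_diff)
  ultimately show ?thesis by (simp add: algebra_simps)
qed

text \<open>The curves are now indexed by the cofactor \<open>m\<close>, with \<open>n\<close> close to \<open>(m * d\<^sup>2) powr (1 / c)\<close> as a function of \<open>d\<close>;
  there are about \<open>M = N powr c / D\<^sup>2\<close> of them.\<close>

lemma card_pairs_large_divisor:
  fixes c \<eta> \<theta> N :: real
  assumes c: "1 < c" "c < 12 / 7" and \<eta>: "0 < \<eta>" "7 * \<eta> \<le> 1" "8 * \<eta> \<le> 4 - 7 * c / 3"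
    and \<theta>: "3 * \<eta> \<le> \<theta>" "c \<le> 3 * \<theta>"
    and N: "1 \<le> N" "32 * N powr \<theta> \<le> N powr c" "2 \<le> N powr c" "128 * c / (2 - c) \<le> N powr \<eta>"
  shows "real (card (square_divisor_pairs c N (N powr \<theta>)))
    \<le> (32 + 1056 * (1 + 128 * c / (2 - c) * (1 + 1 / \<eta>)) + 25344 * (1 + 18432 * c / (2 - c))) * N powr (1 - \<eta>)"
proof -
  define P where "P = (\<lambda>e. N powr e)"
  note calc = powr_calculus[OF N(1), folded P_def]
  note PA = calc(1) and Pd = calc(2) and Pr = calc(3) and Pp = calc(4) and P0 = calc(5) and P1 = calc(6) and PM = calc(7)
  define D where "D = P \<theta>"
  have D: "1 \<le> D" using N \<theta> \<eta> by (simp add: D_def P_def ge_one_powr_ge_zero)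
  have D2: "D\<^sup>2 = P (2 * \<theta>)" by (simp add: D_def Pp)
  have \<theta>c: "\<theta> \<le> c"
  proof (rule ccontr)
    assume "\<not> \<theta> \<le> c"
    hence "P c \<le> P \<theta>" by (intro PM) auto
    thus False using N(2) P0[of c] unfolding P_def by linarith
  qed
  define M where "M = P (c - 2 * \<theta>)"
  have M0: "0 < M" by (simp add: M_def P0)
  have MD: "M * D\<^sup>2 = P c" by (simp add: M_def D2 PA)
  have two: "1 \<le> 2 powr c" "2 powr c \<le> 4"
    using c powr_mono[of c 2 "2::real"] by (auto simp: ge_one_powr_ge_zero)
  \<comment> \<open>The price of the 8 in the lower bound \<open>M / 8\<close> for the cofactors,
    carried through the root of order \<open>c\<close>.\<close>
  define q where "q = (8::real) powr (1 / c)"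
  have q: "1 \<le> q" "q \<le> 8" using c powr_mono[of "1 / c" 1 "8::real"] by (auto simp: q_def ge_one_powr_ge_zero)
  \<comment> \<open>The floor lies between \<open>N powr c / 2\<close> and
    \<open>(2 * N) powr c\<close>, and \<open>d\<^sup>2\<close> between \<open>D\<^sup>2\<close> and
    \<open>4 * D\<^sup>2\<close>; the quotient has this range because
    \<open>M * D\<^sup>2 = N powr c\<close>.\<close>
  define ys where "ys = {m::nat. M / 8 \<le> real m \<and> real m \<le> 2 powr c * M}"
  define Q where "Q = (\<lambda>(m::nat) (d::nat) (n::nat). N < real n \<and> real n \<le> 2 * N \<and> \<lfloor>real n powr c\<rfloor> = int m * (int d)\<^sup>2)"
  define G where "G = (\<lambda>m::nat. {d::nat. D < real d \<and> real d \<le> 2 * D \<and> (\<exists>n. Q m d n)})"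
  \<comment> \<open>The choice is harmless: \<open>powr_floor_strict_mono\<close> allows at most one
    \<open>n\<close>, and \<open>zn\<close> below identifies it.\<close>
  define z where "z = (\<lambda>(m::nat) (d::nat). SOME n. Q m d n)"
  have ys0: "0 < real m" "real m \<le> 4 * M" if "m \<in> ys" for m
  proof -
    have "2 powr c * M \<le> 4 * M" using two M0 by (intro mult_right_mono) auto
    moreover have "M / 8 \<le> real m" "real m \<le> 2 powr c * M" using that by (auto simp: ys_def)
    ultimately show "0 < real m" "real m \<le> 4 * M" using M0 by linarith+
  qed
  have ys: "finite ys" "real (card ys) \<le> 4 * M"
    using card_nat_interval_le[of "4 * M" ys] ys0 M0 by force+
  define g where "g = (2 / c - 1) / 2"
  have g: "0 < g" using c by (simp add: g_def)
  have g': "64 / g = 128 * c / (2 - c)" using c by (simp add: g_def field_simps)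
  have Mc: "(M / 8) powr (1 / c) = P (1 - 2 * \<theta> / c) / q"
    using M0 c unfolding q_def M_def by (simp add: powr_divide Pr field_simps)
  have dc: "1 < 2 / c" "2 / c < 2" using c by (auto simp: field_simps)
  have Ds: "P (1 - 2 * \<theta> / c) / q * D powr (2 / c - 1) = P (1 - \<theta>) / q"
  proof -
    have "P (1 - 2 * \<theta> / c) * D powr (2 / c - 1) = P (1 - 2 * \<theta> / c + \<theta> * (2 / c - 1))"
      by (simp add: D_def Pr PA)
    also have "1 - 2 * \<theta> / c + \<theta> * (2 / c - 1) = 1 - \<theta>" using c by (simp add: field_simps)
    finally show ?thesis by simp
  qed
  \<comment> \<open>Now \<open>d\<close> is the abscissa and \<open>n\<close> the height, with
    exponent \<open>2 / c\<close> between 1 and 2. The tolerance \<open>P (1 - c)\<close> is the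
    unit lost in the floor divided by a lower bound for the derivative of
    \<open>n powr c\<close>.\<close>
  interpret nc: near_curves "2 / c" D "(M / 8) powr (1 / c)" "P (1 - c)" "8 * M" ys G "\<lambda>m. real m powr (1 / c)" "\<lambda>m d. int (z m d)"
  proof
    fix m assume m: "m \<in> ys"
    show "(M / 8) powr (1 / c) \<le> real m powr (1 / c) \<and> real m powr (1 / c) \<le> 16 * (M / 8) powr (1 / c)"
    proof
      show "(M / 8) powr (1 / c) \<le> real m powr (1 / c)" using m c M0 by (intro powr_mono2) (auto simp: ys_def)
      have "real m powr (1 / c) \<le> (2 powr c * 8 * (M / 8)) powr (1 / c)" using m c by (intro powr_mono2) (auto simp: ys_def)
      also have "\<dots> = 2 * q * (M / 8) powr (1 / c)" using M0 c
        by (simp only: powr_mult) (simp add: powr_powr q_def)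
      also have "\<dots> \<le> 16 * (M / 8) powr (1 / c)" using q by (intro mult_right_mono) auto
      finally show "real m powr (1 / c) \<le> 16 * (M / 8) powr (1 / c)" .
    qed
    fix d assume d: "d \<in> G m"
    show "D \<le> real d \<and> real d \<le> 2 * D" using d by (auto simp: G_def)
    have d0: "0 < real d" using d D by (auto simp: G_def)
    define n where "n = z m d"
    have "Q m d n" unfolding n_def z_def using d by (intro someI_ex[of "Q m d"]) (auto simp: G_def)
    hence n: "N < real n" "real n \<le> 2 * N" and k: "\<lfloor>real n powr c\<rfloor> = int m * (int d)\<^sup>2" by (auto simp: Q_def)
    define u where "u = (real m * (real d)\<^sup>2) powr (1 / c)"
    have md0: "0 < real m * (real d)\<^sup>2" using ys0[OF m] d0 by simp
    have u0: "0 < u" unfolding u_def powr_gt_zero using md0 by (rule less_imp_neq[THEN not_sym])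
    have uc: "u powr c = real m * (real d)\<^sup>2" using md0 c by (simp add: u_def powr_powr)
    have "(of_int \<lfloor>real n powr c\<rfloor> :: real) = real m * (real d)\<^sup>2" unfolding k by simp
    hence ub: "u powr c \<le> real n powr c" "real n powr c < u powr c + 1" unfolding uc by linarith+
    have un: "u \<le> real n"
    proof (rule ccontr)
      assume "\<not> u \<le> real n"
      hence "real n powr c < u powr c" using c by (intro powr_less_mono2) auto
      thus False using ub by simp
    qed
    have "real m powr (1 / c) * real d powr (2 / c) = u"
      using d0 unfolding u_def by (simp add: powr_mult powr_powr flip: powr_numeral)
    moreover have "\<bar>u - real n\<bar> \<le> P (1 - c)"
    proof -
      have "(real n - u) * real n powr (c - 1) \<le> real n powr c - u powr c" using c u0 un by (intro powr_diff_ge) auto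
      also have "\<dots> \<le> 1" using ub by simp
      finally have "(real n - u) * real n powr (c - 1) \<le> 1" .
      moreover have "(real n - u) * P (c - 1) \<le> (real n - u) * real n powr (c - 1)"
        unfolding P_def using un n N c by (intro mult_left_mono powr_mono2) auto
      ultimately have "(real n - u) * P (c - 1) \<le> 1" by linarith
      moreover have "P (1 - c) * P (c - 1) = 1" unfolding PA using N by (simp add: P_def)
      ultimately have "(real n - u) * P (c - 1) \<le> P (1 - c) * P (c - 1)" by simp
      thus ?thesis using un P0[of "c - 1"] by (simp add: mult_le_cancel_right)
    qed
    ultimately show "\<bar>real m powr (1 / c) * real d powr (2 / c) - of_int (int (z m d))\<bar> \<le> P (1 - c)"
      by (simp add: n_def)
  next
    fix m m' assume mm: "m \<in> ys" "m' \<in> ys"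
    note m = ys0[OF mm(1)] ys0[OF mm(2)]
    have "ln (real m powr (1 / c) / real m' powr (1 / c)) = (1 / c) * ln (real m / real m')"
      using m by (simp add: ln_div ln_powr diff_divide_distrib)
    hence "8 * M * \<bar>ln (real m powr (1 / c) / real m' powr (1 / c))\<bar> = (2 / c) * (4 * M * \<bar>ln (real m / real m')\<bar>)"
      using c by (simp add: abs_mult)
    moreover have "1 * (4 * M * \<bar>ln (real m / real m')\<bar>) \<le> (2 / c) * (4 * M * \<bar>ln (real m / real m')\<bar>)"
      using c M0 by (intro mult_right_mono) auto
    moreover have "\<bar>real m - real m'\<bar> \<le> 4 * M * \<bar>ln (real m / real m')\<bar>"
      by (rule abs_diff_le_ln) (use m in auto)
    ultimately show "\<bar>real m - real m'\<bar> \<le> 8 * M * \<bar>ln (real m powr (1 / c) / real m' powr (1 / c))\<bar>" by linarith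
  next
    have "32 * P \<theta> * P (1 - c - \<theta>) \<le> P c * P (1 - c - \<theta>)"
      using N(2) P0[of "1 - c - \<theta>"] unfolding P_def by (intro mult_right_mono) auto
    hence "32 * P (1 - c) \<le> P (1 - \<theta>)" unfolding mult.assoc PA by simp
    moreover have "4 * P (1 - c) * q \<le> 4 * P (1 - c) * 8" using q P0[of "1 - c"] by (intro mult_left_mono) auto
    ultimately have "4 * P (1 - c) * q \<le> P (1 - \<theta>)" by linarith
    thus "4 * P (1 - c) \<le> (M / 8) powr (1 / c) * D powr (2 / c - 1)" unfolding Mc Ds using q by (simp add: field_simps)
  qed (use c N D ys M0 P0 dc in auto)
  \<comment> \<open>\<open>L\<close> solves \<open>M * D / L = P (1 - \<eta>)\<close>, so that
    points outside short triples are negligible. \<open>B\<close> makes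
    \<open>M * P (1 - \<theta>) * B\<^sup>2\<close> equal to \<open>P (1 - 2 * \<eta>)\<close>,
    which bounds the short gaps up to the logarithmic term.\<close>
  define B where "B = P ((3 * \<theta> - c) / 2 - \<eta>)"
  define L where "L = P (c - 1 + \<eta> - \<theta>)"
  define sv where "sv = nc.s"
  define tv where "tv = nc.\<tau>"
  define gv where "gv = nc.g"
  define ev where "ev = nc.\<epsilon> B"
  have sq: "sv = P (1 - \<theta>) / q" unfolding sv_def nc.s_def unfolding Mc Ds ..
  have s: "sv \<le> P (1 - \<theta>)" unfolding sq using q P0[of "1 - \<theta>"] by (simp add: field_simps)
  have s0: "0 < sv" using nc.s_pos by (simp add: sv_def)
  have ge: "gv = g" by (simp add: gv_def nc.g_def g_def)
  have tq: "tv = q * P (2 * \<theta> - c)"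
  proof -
    have "tv = P (1 - c) * P \<theta> / (P (1 - \<theta>) / q)"
      unfolding tv_def nc.\<tau>_def sv_def[symmetric] sq by (simp add: D_def)
    also have "\<dots> = q * (P (1 - c + \<theta>) / P (1 - \<theta>))" by (simp add: PA)
    finally show ?thesis unfolding Pd by (simp add: algebra_simps)
  qed
  have t: "tv \<le> 8 * P (2 * \<theta> - c)" unfolding tq using q P0[of "2 * \<theta> - c"] by (intro mult_right_mono) auto
  have t0: "0 < tv" using nc.\<tau>_pos by (simp add: tv_def)
  have B2: "B\<^sup>2 = P (3 * \<theta> - c - 2 * \<eta>)" unfolding B_def Pp by (rule arg_cong[where f = P]) (simp add: field_simps)
  have BB: "8 * tv \<le> gv * B\<^sup>2"
  proof -
    have "64 / g \<le> P \<eta>" using N(4) unfolding g' P_def .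
    also have "\<dots> \<le> P (\<theta> - 2 * \<eta>)" using \<theta> by (intro PM) auto
    finally have "64 \<le> g * P (\<theta> - 2 * \<eta>)" using g by (simp add: field_simps)
    hence "64 * P (2 * \<theta> - c) \<le> (g * P (\<theta> - 2 * \<eta>)) * P (2 * \<theta> - c)" using P0[of "2 * \<theta> - c"] by (intro mult_right_mono) auto
    also have "\<dots> = g * B\<^sup>2" unfolding B2 mult.assoc PA by (simp add: algebra_simps)
    finally show ?thesis using t by (simp add: ge)
  qed
  have "(3 * \<theta> - c) / 2 - \<eta> \<le> \<theta>" "c - 1 + \<eta> - \<theta> \<le> \<theta>" using c \<theta> \<eta> \<theta>c by argo+
  hence BN: "B \<le> D" and LN: "L \<le> D" unfolding B_def L_def D_def by (auto intro: PM)
  have Bp: "0 < B" "0 < L" by (simp_all add: B_def L_def P0)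
  note conds = Bp(1) BN BB[unfolded tv_def gv_def] Bp(2) LN
  note main = nc.sum_card_G_le[OF conds, folded sv_def tv_def gv_def ev_def]
  have eps: "ev \<le> 32 / g * P (2 * \<eta> - \<theta>)" "0 \<le> ev"
  proof -
    have e: "ev = 4 * tv / (g * B\<^sup>2)"
      unfolding ev_def nc.\<epsilon>_def[OF conds] tv_def[symmetric] gv_def[symmetric] ge ..
    show "0 \<le> ev" unfolding e using t0 g by simp
    have "4 * tv / (g * B\<^sup>2) \<le> 4 * (8 * P (2 * \<theta> - c)) / (g * B\<^sup>2)"
      using t g by (intro divide_right_mono mult_left_mono) auto
    also have "\<dots> = 32 / g * (P (2 * \<theta> - c) / P (3 * \<theta> - c - 2 * \<eta>))" unfolding B2 by simp
    also have "\<dots> = 32 / g * P (2 * \<eta> - \<theta>)" unfolding Pd by (simp add: algebra_simps)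
    finally show "ev \<le> 32 / g * P (2 * \<eta> - \<theta>)" unfolding e .
  qed
  have "real (card (square_divisor_pairs c N D)) \<le> (\<Sum>m\<in>ys. real (card (G m)))"
  proof -
    have fin: "finite (Sigma ys G)" using ys nc.fin_G by auto
    have "square_divisor_pairs c N D \<subseteq> (\<lambda>(m, d). (z m d, d)) ` Sigma ys G"
    proof clarify
      fix n d assume "(n, d) \<in> square_divisor_pairs c N D"
      hence n: "N < real n" "real n \<le> 2 * N" and d: "D < real d" "real d \<le> 2 * D"
        and dv: "square_divides c n d" by (auto simp: square_divisor_pairs_def)
      define k where "k = \<lfloor>real n powr c\<rfloor>"
      have "k \<ge> 0" by (simp add: k_def)
      obtain m' where m': "k = (int d)\<^sup>2 * m'" using dv by (auto simp: k_def)
      have "0 < (int d)\<^sup>2" using d D by auto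
      hence "0 \<le> m'" using m' \<open>k \<ge> 0\<close> by (simp add: zero_le_mult_iff)
      then obtain m where m: "k = int m * (int d)\<^sup>2" using m' by (metis mult.commute nonneg_int_cases)
      have Q: "Q m d n" using n m by (simp add: Q_def k_def)
      have "Q m d (z m d)" unfolding z_def by (rule someI[of "Q m d", OF Q])
      hence zn: "z m d = n" using Q powr_floor_strict_mono[of c n "z m d"] powr_floor_strict_mono[of c "z m d" n] c N
        by (cases "z m d" n rule: linorder_cases) (auto simp: Q_def)
      have kr: "of_int k = real m * (real d)\<^sup>2" by (simp add: m)
      have d2: "D\<^sup>2 \<le> (real d)\<^sup>2" "(real d)\<^sup>2 \<le> 4 * D\<^sup>2"
        using d D power_mono[of D "real d" 2] power_mono[of "real d" "2 * D" 2] by auto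
      have "of_int k \<le> real n powr c" "real n powr c < of_int k + 1" unfolding k_def by linarith+
      moreover have "P c \<le> real n powr c" "real n powr c \<le> (2 * N) powr c"
        unfolding P_def using n N c by (auto intro!: powr_mono2)
      moreover have "(2 * N) powr c = 2 powr c * P c" using N by (simp add: powr_mult P_def)
      ultimately have kb: "P c - 1 \<le> of_int k" "of_int k \<le> 2 powr c * P c" by linarith+
      have "P c / 2 \<le> of_int k" using kb(1) N(3) unfolding P_def by linarith
      hence "M * D\<^sup>2 / 2 \<le> real m * (4 * D\<^sup>2)" unfolding MD[symmetric] kr
        using d2 by (meson mult_left_mono of_nat_0_le_iff order_trans)
      hence "(M / 8) * D\<^sup>2 \<le> real m * D\<^sup>2" by simp
      hence 1: "M / 8 \<le> real m" using D by (subst (asm) mult_le_cancel_right_pos) auto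
      have "real m * D\<^sup>2 \<le> real m * (real d)\<^sup>2" using d2 by (intro mult_left_mono) auto
      also have "\<dots> \<le> 2 powr c * M * D\<^sup>2" using kb(2) MD kr by (simp add: mult.assoc)
      finally have 2: "real m \<le> 2 powr c * M" using D by (subst (asm) mult_le_cancel_right_pos) auto
      have "(m, d) \<in> Sigma ys G" using 1 2 d Q by (auto simp: ys_def G_def)
      thus "(n, d) \<in> (\<lambda>(m, d). (z m d, d)) ` Sigma ys G" using zn by force
    qed
    hence "card (square_divisor_pairs c N D) \<le> card (Sigma ys G)"
      using fin by (meson card_image_le card_mono finite_imageI order_trans)
    also have "\<dots> = (\<Sum>d\<in>ys. card (G d))" using ys nc.fin_G by (intro card_SigmaI) auto
    finally show ?thesis by (metis of_nat_le_iff of_nat_sum)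
  qed
  also note main
  also have "2 * (8 * M) * (D / L + 1) \<le> 32 * P (1 - \<eta>)"
  proof -
    have "2 * (8 * M) * (D / L + 1) = 16 * (M * (D / L)) + 16 * M" by (simp add: algebra_simps)
    also have "M * (D / L) = P (1 - \<eta>)" unfolding D_def L_def M_def Pd PA by (simp add: algebra_simps)
    also have "M \<le> P (1 - \<eta>)" unfolding M_def using \<theta> \<eta> c by (intro PM) argo
    finally show ?thesis by simp
  qed
  also have "132 * (8 * M) * sv * (B\<^sup>2 + 4 * tv / gv * (1 + ln D)) \<le> 1056 * (1 + 64 / g * (1 + 1 / \<eta>)) * P (1 - \<eta>)"
  proof -
    have "ln D = \<theta> * ln N" using N by (simp add: D_def P_def ln_powr)
    also have "\<dots> \<le> 2 * ln N" using \<theta>c c N by (intro mult_right_mono) auto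
    finally have "1 + ln D \<le> 2 * (1 + ln N)" by simp
    hence lnD: "1 + ln D \<le> 2 * ((1 + 1 / \<eta>) * P \<eta>)" using one_plus_ln_le[OF N(1) \<eta>(1)] unfolding P_def by (smt (verit))
    have "0 \<le> 1 + ln D" using D by simp
    hence "132 * (8 * M) * sv * (B\<^sup>2 + 4 * tv / gv * (1 + ln D))
        \<le> 132 * (8 * M) * P (1 - \<theta>) * (B\<^sup>2 + 4 * (8 * P (2 * \<theta> - c)) / g * (2 * ((1 + 1 / \<eta>) * P \<eta>)))"
      using lnD s s0 t t0 g M0 P0 unfolding ge
      by (intro mult_mono add_mono divide_right_mono mult_left_mono) (auto simp: less_imp_le)
    also have "\<dots> = 1056 * (P (c - 2 * \<theta>) * P (1 - \<theta>) * P (3 * \<theta> - c - 2 * \<eta>)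
        + 64 / g * (1 + 1 / \<eta>) * (P (c - 2 * \<theta>) * P (1 - \<theta>) * P (2 * \<theta> - c) * P \<eta>))"
      unfolding B2 M_def by (simp add: algebra_simps)
    also have "\<dots> = 1056 * (P (1 - 2 * \<eta>) + 64 / g * (1 + 1 / \<eta>) * P (1 - \<theta> + \<eta>))"
      unfolding PA by (simp add: algebra_simps)
    also have "\<dots> \<le> 1056 * (P (1 - \<eta>) + 64 / g * (1 + 1 / \<eta>) * P (1 - \<eta>))"
      using \<eta> \<theta> g by (intro mult_left_mono add_mono PM) auto
    finally show ?thesis by (simp add: algebra_simps)
  qed
  also have "25344 * sv\<^sup>2 * L ^ 5 / D * (1 + 36 * ev * (8 * M)) \<le> 25344 * (1 + 9216 / g) * P (1 - \<eta>)"
  proof -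
    have "25344 * sv\<^sup>2 * L ^ 5 / D * (1 + 36 * ev * (8 * M))
        \<le> 25344 * (P (1 - \<theta>))\<^sup>2 * L ^ 5 / D * (1 + 36 * (32 / g * P (2 * \<eta> - \<theta>)) * (8 * M))"
      using s s0 eps M0 D Bp by (intro mult_mono divide_right_mono add_mono power_mono) auto
    also have "\<dots> = 25344 * (P (2 * (1 - \<theta>)) * P (5 * (c - 1 + \<eta> - \<theta>)) / P \<theta>) * (1 + 9216 / g * (P (2 * \<eta> - \<theta>) * P (c - 2 * \<theta>)))"
      unfolding D_def L_def M_def by (simp add: Pp)
    also have "\<dots> = 25344 * P (5 * c - 3 - 8 * \<theta> + 5 * \<eta>) * (1 + 9216 / g * P (2 * \<eta> + (c - 3 * \<theta>)))"
      unfolding PA Pd by (simp add: algebra_simps)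
    also have "\<dots> \<le> 25344 * P (5 * c - 3 - 8 * \<theta> + 5 * \<eta>) * ((1 + 9216 / g) * P (2 * \<eta>))"
    proof (intro mult_left_mono)
      have "1 \<le> P (2 * \<eta>)" using N \<eta> by (simp add: P_def ge_one_powr_ge_zero)
      \<comment> \<open>For \<theta> at least c/3 the number of cofactors is at most of order
        \<open>D\<close>, so again only about \<open>P (2 * \<eta>)\<close> curves can share a
        shape.\<close>
      moreover have "9216 / g * P (2 * \<eta> + (c - 3 * \<theta>)) \<le> 9216 / g * P (2 * \<eta>)"
        using \<theta> g by (intro mult_left_mono PM) auto
      ultimately show "1 + 9216 / g * P (2 * \<eta> + (c - 3 * \<theta>)) \<le> (1 + 9216 / g) * P (2 * \<eta>)" by (simp add: algebra_simps)
    qed (use P0 in \<open>simp add: less_imp_le\<close>)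
    also have "\<dots> = 25344 * (1 + 9216 / g) * P (5 * c - 3 - 8 * \<theta> + 7 * \<eta>)"
      using PA[of "5 * c - 3 - 8 * \<theta> + 5 * \<eta>" "2 * \<eta>"] by (simp add: algebra_simps)
    also have "\<dots> \<le> 25344 * (1 + 9216 / g) * P (1 - \<eta>)"
    proof (intro mult_left_mono PM)
      \<comment> \<open>Here \<theta> at least c/3 is inserted, and the condition 7c/3 + 8\<eta> at
        most 4 of the other case reappears.\<close>
      show "5 * c - 3 - 8 * \<theta> + 7 * \<eta> \<le> 1 - \<eta>" using \<eta> \<theta> by argo
    qed (use g in auto)
    finally show ?thesis .
  qed
  finally have "real (card (square_divisor_pairs c N D)) \<le> (32 + 1056 * (1 + 64 / g * (1 + 1 / \<eta>)) + 25344 * (1 + 9216 / g)) * P (1 - \<eta>)"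
    by (simp add: algebra_simps)
  moreover have "9216 / g = 18432 * c / (2 - c)" using c by (simp add: g_def field_simps)
  ultimately show ?thesis unfolding g' D_def P_def by simp
qed

section \<open>Combining both cases over all dyadic boxes\<close>

lemma powr_eventually_ge:
  assumes "0 < (e::real)"
  obtains N0 where "1 \<le> N0" "\<And>N. N0 \<le> N \<Longrightarrow> K \<le> N powr e"
proof
  show "1 \<le> max 1 (\<bar>K\<bar> powr (1 / e))" by simp
  fix N assume N: "max 1 (\<bar>K\<bar> powr (1 / e)) \<le> N"
  have "(\<bar>K\<bar> powr (1 / e)) powr e \<le> N powr e" using N assms by (intro powr_mono2) auto
  thus "K \<le> N powr e" using assms by (simp add: powr_powr)
qed

lemma square_divisor_le:
  assumes "1 \<le> (n::nat)" "0 \<le> c" "square_divides c n d"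
  shows "(real d)\<^sup>2 \<le> real n powr c" "1 \<le> d"
proof -
  have "1 \<le> real n powr c" using assms by (intro ge_one_powr_ge_zero) auto
  hence k: "1 \<le> \<lfloor>real n powr c\<rfloor>" by simp
  hence "(int d)\<^sup>2 \<le> \<lfloor>real n powr c\<rfloor>" using assms by (intro zdvd_imp_le) auto
  hence "real_of_int ((int d)\<^sup>2) \<le> real n powr c" by (simp add: le_floor_iff)
  thus "(real d)\<^sup>2 \<le> real n powr c" by simp
  show "1 \<le> d" using assms k by (cases d) auto
qed

lemma finite_square_divisor_pairs:
  assumes "0 \<le> c" "0 \<le> x" "\<And>n d. (n, d) \<in> S \<Longrightarrow> 1 \<le> n \<and> real n \<le> x \<and> square_divides c n d"
  shows "finite S" "real (card S) \<le> x * x powr c"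
proof -
  have sub: "S \<subseteq> {1..nat \<lfloor>x\<rfloor>} \<times> {1..nat \<lfloor>x powr c\<rfloor>}"
  proof
    fix p assume "p \<in> S"
    then obtain n d where p: "p = (n, d)" "(n, d) \<in> S" by (cases p) auto
    note a = assms(3)[OF p(2)]
    have d: "(real d)\<^sup>2 \<le> real n powr c" "1 \<le> d" using square_divisor_le[of n c d] a assms by auto
    have "real d \<le> (real d)\<^sup>2" using d(2) by (simp add: power2_eq_square)
    also have "\<dots> \<le> x powr c" using d(1) a assms by (meson of_nat_0_le_iff order_trans powr_mono2)
    finally show "p \<in> {1..nat \<lfloor>x\<rfloor>} \<times> {1..nat \<lfloor>x powr c\<rfloor>}" using a d p by (auto simp: le_nat_floor)
  qed
  show "finite S" by (rule finite_subset[OF sub]) auto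
  have "card S \<le> nat \<lfloor>x\<rfloor> * nat \<lfloor>x powr c\<rfloor>" using card_mono[OF _ sub] by (simp add: card_cartesian_product)
  hence "real (card S) \<le> real (nat \<lfloor>x\<rfloor>) * real (nat \<lfloor>x powr c\<rfloor>)" by (metis of_nat_le_iff of_nat_mult)
  also have "\<dots> \<le> x * x powr c" using assms by (intro mult_mono) auto
  finally show "real (card S) \<le> x * x powr c" .
qed

text \<open>Uniformity in \<theta> is the point: the dyadic summation uses an exponent that changes
  from box to box. Exponents so large that the box is empty are therefore included.\<close>

lemma card_square_divisor_pairs_bound:
  fixes c \<eta>0 :: real
  assumes c: "1 < c" "c < 12 / 7" and \<eta>0: "0 < \<eta>0"
  obtains \<eta> C :: real where "0 < \<eta>" "\<eta> \<le> 1" "0 \<le> C"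
    "\<And>N \<theta>. 1 \<le> N \<Longrightarrow> \<eta>0 \<le> \<theta> \<Longrightarrow> real (card (square_divisor_pairs c N (N powr \<theta>))) \<le> C * N powr (1 - \<eta>)"
proof -
  \<comment> \<open>The last entry is positive exactly because c < 12/7; the first provides
    \<open>3 * \<eta> \<le> \<theta>\<close> for every \<theta> from \<open>\<eta>0\<close>
    on.\<close>
  define \<eta> where "\<eta> = min (\<eta>0 / 3) (min (1 / 7) ((4 - 7 * c / 3) / 8))"
  have \<eta>: "0 < \<eta>" "7 * \<eta> \<le> 1" "8 * \<eta> \<le> 4 - 7 * c / 3" "3 * \<eta> \<le> \<eta>0"
    using c \<eta>0 by (auto simp: \<eta>_def min_def)
  obtain N1 where N1: "1 \<le> N1" "\<And>N. N1 \<le> N \<Longrightarrow> 16 \<le> N powr (c - 1)" using powr_eventually_ge[of "c - 1" 16] c by auto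
  obtain N2 where N2: "1 \<le> N2" "\<And>N. N2 \<le> N \<Longrightarrow> max (64 / (c - 1)) (128 * c / (2 - c)) \<le> N powr \<eta>"
    using powr_eventually_ge[OF \<eta>(1)] by metis
  obtain N3 where N3: "1 \<le> N3" "\<And>N. N3 \<le> N \<Longrightarrow> 4096 \<le> N powr c" using powr_eventually_ge[of c 4096] c by auto
  define N0 where "N0 = max N1 (max N2 N3)"
  define C1 where "C1 = 16 + 132 * (1 + 32 / (c - 1) * (1 + 1 / \<eta>)) + 1584 * (1 + 4608 / (c - 1))"
  define C2 where "C2 = 32 + 1056 * (1 + 128 * c / (2 - c) * (1 + 1 / \<eta>)) + 25344 * (1 + 18432 * c / (2 - c))"
  define C3 where "C3 = (2 * N0) * (2 * N0) powr c"
  have C: "0 \<le> C1" "0 \<le> C2" "0 \<le> C3" using c \<eta> N1 by (auto simp: C1_def C2_def C3_def N0_def)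
  have main: "real (card (square_divisor_pairs c N (N powr \<theta>))) \<le> (C1 + C2 + C3) * N powr (1 - \<eta>)"
    if N: "1 \<le> N" and \<theta>: "\<eta>0 \<le> \<theta>" for N \<theta>
  proof -
    let ?S = "square_divisor_pairs c N (N powr \<theta>)"
    have Np: "1 \<le> N powr (1 - \<eta>)" using N \<eta> by (intro ge_one_powr_ge_zero) auto
    have three: "real (card ?S) \<le> C1 * N powr (1 - \<eta>) \<or> real (card ?S) \<le> C2 * N powr (1 - \<eta>) \<or> real (card ?S) \<le> C3 * N powr (1 - \<eta>)"
    proof (cases "N0 \<le> N")
      case False
      have "real (card ?S) \<le> (2 * N0) * (2 * N0) powr c"
        by (rule finite_square_divisor_pairs) (use False N c N1 in \<open>auto simp: square_divisor_pairs_def intro!: Suc_leI gr0I\<close>)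
      also have "\<dots> \<le> C3 * N powr (1 - \<eta>)" using Np C mult_left_mono[OF Np, of C3] by (simp add: C3_def)
      finally show ?thesis by simp
    next
      case True
      hence big: "16 \<le> N powr (c - 1)" "64 / (c - 1) \<le> N powr \<eta>" "128 * c / (2 - c) \<le> N powr \<eta>" "4096 \<le> N powr c"
        using N1 N2 N3 by (auto simp: N0_def)
      have \<theta>3: "3 * \<eta> \<le> \<theta>" using \<eta> \<theta> by linarith
      show ?thesis
      proof (cases "3 * \<theta> \<le> c")
        case True
        show ?thesis using card_pairs_small_divisor[OF c \<eta>(1-3) \<theta>3 True N big(1,2)] by (simp add: C1_def)
      next
        case False
        show ?thesis
        proof (cases "32 * N powr \<theta> \<le> N powr c")
          case True
          show ?thesis using card_pairs_large_divisor[OF c \<eta>(1-3) \<theta>3 _ N True _ big(3)] False big(4) by (simp add: C2_def)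
        next
          case F: False
          \<comment> \<open>A divisor above \<open>N powr c / 32\<close> would have square above
            \<open>(N powr c)^2 / 1024\<close>, whereas it must be at most
            \<open>4 * N powr c\<close>. This is impossible as soon as \<open>N powr c\<close>
            reaches 4096 = 4 * 1024.\<close>
          have "?S = {}"
          proof (rule ccontr)
            assume "?S \<noteq> {}"
            then obtain n d where "N < real n" "real n \<le> 2 * N" and d: "N powr \<theta> < real d" and dv: "square_divides c n d"
              by (auto simp: square_divisor_pairs_def)
            have n: "1 \<le> n" using \<open>N < real n\<close> N by linarith
            have "(real d)\<^sup>2 \<le> real n powr c" using square_divisor_le[OF n _ dv] c by simp
            also have "\<dots> \<le> (2 * N) powr c" using \<open>real n \<le> 2 * N\<close> c by (intro powr_mono2) auto
            also have "\<dots> = 2 powr c * N powr c" using N by (simp add: powr_mult)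
            also have "\<dots> \<le> 4 * N powr c" using c powr_mono[of c 2 "2::real"] by (intro mult_right_mono) auto
            finally have "(real d)\<^sup>2 \<le> 4 * N powr c" .
            moreover have "(N powr c / 32)\<^sup>2 < (real d)\<^sup>2" using F d by (intro power_strict_mono) auto
            ultimately have "N powr c * N powr c < 4096 * N powr c" by (simp add: power2_eq_square)
            moreover have "4096 * N powr c \<le> N powr c * N powr c" using big(4) by (intro mult_right_mono) auto
            ultimately show False by simp
          qed
          thus ?thesis using C by simp
        qed
      qed
    qed
    have "C1 * N powr (1 - \<eta>) \<le> (C1 + C2 + C3) * N powr (1 - \<eta>)" "C2 * N powr (1 - \<eta>) \<le> (C1 + C2 + C3) * N powr (1 - \<eta>)"
      "C3 * N powr (1 - \<eta>) \<le> (C1 + C2 + C3) * N powr (1 - \<eta>)" using C by (intro mult_right_mono; simp)+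
    thus ?thesis using three by linarith
  qed
  show ?thesis by (rule that[of \<eta> "C1 + C2 + C3"]) (use \<eta> C main in auto)
qed

lemma dyadic_range:
  assumes "1 < (t::real)"
  obtains i where "2 ^ i < t" "t \<le> 2 ^ Suc i"
proof -
  have ex: "\<exists>i. t \<le> 2 ^ Suc i" using real_arch_pow[of 2 t] by (metis less_le_trans less_imp_le one_less_numeral_iff power_increasing_iff le_SucI order_refl semiring_norm(76))
  define i where "i = (LEAST i. t \<le> 2 ^ Suc i)"
  have "t \<le> 2 ^ Suc i" unfolding i_def using ex by (rule LeastI_ex)
  moreover have "2 ^ i < t"
  proof (cases i)
    case (Suc k)
    have "\<not> t \<le> 2 ^ Suc k" using not_less_Least[of k "\<lambda>i. t \<le> 2 ^ Suc i"] Suc by (simp add: i_def)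
    thus ?thesis by (simp add: Suc)
  qed (use assms in simp)
  ultimately show ?thesis using that by blast
qed

lemma card_large_square_divisors:
  fixes c \<eta>0 :: real
  assumes c: "1 < c" "c < 12 / 7" and \<eta>0: "0 < \<eta>0"
  obtains \<eta> C :: real where "0 < \<eta>" "0 \<le> C"
    "\<And>x. 1 \<le> x \<Longrightarrow> real (card {(n, d). 1 \<le> n \<and> real n \<le> x \<and> real n powr \<eta>0 < real d \<and> square_divides c n d}) \<le> C * x powr (1 - \<eta>)"
proof -
  obtain \<eta> C where \<eta>: "0 < \<eta>" "\<eta> \<le> 1" and C: "0 \<le> C"
    and pairs: "\<And>N \<theta>. 1 \<le> N \<Longrightarrow> \<eta>0 \<le> \<theta> \<Longrightarrow> real (card (square_divisor_pairs c N (N powr \<theta>))) \<le> C * N powr (1 - \<eta>)"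
    using card_square_divisor_pairs_bound[OF assms] by metis
  define K where "K = 8 * (1 + 4 / \<eta>)\<^sup>2"
  have K: "0 \<le> K" by (simp add: K_def)
  have main: "real (card {(n, d). 1 \<le> n \<and> real n \<le> x \<and> real n powr \<eta>0 < real d \<and> square_divides c n d}) \<le> (2 * K * C) * x powr (1 - \<eta> / 2)"
    (is "real (card ?T) \<le> _") if x: "1 \<le> x" for x
  proof -
    define I where "I = nat \<lfloor>log 2 x\<rfloor>"
    \<comment> \<open>With \<open>N = 2 ^ i\<close> the lower end of the range of \<open>d\<close>
      is \<open>N powr (\<eta>0 + j / i)\<close>, which brings the box into the form required by
      \<open>pairs\<close>.\<close>
    let ?U = "\<lambda>i j. square_divisor_pairs c (2 ^ i) ((2 ^ i) powr \<eta>0 * 2 ^ j)"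
    have sub: "?T \<subseteq> (\<Union>i\<in>{1..I}. \<Union>j\<in>{..<2 * (i + 1)}. ?U i j)"
    proof clarify
      fix n d :: nat assume n: "1 \<le> n" "real n \<le> x" and d: "real n powr \<eta>0 < real d" and dv: "square_divides c n d"
      have d2: "(real d)\<^sup>2 \<le> real n powr c" using square_divisor_le[OF n(1) _ dv] c by simp
      have "1 \<le> real n powr \<eta>0" using n \<eta>0 by (intro ge_one_powr_ge_zero) auto
      hence d1: "1 < real d" using d by linarith
      \<comment> \<open>Excludes \<open>i = 0\<close>, where the exponent \<open>j / i\<close> would
        not represent \<open>2 ^ j\<close>. For \<open>n\<close> at most 2 the square of
        \<open>d\<close> would be below 4, contradicting \<open>d > 1\<close>.\<close>
      have n3: "2 < n"
      proof (rule ccontr)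
        assume "\<not> 2 < n"
        hence "real n powr c \<le> 2 powr c" using c by (intro powr_mono2) auto
        also have "\<dots> < 2 powr 2" using c by (intro powr_less_mono) auto
        finally have "(real d)\<^sup>2 < 2\<^sup>2" using d2 by simp
        hence "real d < 2" by (rule power_less_imp_less_base) simp
        thus False using d1 by simp
      qed
      obtain i where i: "2 ^ i < real n" "real n \<le> 2 ^ Suc i" using dyadic_range[of "real n"] n3 by auto
      have i1: "1 \<le> i" using i n3 by (cases i) auto
      have iI: "i \<le> I"
      proof -
        have "2 ^ i \<le> x" using i n by linarith
        hence "real i \<le> log 2 x" using x by (simp add: le_log_iff powr_realpow)
        thus ?thesis by (simp add: I_def le_nat_floor)
      qed
      let ?A = "(2 ^ i) powr \<eta>0 :: real"
      have A1: "1 \<le> ?A" using \<eta>0 by (intro ge_one_powr_ge_zero) auto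
      have "?A \<le> real n powr \<eta>0" using i \<eta>0 by (intro powr_mono2) auto
      hence "1 < real d / ?A" using d A1 by (simp add: field_simps)
      then obtain j where j: "2 ^ j < real d / ?A" "real d / ?A \<le> 2 ^ Suc j" by (rule dyadic_range)
      have jj: "?A * 2 ^ j < real d" "real d \<le> 2 * (?A * 2 ^ j)" using j A1 by (simp_all add: field_simps)
      have "(2::real) ^ j \<le> real d" using jj(1) mult_right_mono[OF A1, of "2 ^ j"] by linarith
      also have "\<dots> \<le> (real d)\<^sup>2" using d1 by (simp add: power2_eq_square)
      also have "\<dots> \<le> real n powr c" by (rule d2)
      also have "\<dots> < real n powr 2" using c n3 by (intro powr_less_mono) auto
      also have "\<dots> = (real n)\<^sup>2" using n3 by simp
      also have "\<dots> \<le> (2 ^ Suc i)\<^sup>2" using i by (intro power_mono) auto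
      also have "\<dots> = 2 ^ (2 * (i + 1))" by (simp add: power_mult[symmetric] mult.commute)
      finally have "j < 2 * (i + 1)" by (rule power_less_imp_less_exp[rotated]) simp
      moreover have "(n, d) \<in> ?U i j" using i jj dv by (simp add: square_divisor_pairs_def)
      ultimately show "(n, d) \<in> (\<Union>i\<in>{1..I}. \<Union>j\<in>{..<2 * (i + 1)}. ?U i j)" using i1 iI by auto
    qed
    have U: "real (card (?U i j)) \<le> C * x powr (1 - \<eta>)" if i: "i \<in> {1..I}" for i j
    proof -
      have e: "(2 ^ i) powr \<eta>0 * 2 ^ j = (2 ^ i) powr (\<eta>0 + real j / real i :: real)"
      proof -
        have "(2 ^ i :: real) powr (real j / real i) = (2 powr real i) powr (real j / real i)" by (simp add: powr_realpow)
        also have "\<dots> = 2 powr real j" using i by (simp add: powr_powr)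
        also have "\<dots> = 2 ^ j" by (simp add: powr_realpow)
        finally show ?thesis by (simp add: powr_add)
      qed
      have "real (card (?U i j)) \<le> C * (2 ^ i) powr (1 - \<eta>)" unfolding e by (rule pairs) auto
      also have "\<dots> \<le> C * x powr (1 - \<eta>)"
      proof (intro mult_left_mono powr_mono2)
        have "0 \<le> log 2 x" using x by simp
        hence "real i \<le> log 2 x" using i unfolding I_def by (simp add: nat_le_iff le_floor_iff) linarith
        thus "2 ^ i \<le> x" using x by (simp add: le_log_iff powr_realpow)
      qed (use C \<eta> in auto)
      finally show ?thesis .
    qed
    have finU: "finite (?U i j)" for i j
      by (rule finite_square_divisor_pairs(1)[of c "2 * 2 ^ i"])
         (use c in \<open>auto simp: square_divisor_pairs_def intro!: Suc_leI gr0I\<close>)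
    have "card ?T \<le> card (\<Union>i\<in>{1..I}. \<Union>j\<in>{..<2 * (i + 1)}. ?U i j)"
      by (rule card_mono[OF _ sub]) (use finU in auto)
    also have "\<dots> \<le> (\<Sum>i\<in>{1..I}. card (\<Union>j\<in>{..<2 * (i + 1)}. ?U i j))" by (rule card_UN_le) simp
    also have "\<dots> \<le> (\<Sum>i\<in>{1..I}. \<Sum>j\<in>{..<2 * (i + 1)}. card (?U i j))" by (intro sum_mono card_UN_le) simp
    finally have "real (card ?T) \<le> (\<Sum>i\<in>{1..I}. \<Sum>j\<in>{..<2 * (i + 1)}. real (card (?U i j)))"
      by (metis (mono_tags, lifting) of_nat_le_iff of_nat_sum sum.cong)
    also have "\<dots> \<le> (\<Sum>i\<in>{1..I}. \<Sum>j\<in>{..<2 * (i + 1)}. C * x powr (1 - \<eta>))" using U by (intro sum_mono) auto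
    also have "\<dots> = (\<Sum>i\<in>{1..I}. real (2 * (i + 1)) * (C * x powr (1 - \<eta>)))" by simp
    also have "\<dots> \<le> (\<Sum>i\<in>{1..I}. real (2 * (I + 1)) * (C * x powr (1 - \<eta>)))" using C by (intro sum_mono mult_right_mono) auto
    also have "\<dots> = real I * (2 * (real I + 1)) * (C * x powr (1 - \<eta>))" by (simp add: algebra_simps)
    also have "\<dots> \<le> (real I + 1) * (2 * (real I + 1)) * (C * x powr (1 - \<eta>))" using C by (intro mult_right_mono) auto
    \<comment> \<open>The number of boxes is of order the square of \<open>ln x\<close>; half of the
      saving \<eta> is spent on absorbing it.\<close>
    also have "\<dots> \<le> (2 * K * x powr (\<eta> / 2)) * (C * x powr (1 - \<eta>))"
    proof (rule mult_right_mono)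
      have "real I \<le> log 2 x" using x by (simp add: I_def)
      also have "\<dots> = ln x / ln 2" by (simp add: log_def)
      also have "\<dots> \<le> ln x / (1 / 2)" using x ln2_ge_two_thirds by (intro divide_left_mono) auto
      finally have "real I + 1 \<le> 2 * (1 + ln x)" by simp
      also have "\<dots> \<le> 2 * ((1 + 1 / (\<eta> / 4)) * x powr (\<eta> / 4))" using one_plus_ln_le[OF x, of "\<eta> / 4"] \<eta> by simp
      also have "\<dots> = 2 * (1 + 4 / \<eta>) * x powr (\<eta> / 4)" by (simp add: algebra_simps)
      finally have "real I + 1 \<le> 2 * (1 + 4 / \<eta>) * x powr (\<eta> / 4)" .
      hence "(real I + 1)\<^sup>2 \<le> (2 * (1 + 4 / \<eta>) * x powr (\<eta> / 4))\<^sup>2" by (intro power_mono) auto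
      also have "\<dots> = K / 2 * (x powr (\<eta> / 4))\<^sup>2" 
        unfolding K_def power_mult_distrib by simp
      also have "(x powr (\<eta> / 4))\<^sup>2 = x powr (\<eta> / 2)" using x by (simp add: powr_power)
      finally have "(real I + 1)\<^sup>2 \<le> K / 2 * x powr (\<eta> / 2)" .
      moreover have "(real I + 1) * (2 * (real I + 1)) = 2 * (real I + 1)\<^sup>2" by (simp add: power2_eq_square)
      moreover have "0 \<le> K * x powr (\<eta> / 2)" using K by simp
      ultimately show "(real I + 1) * (2 * (real I + 1)) \<le> 2 * K * x powr (\<eta> / 2)" by linarith
    qed (use C in auto)
    also have "\<dots> = (2 * K * C) * (x powr (\<eta> / 2) * x powr (1 - \<eta>))" by simp
    also have "x powr (\<eta> / 2) * x powr (1 - \<eta>) = x powr (1 - \<eta> / 2)" by (simp flip: powr_add)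
    finally show ?thesis .
  qed
  show ?thesis by (rule that[of "\<eta> / 2" "2 * K * C"]) (use \<eta> K C main in auto)
qed

section \<open>Small square divisors\<close>

lemma card_int_interval_le:
  fixes A V :: real
  assumes "0 \<le> V"
  shows "real (card {\<lceil>A\<rceil>..\<lfloor>A + V\<rfloor>}) \<le> V + 1"
proof -
  have "real_of_int \<lfloor>A + V\<rfloor> \<le> A + V" "A \<le> real_of_int \<lceil>A\<rceil>" by linarith+
  hence "real_of_int (\<lfloor>A + V\<rfloor> - \<lceil>A\<rceil> + 1) \<le> V + 1" unfolding of_int_diff of_int_add of_int_1 by linarith
  moreover have "real (card {\<lceil>A\<rceil>..\<lfloor>A + V\<rfloor>}) = max 0 (real_of_int (\<lfloor>A + V\<rfloor> - \<lceil>A\<rceil> + 1))"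
    by (simp add: of_nat_nat max_def)
  ultimately show ?thesis using assms by simp
qed

text \<open>The integer \<open>j k = a * k - m k * p\<close> determines \<open>k\<close> below
  \<open>p\<close> since \<open>a\<close> is invertible modulo \<open>p\<close>, and it lies in an
  interval of length \<open>p * (l + 2 * e)\<close>. Counting integers in that interval replaces an
  exponential sum estimate.\<close>

lemma card_near_progression:
  fixes F :: "nat \<Rightarrow> real" and a :: int and p :: nat and r u l e :: real
  assumes cop: "coprime a (int p)" and p: "1 \<le> p" and l: "0 \<le> l" and e: "0 \<le> e"
    and F: "\<And>k. k < p \<Longrightarrow> \<bar>F k - (r + of_int a * real k / real p)\<bar> \<le> e"
  shows "real (card {k. k < p \<and> (\<exists>m::int. of_int m + u \<le> F k \<and> F k < of_int m + u + l)}) \<le> real p * (l + 2 * e) + 1"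
proof -
  let ?S = "{k. k < p \<and> (\<exists>m::int. of_int m + u \<le> F k \<and> F k < of_int m + u + l)}"
  define m where "m = (\<lambda>k. SOME m::int. of_int m + u \<le> F k \<and> F k < of_int m + u + l)"
  define j where "j = (\<lambda>k. a * int k - m k * int p)"
  have m: "of_int (m k) + u \<le> F k" "F k < of_int (m k) + u + l" if "k \<in> ?S" for k
    using someI_ex[of "\<lambda>m::int. of_int m + u \<le> F k \<and> F k < of_int m + u + l"] that by (auto simp: m_def)
  define A where "A = real p * (u - r - e)"
  define V where "V = real p * (l + 2 * e)"
  have V: "0 \<le> V" using l e by (simp add: V_def)
  have "inj_on j ?S"
  proof (rule inj_onI)
    fix k k' assume k: "k \<in> ?S" "k' \<in> ?S" and eq: "j k = j k'"
    have "a * (int k - int k') = (m k - m k') * int p" using eq by (simp add: j_def algebra_simps)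
    hence "int p dvd a * (int k - int k')" by simp
    hence "int p dvd int k - int k'" using cop by (meson coprime_commute coprime_dvd_mult_right_iff)
    moreover have "\<bar>int k - int k'\<bar> < int p" using k by auto
    ultimately have "int k - int k' = 0" using dvd_imp_le_int[of "int k - int k'" "int p"] by linarith
    thus "k = k'" by simp
  qed
  moreover have "j ` ?S \<subseteq> {\<lceil>A\<rceil>..\<lfloor>A + V\<rfloor>}"
  proof (rule image_subsetI)
    fix k assume k: "k \<in> ?S"
    have p0: "0 < real p" using p by simp
    have Fk: "F k - e \<le> r + of_int a * real k / real p" "r + of_int a * real k / real p \<le> F k + e"
      using F[of k] k by (auto simp: abs_le_iff)
    have ak: "of_int (a * int k) = real p * (of_int a * real k / real p)" using p0 by simp
    have "real p * (F k - e - r) \<le> of_int (a * int k)" unfolding ak using Fk p0 by (intro mult_left_mono) auto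
    moreover have "of_int (a * int k) \<le> real p * (F k + e - r)" unfolding ak using Fk p0 by (intro mult_left_mono) auto
    moreover have "real p * of_int (m k) \<le> real p * (F k - u)" using m[OF k] p0 by (intro mult_left_mono) auto
    moreover have "real p * (F k - u - l) \<le> real p * of_int (m k)" using m[OF k] p0 by (intro mult_left_mono) auto
    ultimately have "A \<le> of_int (j k)" "of_int (j k) \<le> A + V"
      unfolding j_def A_def V_def by (simp_all add: algebra_simps)
    thus "j k \<in> {\<lceil>A\<rceil>..\<lfloor>A + V\<rfloor>}" by (simp add: ceiling_le_iff le_floor_iff)
  qed
  ultimately have "card ?S \<le> card {\<lceil>A\<rceil>..\<lfloor>A + V\<rfloor>}" by (meson card_inj_on_le finite_atLeastAtMost_int)
  thus ?thesis using card_int_interval_le[OF V, of A] by (simp add: V_def)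
qed

text \<open>For \<beta> between 0 and 1: the fractional part of \<open>t\<close> is smaller than
  \<beta>.\<close>

definition hits :: "real \<Rightarrow> real \<Rightarrow> bool" where
  "hits \<beta> t \<longleftrightarrow> (\<exists>m::int. of_int m \<le> t \<and> t < of_int m + \<beta>)"

lemma not_hits:
  assumes "\<not> hits \<beta> t"
  shows "\<exists>m::int. of_int m + \<beta> \<le> t \<and> t < of_int m + \<beta> + (1 - \<beta>)"
proof -
  have "of_int \<lfloor>t\<rfloor> \<le> t" "t < of_int \<lfloor>t\<rfloor> + 1" by linarith+
  thus ?thesis using assms by (intro exI[of _ "\<lfloor>t\<rfloor>"]) (auto simp: hits_def not_less)
qed

text \<open>The previous upper bound is applied to the arc [0, \<beta>) and to its complement; the
  second application is the lower bound for the first arc.\<close>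

lemma card_hits_block:
  fixes F :: "nat \<Rightarrow> real" and a :: int and p :: nat and r e \<beta> :: real
  assumes cop: "coprime a (int p)" and p: "1 \<le> p" and \<beta>: "0 \<le> \<beta>" "\<beta> \<le> 1" and e: "0 \<le> e"
    and F: "\<And>k. k < p \<Longrightarrow> \<bar>F k - (r + of_int a * real k / real p)\<bar> \<le> e"
  shows "\<bar>real (card {k. k < p \<and> hits \<beta> (F k)}) - \<beta> * real p\<bar> \<le> 2 * e * real p + 1"
proof -
  have up: "real (card {k. k < p \<and> hits \<beta> (F k)}) \<le> real p * (\<beta> + 2 * e) + 1"
    using card_near_progression[OF cop p \<beta>(1) e F, of 0] by (simp add: hits_def)
  have "card {k. k < p \<and> \<not> hits \<beta> (F k)} \<le> card {k. k < p \<and> (\<exists>m::int. of_int m + \<beta> \<le> F k \<and> F k < of_int m + \<beta> + (1 - \<beta>))}"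
    by (intro card_mono) (use not_hits in \<open>blast intro: finite_subset[of _ "{..<p}"]\<close>)+
  hence lo: "real (card {k. k < p \<and> \<not> hits \<beta> (F k)}) \<le> real p * (1 - \<beta> + 2 * e) + 1"
    using card_near_progression[OF cop p _ e F, of "1 - \<beta>" \<beta>] \<beta> by simp
  have "card {k. k < p \<and> hits \<beta> (F k)} + card {k. k < p \<and> \<not> hits \<beta> (F k)} = card ({k. k < p \<and> hits \<beta> (F k)} \<union> {k. k < p \<and> \<not> hits \<beta> (F k)})"
    by (intro card_Un_disjoint[symmetric]) auto
  also have "{k. k < p \<and> hits \<beta> (F k)} \<union> {k. k < p \<and> \<not> hits \<beta> (F k)} = {..<p}" by auto
  finally have "real (card {k. k < p \<and> hits \<beta> (F k)}) + real (card {k. k < p \<and> \<not> hits \<beta> (F k)}) = real p" by (simp flip: of_nat_add)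
  thus ?thesis using up lo by (simp add: abs_le_iff algebra_simps)
qed

text \<open>Greedy decomposition from the left: a good start opens its block, a bad start forms a
  block of one element whose error of at most 1 is charged to the count of bad points. A block is
  opened only while more than \<open>K\<close> elements remain, so it fits, and the final remainder
  costs at most \<open>K\<close>.\<close>

lemma block_partition_error:
  fixes H Bad :: "nat \<Rightarrow> bool" and \<beta> \<eta> :: real and K :: nat
  assumes \<beta>: "0 \<le> \<beta>" "\<beta> \<le> 1" and \<eta>: "0 \<le> \<eta>"
    and good: "\<And>n. u0 \<le> n \<Longrightarrow> n < v \<Longrightarrow> \<not> Bad n \<Longrightarrow> \<exists>p. 1 \<le> p \<and> p \<le> K \<and> \<bar>real (card {k. k < p \<and> H (n + k)}) - \<beta> * real p\<bar> \<le> \<eta> * real p"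
    and u: "u0 \<le> u" "u \<le> v"
  shows "\<bar>real (card {n \<in> {u..<v}. H n}) - \<beta> * (real v - real u)\<bar>
    \<le> real (card {n \<in> {u..<v}. Bad n}) + \<eta> * (real v - real u) + real K"
  using u
proof (induction "v - u" arbitrary: u rule: less_induct)
  case less
  have split: "real (card {n \<in> {u..<v}. P n}) = real (card {k. k < p \<and> P (u + k)}) + real (card {n \<in> {u + p..<v}. P n})"
    if "u + p \<le> v" for p P
  proof -
    have "{n \<in> {u..<v}. P n} = (\<lambda>k. u + k) ` {k. k < p \<and> P (u + k)} \<union> {n \<in> {u + p..<v}. P n}"
    proof (rule set_eqI)
      fix n
      show "n \<in> {n \<in> {u..<v}. P n} \<longleftrightarrow> n \<in> (\<lambda>k. u + k) ` {k. k < p \<and> P (u + k)} \<union> {n \<in> {u + p..<v}. P n}"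
      proof (cases "u + p \<le> n")
        case False
        show ?thesis
        proof (cases "u \<le> n")
          case True
          then obtain k where "n = u + k" by (metis le_iff_add)
          thus ?thesis using False that by auto
        qed (auto)
      qed (auto)
    qed
    moreover have "card ((\<lambda>k. u + k) ` {k. k < p \<and> P (u + k)}) = card {k. k < p \<and> P (u + k)}"
      by (rule card_image) (auto intro: inj_onI)
    moreover have "(\<lambda>k. u + k) ` {k. k < p \<and> P (u + k)} \<inter> {n \<in> {u + p..<v}. P n} = {}" by auto
    ultimately show ?thesis by (simp add: card_Un_disjoint)
  qed
  show ?case
  proof (cases "v - u \<le> K")
    case True
    have c: "card {n \<in> {u..<v}. H n} \<le> v - u" 
      using card_mono[of "{u..<v}" "{n \<in> {u..<v}. H n}"] by (metis (no_types, lifting) card_atLeastLessThan finite_atLeastLessThan mem_Collect_eq subsetI)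
    hence c: "real (card {n \<in> {u..<v}. H n}) \<le> real v - real u" using less.prems by linarith
    have "0 \<le> \<beta> * (real v - real u)" "\<beta> * (real v - real u) \<le> 1 * (real v - real u)" "0 \<le> \<eta> * (real v - real u)"
      using \<beta> \<eta> less.prems mult_right_mono[OF \<beta>(2), of "real v - real u"] by simp_all
    moreover have "real v - real u \<le> real K" using True less.prems by linarith
    moreover have "0 \<le> real (card {n \<in> {u..<v}. H n})" "0 \<le> real (card {n \<in> {u..<v}. Bad n})" by simp_all
    ultimately show ?thesis using c unfolding abs_le_iff by (auto simp del: of_nat_0_le_iff)
  next
    case False
    obtain p where p: "1 \<le> p" "p \<le> v - u" and
      pe: "\<bar>real (card {k. k < p \<and> H (u + k)}) - \<beta> * real p\<bar> \<le> real (card {k. k < p \<and> Bad (u + k)}) + \<eta> * real p"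
    proof (cases "Bad u")
      case True
      have "{k. k < (1::nat) \<and> Bad (u + k)} = {0}" using True by auto
      moreover have "{k. k < (1::nat) \<and> H (u + k)} = (if H u then {0} else {})" by auto
      ultimately show ?thesis using that[of 1] False \<beta> \<eta> by auto
    next
      case nb: False
      obtain p where "1 \<le> p \<and> p \<le> K \<and> \<bar>real (card {k. k < p \<and> H (u + k)}) - \<beta> * real p\<bar> \<le> \<eta> * real p"
        using good[OF less.prems(1) _ nb] less.prems False by (metis diff_is_0_eq le0 not_less)
      thus ?thesis using that[of p] False by auto
    qed
    have up: "u + p \<le> v" using p less.prems by linarith
    have IH: "\<bar>real (card {n \<in> {u + p..<v}. H n}) - \<beta> * (real v - real (u + p))\<bar>
      \<le> real (card {n \<in> {u + p..<v}. Bad n}) + \<eta> * (real v - real (u + p)) + real K"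
      by (rule less.hyps) (use p less.prems up in auto)
    have eq: "y * (real v - real u) = y * real p + y * (real v - real (u + p))" for y
      by (simp add: algebra_simps)
    show ?thesis unfolding split[OF up, of H] split[OF up, of Bad] eq[of \<beta>] eq[of \<eta>] using IH pe by linarith
  qed
qed

text \<open>The upper growth rate \<open>\<mu>1\<close> limits how many integers are approached, the
  lower rate \<open>\<mu>0\<close> how long the function can stay near each of them.\<close>

lemma card_near_integers:
  fixes G :: "nat \<Rightarrow> real" and \<mu>0 \<mu>1 \<epsilon> :: real
  assumes \<mu>: "0 < \<mu>0" "0 \<le> \<mu>1" and \<epsilon>: "0 \<le> \<epsilon>"
    and inc: "\<And>n n'. u \<le> n \<Longrightarrow> n \<le> n' \<Longrightarrow> n' < v \<Longrightarrow> \<mu>0 * (real n' - real n) \<le> G n' - G n \<and> G n' - G n \<le> \<mu>1 * (real n' - real n)"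
    and uv: "u \<le> v"
  shows "real (card {n \<in> {u..<v}. \<exists>a::int. \<bar>G n - of_int a\<bar> \<le> \<epsilon>}) \<le> (\<mu>1 * (real v - real u) + 2 * \<epsilon> + 1) * (2 * \<epsilon> / \<mu>0 + 1)"
proof -
  let ?S = "{n \<in> {u..<v}. \<exists>a::int. \<bar>G n - of_int a\<bar> \<le> \<epsilon>}"
  define a where "a = (\<lambda>n. SOME a::int. \<bar>G n - of_int a\<bar> \<le> \<epsilon>)"
  have a: "\<bar>G n - of_int (a n)\<bar> \<le> \<epsilon>" if "n \<in> ?S" for n
    using someI_ex[of "\<lambda>a::int. \<bar>G n - of_int a\<bar> \<le> \<epsilon>"] that by (auto simp: a_def)
  define V where "V = \<mu>1 * (real v - real u) + 2 * \<epsilon>"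
  have V: "0 \<le> V" using \<mu> \<epsilon> uv by (simp add: V_def)
  let ?J = "{\<lceil>G u - \<epsilon>\<rceil>..\<lfloor>(G u - \<epsilon>) + V\<rfloor>}"
  have "real (card ?S) \<le> (1 + (2 * \<epsilon> / \<mu>0) / 1) * real (card ?J)"
  proof (rule card_le_mult_fibres(2)[where f = a])
    show "a ` ?S \<subseteq> ?J"
    proof (rule image_subsetI)
      fix n assume n: "n \<in> ?S"
      have "\<mu>0 * (real n - real u) \<le> G n - G u" "G n - G u \<le> \<mu>1 * (real n - real u)" using inc[of u n] n by auto
      moreover have "0 \<le> \<mu>0 * (real n - real u)" using \<mu> n by simp
      moreover have "\<mu>1 * (real n - real u) \<le> \<mu>1 * (real v - real u)" using \<mu> n by (intro mult_left_mono) auto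
      ultimately have "G u - \<epsilon> \<le> of_int (a n)" "of_int (a n) \<le> (G u - \<epsilon>) + V" using a[OF n] by (auto simp: V_def abs_le_iff)
      thus "a n \<in> ?J" by (simp add: ceiling_le_iff le_floor_iff)
    qed
    fix j
    show fin: "finite {n \<in> ?S. a n = j}" by auto
    show "real (card {n \<in> ?S. a n = j}) \<le> 1 + (2 * \<epsilon> / \<mu>0) / 1"
    proof (rule card_spaced_le[OF fin])
      fix n n' assume n: "n \<in> {n \<in> ?S. a n = j}" "n' \<in> {n \<in> ?S. a n = j}" "n < n'"
      hence "\<bar>G n - of_int j\<bar> \<le> \<epsilon>" "\<bar>G n' - of_int j\<bar> \<le> \<epsilon>" using a[of n] a[of n'] by auto
      moreover have "\<mu>0 * (real n' - real n) \<le> G n' - G n" using inc[of n n'] n by auto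
      ultimately have "\<mu>0 * (real n' - real n) \<le> 2 * \<epsilon>" by linarith
      hence "real n' - real n \<le> 2 * \<epsilon> / \<mu>0" using \<mu> by (simp add: field_simps)
      thus "1 \<le> real n' - real n \<and> real n' - real n \<le> 2 * \<epsilon> / \<mu>0" using n by auto
    qed (use \<mu> \<epsilon> in auto)
  qed auto
  also have "\<dots> \<le> (1 + (2 * \<epsilon> / \<mu>0) / 1) * (V + 1)"
    using card_int_interval_le[OF V, of "G u - \<epsilon>"] \<mu> \<epsilon> by (intro mult_left_mono) auto
  finally show ?thesis by (simp add: V_def mult.commute add.commute)
qed


section \<open>The phase \<rho> times \<open>n powr c\<close> and its exceptional points\<close>

lemma power_phase_bounds:
  fixes c \<rho> A x :: real
  assumes c: "1 < c" "c < 2" and A: "0 < A" and \<rho>: "0 < \<rho>"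
  shows "A \<le> s \<Longrightarrow> s \<le> t \<Longrightarrow> t \<le> x \<Longrightarrow>
      \<rho> * ((c - 1) * x powr (c - 2)) * (t - s) \<le> \<rho> * (c * t powr (c - 1)) - \<rho> * (c * s powr (c - 1))"
    and "A \<le> s \<Longrightarrow> s \<le> t \<Longrightarrow>
      \<rho> * (c * t powr (c - 1)) - \<rho> * (c * s powr (c - 1)) \<le> \<rho> * (2 * A powr (c - 2)) * (t - s)"
    and "A \<le> s \<Longrightarrow> s \<le> t \<Longrightarrow>
      \<bar>\<rho> * t powr c - \<rho> * s powr c - (t - s) * (\<rho> * (c * s powr (c - 1)))\<bar> \<le> \<rho> * (2 * A powr (c - 2)) * (t - s)\<^sup>2"
proof -
  have mvt: "\<exists>v. s \<le> v \<and> v \<le> t \<and> c * t powr (c - 1) - c * s powr (c - 1) = (t - s) * (c * ((c - 1) * v powr (c - 2)))"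
    if "A \<le> s" "s \<le> t" for s t
  proof (cases "s = t")
    case False
    have "\<exists>v>s. v < t \<and> c * t powr (c - 1) - c * s powr (c - 1) = (t - s) * (c * ((c - 1) * v powr (c - 1 - 1)))"
    proof (rule MVT2[where f = "\<lambda>t. c * t powr (c - 1)"])
      fix y assume "s \<le> y" "y \<le> t"
      thus "((\<lambda>t. c * t powr (c - 1)) has_real_derivative c * ((c - 1) * y powr (c - 1 - 1))) (at y)"
        using that A by (intro DERIV_cmult has_real_derivative_powr) auto
    qed (use that False in auto)
    thus ?thesis by (auto intro: less_imp_le)
  qed auto
  show low: "\<rho> * ((c - 1) * x powr (c - 2)) * (t - s) \<le> \<rho> * (c * t powr (c - 1)) - \<rho> * (c * s powr (c - 1))"
    if st: "A \<le> s" "s \<le> t" "t \<le> x" for s t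
  proof -
    obtain v where v: "s \<le> v" "v \<le> t" "c * t powr (c - 1) - c * s powr (c - 1) = (t - s) * (c * ((c - 1) * v powr (c - 2)))"
      using mvt[OF st(1,2)] by blast
    have "x powr (c - 2) \<le> v powr (c - 2)" using st v A c by (intro powr_mono2') auto
    hence "1 * ((c - 1) * x powr (c - 2)) \<le> c * ((c - 1) * v powr (c - 2))" using c by (intro mult_mono mult_left_mono) auto
    hence "(t - s) * ((c - 1) * x powr (c - 2)) \<le> (t - s) * (c * ((c - 1) * v powr (c - 2)))" using st by (intro mult_left_mono) auto
    hence "\<rho> * ((t - s) * ((c - 1) * x powr (c - 2))) \<le> \<rho> * (c * t powr (c - 1) - c * s powr (c - 1))"
      unfolding v(3) using \<rho> by (rule mult_left_mono[OF _ less_imp_le])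
    thus ?thesis by (simp add: right_diff_distrib mult_ac)
  qed
  show up: "\<rho> * (c * t powr (c - 1)) - \<rho> * (c * s powr (c - 1)) \<le> \<rho> * (2 * A powr (c - 2)) * (t - s)"
    if st: "A \<le> s" "s \<le> t" for s t
  proof -
    obtain v where v: "s \<le> v" "v \<le> t" "c * t powr (c - 1) - c * s powr (c - 1) = (t - s) * (c * ((c - 1) * v powr (c - 2)))"
      using mvt[OF st(1,2)] by blast
    have "v powr (c - 2) \<le> A powr (c - 2)" using st v A c by (intro powr_mono2') auto
    hence "c * ((c - 1) * v powr (c - 2)) \<le> 2 * (1 * A powr (c - 2))" using c by (intro mult_mono) auto
    hence "(t - s) * (c * ((c - 1) * v powr (c - 2))) \<le> (t - s) * (2 * (1 * A powr (c - 2)))" using st by (intro mult_left_mono) auto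
    hence "\<rho> * (c * t powr (c - 1) - c * s powr (c - 1)) \<le> \<rho> * ((t - s) * (2 * (1 * A powr (c - 2))))"
      unfolding v(3) using \<rho> by (rule mult_left_mono[OF _ less_imp_le])
    thus ?thesis by (simp add: right_diff_distrib mult_ac)
  qed
  show "\<bar>\<rho> * t powr c - \<rho> * s powr c - (t - s) * (\<rho> * (c * s powr (c - 1)))\<bar> \<le> \<rho> * (2 * A powr (c - 2)) * (t - s)\<^sup>2"
    if st: "A \<le> s" "s \<le> t" for s t
  proof (cases "s = t")
    case False
    have "\<exists>v>s. v < t \<and> \<rho> * t powr c - \<rho> * s powr c = (t - s) * (\<rho> * (c * v powr (c - 1)))"
      by (rule MVT2[where f = "\<lambda>t. \<rho> * t powr c"]) (use st False A in \<open>auto intro!: DERIV_cmult has_real_derivative_powr\<close>)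
    then obtain v where v: "s < v" "v < t" "\<rho> * t powr c - \<rho> * s powr c = (t - s) * (\<rho> * (c * v powr (c - 1)))" by blast
    have "s powr (c - 1) \<le> v powr (c - 1)" using v st A c by (intro powr_mono2) auto
    hence lo: "0 \<le> \<rho> * (c * v powr (c - 1)) - \<rho> * (c * s powr (c - 1))"
      using \<rho> c by (simp add: mult_left_mono)
    have "\<rho> * (c * v powr (c - 1)) - \<rho> * (c * s powr (c - 1)) \<le> \<rho> * (2 * A powr (c - 2)) * (v - s)" using up[of s v] st v by simp
    also have "\<dots> \<le> \<rho> * (2 * A powr (c - 2)) * (t - s)" using v \<rho> by (intro mult_left_mono) auto
    finally have "\<bar>(t - s) * (\<rho> * (c * v powr (c - 1)) - \<rho> * (c * s powr (c - 1)))\<bar> \<le> (t - s) * (\<rho> * (2 * A powr (c - 2)) * (t - s))"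
      using lo st by (simp add: abs_mult mult_left_mono)
    moreover have "(t - s) * (\<rho> * (2 * A powr (c - 2)) * (t - s)) = \<rho> * (2 * A powr (c - 2)) * (t - s)\<^sup>2"
      by (simp add: power2_eq_square)
    ultimately show ?thesis unfolding v(3) right_diff_distrib[of "t - s", symmetric] by (simp only:)
  qed (use \<rho> in simp)
qed

text \<open>The floor of \<open>t\<close> is a multiple of \<open>d\<^sup>2\<close> exactly when
  \<open>t\<close> lies in a unit interval starting at such a multiple; dividing by
  \<open>d\<^sup>2\<close> turns this into a condition modulo 1.\<close>

lemma hits_power_iff:
  assumes "1 \<le> d"
  shows "hits (1 / (real d)\<^sup>2) (1 / (real d)\<^sup>2 * t) \<longleftrightarrow> (int d)\<^sup>2 dvd \<lfloor>t\<rfloor>"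
proof -
  define q where "q = (int d)\<^sup>2"
  have q: "0 < q" "(real d)\<^sup>2 = of_int q" using assms by (auto simp: q_def)
  have "hits (1 / of_int q) (1 / of_int q * t) \<longleftrightarrow> (\<exists>m::int. of_int (m * q) \<le> t \<and> t < of_int (m * q) + 1)"
    unfolding hits_def
  proof (intro ex_cong1 conj_cong)
    fix m :: int
    have q': "0 < (of_int q :: real)" using q(1) by simp
    show "of_int m \<le> 1 / of_int q * t \<longleftrightarrow> of_int (m * q) \<le> t"
      using q' by (simp add: pos_le_divide_eq)
    have "of_int m + 1 / of_int q = (of_int (m * q) + 1) / (of_int q :: real)"
      using q' by (simp add: add_divide_distrib)
    thus "1 / of_int q * t < of_int m + 1 / of_int q \<longleftrightarrow> t < of_int (m * q) + 1"
      using q' by (simp add: divide_less_cancel)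
  qed
  also have "\<dots> \<longleftrightarrow> (\<exists>m. \<lfloor>t\<rfloor> = m * q)" by (simp only: floor_eq_iff)
  also have "\<dots> \<longleftrightarrow> q dvd \<lfloor>t\<rfloor>" by (auto simp: dvd_def mult.commute)
  finally show ?thesis unfolding q(2) unfolding q_def .
qed

text \<open>Each non-exceptional \<open>n\<close> starts a block whose length is the denominator of a rational
  approximation to the derivative of the phase at \<open>n\<close>; exceptional means that this denominator is at most \<open>P\<close>.\<close>

lemma count_hits_power_phase:
  fixes c \<rho> \<beta> A x :: real and K P u v :: nat
  assumes c: "1 < c" "c < 2" and A: "0 < A" and \<rho>: "0 < \<rho>" and \<beta>: "0 \<le> \<beta>" "\<beta> \<le> 1"
    and K: "1 \<le> K" and u: "A \<le> real u" "u \<le> v" "real v \<le> x + 1"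
  defines "\<mu>0 \<equiv> \<rho> * ((c - 1) * x powr (c - 2))" and "\<mu>1 \<equiv> \<rho> * (2 * A powr (c - 2))"
  shows "\<bar>real (card {n \<in> {u..<v}. hits \<beta> (\<rho> * real n powr c)}) - \<beta> * (real v - real u)\<bar>
    \<le> real P * ((real P * \<mu>1 * (real v - real u) + 3) * (2 / (real K * \<mu>0) + 1))
      + (2 * (1 / real K + \<mu>1 * (real K)\<^sup>2) + 1 / (real P + 1)) * (real v - real u) + real K"
proof (cases "u = v")
  case True
  have "0 \<le> \<mu>0" "0 \<le> \<mu>1" using \<rho> c by (auto simp: \<mu>0_def \<mu>1_def)
  thus ?thesis using True by simp
next
  case False
  hence uv: "u < v" using u by simp
  have x: "A \<le> x" using u uv by linarith
  have \<mu>: "0 < \<mu>0" "0 < \<mu>1" using \<rho> c A x by (auto simp: \<mu>0_def \<mu>1_def)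
  define f' where "f' = (\<lambda>n::nat. \<rho> * (c * real n powr (c - 1)))"
  define Bad where "Bad = (\<lambda>n. \<exists>p\<in>{1..P}. \<exists>a::int. \<bar>real p * f' n - of_int a\<bar> \<le> 1 / real K)"
  \<comment> \<open>On a block of at most \<open>K\<close> terms, replacing the slope by its
    rational approximation costs at most \<open>1 / K\<close>, since the index within the block
    stays below the denominator; the curvature costs at most
    \<open>\<mu>1 * K\<^sup>2\<close>.\<close>
  define e where "e = 1 / real K + \<mu>1 * (real K)\<^sup>2"
  have e0: "0 \<le> e" using \<mu> by (simp add: e_def)
  have "\<bar>real (card {n \<in> {u..<v}. hits \<beta> (\<rho> * real n powr c)}) - \<beta> * (real v - real u)\<bar>
    \<le> real (card {n \<in> {u..<v}. Bad n}) + (2 * e + 1 / (real P + 1)) * (real v - real u) + real K"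
  proof (rule block_partition_error[OF \<beta> _ _ order_refl u(2)])
    show "0 \<le> 2 * e + 1 / (real P + 1)" using e0 by simp
    fix n assume n: "u \<le> n" "n < v" "\<not> Bad n"
    obtain a k :: int where ak: "coprime a k" "0 < k" "k \<le> int K" "\<bar>of_int k * f' n - of_int a\<bar> < 1 / real K"
      using Dirichlet_approx_coprime[of K "f' n"] K by auto
    define p where "p = nat k"
    have p: "k = int p" "1 \<le> p" "p \<le> K" using ak by (auto simp: p_def)
    have ap: "\<bar>real p * f' n - of_int a\<bar> < 1 / real K" using ak(4) by (simp add: p)
    have "P < p"
    proof (rule ccontr)
      assume "\<not> P < p"
      hence "Bad n" unfolding Bad_def using p ap by (intro bexI[of _ p] exI[of _ a]) auto
      thus False using n by simp
    qed
    have "\<bar>real (card {k. k < p \<and> hits \<beta> (\<rho> * real (n + k) powr c)}) - \<beta> * real p\<bar> \<le> 2 * e * real p + 1"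
    proof (rule card_hits_block[where r = "\<rho> * real n powr c", OF ak(1)[unfolded p] p(2) \<beta> e0])
      fix k assume k: "k < p"
      have "\<bar>\<rho> * real (n + k) powr c - \<rho> * real n powr c - (real (n + k) - real n) * f' n\<bar> \<le> \<mu>1 * (real (n + k) - real n)\<^sup>2"
        unfolding f'_def \<mu>1_def using n u by (intro power_phase_bounds(3)[OF c A \<rho>]) auto
      hence 1: "\<bar>\<rho> * real (n + k) powr c - \<rho> * real n powr c - real k * f' n\<bar> \<le> \<mu>1 * (real k)\<^sup>2" by simp
      have 2: "\<mu>1 * (real k)\<^sup>2 \<le> \<mu>1 * (real K)\<^sup>2" using \<mu> k p by (intro mult_left_mono power_mono) auto
      have "\<bar>real k * f' n - of_int a * real k / real p\<bar> = real k / real p * \<bar>real p * f' n - of_int a\<bar>"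
      proof -
        have "real k * f' n - of_int a * real k / real p = real k / real p * (real p * f' n - of_int a)"
          using p by (simp add: field_simps)
        thus ?thesis by (simp add: abs_mult)
      qed
      also have "\<dots> \<le> 1 * (1 / real K)" using ap k p by (intro mult_mono) auto
      finally show "\<bar>\<rho> * real (n + k) powr c - (\<rho> * real n powr c + of_int a * real k / real p)\<bar> \<le> e"
        using 1 2 unfolding e_def by linarith
    qed
    \<comment> \<open>Excluding denominators up to \<open>P\<close> makes the boundary term 1 of
      each block small relative to its length.\<close>
    also have "\<dots> \<le> (2 * e + 1 / (real P + 1)) * real p"
    proof -
      have "1 \<le> 1 / (real P + 1) * real p" using \<open>P < p\<close> by (simp add: field_simps)
      thus ?thesis by (simp add: distrib_right)
    qed
    finally show "\<exists>p\<ge>1. p \<le> K \<and> \<bar>real (card {k. k < p \<and> hits \<beta> (\<rho> * real (n + k) powr c)}) - \<beta> * real p\<bar>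
        \<le> (2 * e + 1 / (real P + 1)) * real p" using p by blast
  qed
  \<comment> \<open>For each small denominator \<open>p\<close> the function \<open>p * f'\<close>
    is increasing with controlled rate, so it is seldom close to an integer.\<close>
  moreover have "real (card {n \<in> {u..<v}. Bad n}) \<le> real P * ((real P * \<mu>1 * (real v - real u) + 3) * (2 / (real K * \<mu>0) + 1))"
  proof -
    let ?B = "\<lambda>p. {n \<in> {u..<v}. \<exists>a::int. \<bar>real p * f' n - of_int a\<bar> \<le> 1 / real K}"
    have "{n \<in> {u..<v}. Bad n} = (\<Union>p\<in>{1..P}. ?B p)" by (auto simp: Bad_def)
    hence "card {n \<in> {u..<v}. Bad n} \<le> (\<Sum>p\<in>{1..P}. card (?B p))" by (simp only:) (rule card_UN_le, simp)
    hence "real (card {n \<in> {u..<v}. Bad n}) \<le> (\<Sum>p\<in>{1..P}. real (card (?B p)))" by (metis (mono_tags, lifting) of_nat_le_iff of_nat_sum sum.cong)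
    also have "\<dots> \<le> (\<Sum>p\<in>{1..P}. (real P * \<mu>1 * (real v - real u) + 3) * (2 / (real K * \<mu>0) + 1))"
    proof (rule sum_mono)
      fix p assume p: "p \<in> {1..P}"
      have "real (card (?B p)) \<le> (real p * \<mu>1 * (real v - real u) + 2 * (1 / real K) + 1) * (2 * (1 / real K) / (real p * \<mu>0) + 1)"
      proof (rule card_near_integers)
        fix n n' assume n: "u \<le> n" "n \<le> n'" "n' < v"
        have r: "A \<le> real n" "real n \<le> real n'" "real n' \<le> x" using n u by auto
        have "real p * (\<mu>0 * (real n' - real n)) \<le> real p * (f' n' - f' n)" "real p * (f' n' - f' n) \<le> real p * (\<mu>1 * (real n' - real n))"
          using power_phase_bounds(1,2)[OF c A \<rho> r(1,2)] r(3) unfolding f'_def \<mu>0_def \<mu>1_def by (intro mult_left_mono; simp)+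
        thus "real p * \<mu>0 * (real n' - real n) \<le> real p * f' n' - real p * f' n \<and>
            real p * f' n' - real p * f' n \<le> real p * \<mu>1 * (real n' - real n)" by (simp add: right_diff_distrib mult.assoc)
      qed (use p \<mu> u in auto)
      also have "\<dots> \<le> (real P * \<mu>1 * (real v - real u) + 3) * (2 / (real K * \<mu>0) + 1)"
      proof (rule mult_mono)
        have "real p * \<mu>1 * (real v - real u) \<le> real P * \<mu>1 * (real v - real u)" using p \<mu> u by (intro mult_right_mono) auto
        moreover have "1 / real K \<le> 1" using K by simp
        ultimately show "real p * \<mu>1 * (real v - real u) + 2 * (1 / real K) + 1 \<le> real P * \<mu>1 * (real v - real u) + 3" by linarith
        have "2 / (real K * (real p * \<mu>0)) \<le> 2 / (real K * (1 * \<mu>0))"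
          using p \<mu> K by (intro divide_left_mono mult_left_mono mult_right_mono) auto
        thus "2 * (1 / real K) / (real p * \<mu>0) + 1 \<le> 2 / (real K * \<mu>0) + 1" by (simp add: mult_ac)
      qed (use p \<mu> u in auto)
      finally show "real (card (?B p)) \<le> (real P * \<mu>1 * (real v - real u) + 3) * (2 / (real K * \<mu>0) + 1)" .
    qed
    finally show ?thesis by simp
  qed
  ultimately show ?thesis unfolding e_def by linarith
qed

lemma nat_floor_bounds:
  assumes "1 \<le> (q::real)"
  shows "1 \<le> nat \<lfloor>q\<rfloor>" "real (nat \<lfloor>q\<rfloor>) \<le> q" "q \<le> real (nat \<lfloor>q\<rfloor>) + 1" "q / 2 \<le> real (nat \<lfloor>q\<rfloor>)"
proof -
  have f: "1 \<le> \<lfloor>q\<rfloor>" using assms by simp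
  hence r: "real (nat \<lfloor>q\<rfloor>) = of_int \<lfloor>q\<rfloor>" by simp
  show "1 \<le> nat \<lfloor>q\<rfloor>" using f by linarith
  show "real (nat \<lfloor>q\<rfloor>) \<le> q" "q \<le> real (nat \<lfloor>q\<rfloor>) + 1" unfolding r by linarith+
  have "1 \<le> (of_int \<lfloor>q\<rfloor> :: real)" using f by simp
  thus "q / 2 \<le> real (nat \<lfloor>q\<rfloor>)" unfolding r by linarith
qed

text \<open>The saving \<open>2 * \<delta>\<close> in the exponent is chosen so that summing over
  all \<open>d\<close> up to \<open>x powr \<delta>\<close> still leaves
  \<open>x powr (1 - \<delta>)\<close>.\<close>

lemma card_small_square_divisor:
  fixes c \<delta> :: real
  assumes c: "1 < c" "c < 2" and \<delta>: "0 < \<delta>" "28 * \<delta> \<le> 2 - c"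
  obtains C :: real where "0 \<le> C"
    "\<And>x d. 1 \<le> x \<Longrightarrow> 1 \<le> d \<Longrightarrow> real d \<le> x powr \<delta> \<Longrightarrow>
      \<bar>real (card (square_multiples c x d)) - x / (real d)\<^sup>2\<bar> \<le> C * x powr (1 - 2 * \<delta>)"
proof -
  define \<kappa> where "\<kappa> = 2 - c"
  have \<kappa>: "0 < \<kappa>" "\<kappa> < 1" using c by (auto simp: \<kappa>_def)
  define C where "C = 5 * (4 / (c - 1) + 1) + 15"
  have main: "\<bar>real (card (square_multiples c x d)) - x / (real d)\<^sup>2\<bar> \<le> C * x powr (1 - 2 * \<delta>)"
    if x: "1 \<le> x" and d: "1 \<le> d" "real d \<le> x powr \<delta>" for x d
  proof -
    define P where "P = (\<lambda>e. x powr e)"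
    note calc = powr_calculus[OF x, folded P_def]
  note PA = calc(1) and Pd = calc(2) and Pr = calc(3) and Pp = calc(4) and P0 = calc(5) and P1 = calc(6) and PM = calc(7)
    have Pz: "P 0 = 1" using x by (simp add: P_def)
    have Pge: "1 \<le> P a" if "0 \<le> a" for a using PM[OF that] Pz by simp
    define \<rho> where "\<rho> = 1 / (real d)\<^sup>2"
    have \<rho>: "0 < \<rho>" "\<rho> \<le> 1" "P (- 2 * \<delta>) \<le> \<rho>"
    proof -
      show "0 < \<rho>" "\<rho> \<le> 1" using d by (auto simp: \<rho>_def)
      have "(real d)\<^sup>2 \<le> (P \<delta>)\<^sup>2" using d by (intro power_mono) (auto simp: P_def)
      hence "1 / P (2 * \<delta>) \<le> \<rho>" unfolding \<rho>_def Pp using d P0 by (intro divide_left_mono mult_pos_pos) auto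
      thus "P (- 2 * \<delta>) \<le> \<rho>" using Pd[of 0 "2 * \<delta>"] Pz by simp
    qed
    \<comment> \<open>All \<open>n\<close> below \<open>A\<close> are discarded at an admissible
      cost; beyond \<open>A\<close> the second derivative of the phase is comparable to its value at
      \<open>x\<close> up to \<open>P (2 * \<delta>)\<close>.\<close>
    define A where "A = P (1 - 2 * \<delta>)"
    have A: "1 \<le> A" "A \<le> x" unfolding A_def P1[symmetric] using \<delta> \<kappa> \<kappa>_def by (auto intro!: Pge PM)
    define u where "u = nat \<lceil>A\<rceil>"
    define v where "v = nat \<lfloor>x\<rfloor> + 1"
    have u: "A \<le> real u" "real u \<le> A + 1" using A unfolding u_def by linarith+
    have v: "x \<le> real v" "real v \<le> x + 1" using x unfolding v_def by linarith+
    have uv: "u \<le> v" using A x unfolding u_def v_def by linarith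
    \<comment> \<open>With \<open>p\<close> about \<open>P (3 * \<delta>)\<close>, the exponent 12
      makes the exceptional term exactly of order \<open>A\<close>: 3 + 5 - 10 = -2 in units of
      \<delta>. The curvature term then has exponent 26\<delta> - \<kappa>, and requiring this to be
      at most -2\<delta> is the source of the 28.\<close>
    define K where "K = nat \<lfloor>P (12 * \<delta>)\<rfloor>"
    define p where "p = nat \<lfloor>P (3 * \<delta>)\<rfloor>"
    have P12: "1 \<le> P (12 * \<delta>)" "1 \<le> P (3 * \<delta>)" using \<delta> by (auto intro: Pge)
    have K: "1 \<le> K" "real K \<le> P (12 * \<delta>)" "P (12 * \<delta>) / 2 \<le> real K" unfolding K_def using nat_floor_bounds[OF P12(1)] by auto
    have p: "real p \<le> P (3 * \<delta>)" "P (3 * \<delta>) \<le> real p + 1" unfolding p_def using nat_floor_bounds[OF P12(2)] by auto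
    define m0 where "m0 = \<rho> * ((c - 1) * x powr (c - 2))"
    define m1 where "m1 = \<rho> * (2 * A powr (c - 2))"
    have m0: "(c - 1) * P (- 2 * \<delta> - \<kappa>) \<le> m0"
    proof -
      have "(c - 1) * P (- 2 * \<delta> - \<kappa>) = P (- 2 * \<delta>) * ((c - 1) * P (- \<kappa>))" using PA[of "- 2 * \<delta>" "- \<kappa>"] by simp
      also have "\<dots> \<le> \<rho> * ((c - 1) * P (- \<kappa>))" using \<rho> c P0[of "- \<kappa>"] by (intro mult_right_mono) auto
      finally show ?thesis by (simp add: m0_def P_def \<kappa>_def)
    qed
    have m1: "m1 \<le> 2 * P (2 * \<delta> - \<kappa>)"
    proof -
      have "(1 - 2 * \<delta>) * (c - 2) = 2 * \<delta> * \<kappa> - \<kappa>" by (simp add: \<kappa>_def algebra_simps)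
      also have "\<dots> \<le> 2 * \<delta> - \<kappa>" using \<delta> \<kappa> mult_left_mono[of \<kappa> 1 "2 * \<delta>"] by simp
      finally have "A powr (c - 2) \<le> P (2 * \<delta> - \<kappa>)" unfolding A_def Pr by (rule PM)
      hence "\<rho> * (2 * A powr (c - 2)) \<le> 1 * (2 * P (2 * \<delta> - \<kappa>))" using \<rho> by (intro mult_mono) auto
      thus ?thesis by (simp add: m1_def)
    qed
    have m00: "0 < m0" "0 \<le> m1" using \<rho> c x by (auto simp: m0_def m1_def)
    have len: "0 \<le> real v - real u" "real v - real u \<le> P 1" using uv u v A P1 by auto
    let ?H = "\<lambda>n. square_divides c n d"
    have hit: "hits \<rho> (\<rho> * real n powr c) \<longleftrightarrow> ?H n" for n unfolding \<rho>_def by (rule hits_power_iff[OF d(1)])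
    have "\<bar>real (card {n \<in> {u..<v}. hits \<rho> (\<rho> * real n powr c)}) - \<rho> * (real v - real u)\<bar>
      \<le> real p * ((real p * m1 * (real v - real u) + 3) * (2 / (real K * m0) + 1))
        + (2 * (1 / real K + m1 * (real K)\<^sup>2) + 1 / (real p + 1)) * (real v - real u) + real K"
      unfolding m0_def m1_def by (rule count_hits_power_phase) (use c A \<rho> K u uv v in auto)
    hence cnt: "\<bar>real (card {n \<in> {u..<v}. ?H n}) - \<rho> * (real v - real u)\<bar>
      \<le> real p * ((real p * m1 * (real v - real u) + 3) * (2 / (real K * m0) + 1))
        + (2 * (1 / real K + m1 * (real K)\<^sup>2) + 1 / (real p + 1)) * (real v - real u) + real K"
      unfolding hit .
    have T1: "real p * ((real p * m1 * (real v - real u) + 3) * (2 / (real K * m0) + 1)) \<le> 5 * (4 / (c - 1) + 1) * A"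
    proof -
      have a: "real p * m1 * (real v - real u) + 3 \<le> 5 * P (1 - \<kappa> + 5 * \<delta>)"
      proof -
        have "real p * m1 * (real v - real u) \<le> P (3 * \<delta>) * (2 * P (2 * \<delta> - \<kappa>)) * P 1"
          using p m1 m00 len P0 by (intro mult_mono) (auto simp: less_imp_le)
        also have "\<dots> = 2 * (P (3 * \<delta>) * P (2 * \<delta> - \<kappa>) * P 1)" by simp
        also have "\<dots> = 2 * P (1 - \<kappa> + 5 * \<delta>)" unfolding PA by (simp add: algebra_simps)
        finally show ?thesis using Pge[of "1 - \<kappa> + 5 * \<delta>"] \<kappa> \<delta> by simp
      qed
      have b: "2 / (real K * m0) + 1 \<le> (4 / (c - 1) + 1) * P (\<kappa> - 10 * \<delta>)"
      proof -
        have "P (12 * \<delta>) / 2 * ((c - 1) * P (- 2 * \<delta> - \<kappa>)) \<le> real K * m0"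
          using K m0 c P0 by (intro mult_mono) (auto simp: less_imp_le)
        hence "2 / (real K * m0) \<le> 2 / (P (12 * \<delta>) / 2 * ((c - 1) * P (- 2 * \<delta> - \<kappa>)))"
          using P0 c K(1) m00(1) by (intro divide_left_mono mult_pos_pos divide_pos_pos) auto
        also have "\<dots> = 4 / (c - 1) * (P 0 / (P (12 * \<delta>) * P (- 2 * \<delta> - \<kappa>)))" by (simp add: Pz)
        also have "\<dots> = 4 / (c - 1) * P (\<kappa> - 10 * \<delta>)"
          unfolding PA Pd by (rule arg_cong[where f = "\<lambda>e. 4 / (c - 1) * P e"]) simp
        finally have "2 / (real K * m0) \<le> 4 / (c - 1) * P (\<kappa> - 10 * \<delta>)" .
        moreover have "1 \<le> P (\<kappa> - 10 * \<delta>)" using \<delta> \<kappa>_def by (intro Pge) auto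
        ultimately show ?thesis by (simp only: distrib_right)
      qed
      have "real p * ((real p * m1 * (real v - real u) + 3) * (2 / (real K * m0) + 1))
        \<le> P (3 * \<delta>) * ((5 * P (1 - \<kappa> + 5 * \<delta>)) * ((4 / (c - 1) + 1) * P (\<kappa> - 10 * \<delta>)))"
        using p a b m00 len P0 K by (intro mult_mono) (auto simp: less_imp_le)
      also have "\<dots> = 5 * (4 / (c - 1) + 1) * (P (3 * \<delta>) * P (1 - \<kappa> + 5 * \<delta>) * P (\<kappa> - 10 * \<delta>))" by simp
      also have "\<dots> = 5 * (4 / (c - 1) + 1) * A" unfolding PA A_def by (simp add: algebra_simps)
      finally show ?thesis .
    qed
    have T2: "(2 * (1 / real K + m1 * (real K)\<^sup>2) + 1 / (real p + 1)) * (real v - real u) \<le> 9 * A"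
    proof -
      have k1: "1 / real K \<le> 2 * P (- 12 * \<delta>)"
      proof -
        have "1 / real K \<le> 1 / (P (12 * \<delta>) / 2)" using K P12 by (intro divide_left_mono) auto
        also have "\<dots> = 2 * (P 0 / P (12 * \<delta>))" by (simp add: Pz)
        finally show ?thesis unfolding Pd by simp
      qed
      have k2: "m1 * (real K)\<^sup>2 \<le> 2 * P (26 * \<delta> - \<kappa>)"
      proof -
        have "m1 * (real K)\<^sup>2 \<le> 2 * P (2 * \<delta> - \<kappa>) * (P (12 * \<delta>))\<^sup>2"
          using m1 m00 K by (intro mult_mono power_mono) auto
        also have "\<dots> = 2 * (P (2 * \<delta> - \<kappa>) * P (2 * (12 * \<delta>)))" unfolding Pp by simp
        finally show ?thesis unfolding PA by (simp add: algebra_simps)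
      qed
      have k3: "1 / (real p + 1) \<le> P (- 3 * \<delta>)"
      proof -
        have "1 / (real p + 1) \<le> P 0 / P (3 * \<delta>)" using p P12 unfolding Pz by (intro divide_left_mono) auto
        thus ?thesis unfolding Pd by simp
      qed
      have "P (- 12 * \<delta>) \<le> P (- 2 * \<delta>)" "P (26 * \<delta> - \<kappa>) \<le> P (- 2 * \<delta>)" "P (- 3 * \<delta>) \<le> P (- 2 * \<delta>)"
        using \<delta> \<kappa>_def by (auto intro!: PM)
      hence "2 * (1 / real K + m1 * (real K)\<^sup>2) + 1 / (real p + 1) \<le> 9 * P (- 2 * \<delta>)" using k1 k2 k3 by argo
      hence "(2 * (1 / real K + m1 * (real K)\<^sup>2) + 1 / (real p + 1)) * (real v - real u) \<le> (9 * P (- 2 * \<delta>)) * P 1"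
        using len P0[of "- 2 * \<delta>"] by (intro mult_mono) auto
      also have "\<dots> = 9 * A" unfolding A_def mult.assoc PA by simp
      finally show ?thesis .
    qed
    have T3: "real K \<le> A" 
    proof -
      have "P (12 * \<delta>) \<le> A" unfolding A_def using \<delta> \<kappa> \<kappa>_def by (intro PM) auto
      thus ?thesis using K by simp
    qed
    have S: "card {n \<in> {u..<v}. ?H n} \<le> card {n. 1 \<le> n \<and> real n \<le> x \<and> ?H n}"
      "card {n. 1 \<le> n \<and> real n \<le> x \<and> ?H n} \<le> u + card {n \<in> {u..<v}. ?H n}"
    proof -
      let ?N = "{n. 1 \<le> n \<and> real n \<le> x \<and> ?H n}"
      have fin: "finite ?N" by (rule card_nat_interval_le(1)[of x]) (use x in auto)
      have u1: "1 \<le> u" using A u by linarith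
      have lt: "real n \<le> x \<longleftrightarrow> n < v" for n using x le_nat_floor[of n x] unfolding v_def by linarith
      show "card {n \<in> {u..<v}. ?H n} \<le> card ?N" 
      proof (rule card_mono[OF fin], rule subsetI)
        fix n assume "n \<in> {n \<in> {u..<v}. ?H n}"
        thus "n \<in> ?N" using lt[of n] u1 by simp
      qed
      have "?N \<subseteq> {..<u} \<union> {n \<in> {u..<v}. ?H n}" 
      proof (rule subsetI)
        fix n assume "n \<in> ?N"
        thus "n \<in> {..<u} \<union> {n \<in> {u..<v}. ?H n}" using lt[of n] by simp linarith
      qed
      hence "card ?N \<le> card ({..<u} \<union> {n \<in> {u..<v}. ?H n})" by (intro card_mono) auto
      also have "\<dots> \<le> card {..<u} + card {n \<in> {u..<v}. ?H n}" by (rule card_Un_le)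
      finally show "card ?N \<le> u + card {n \<in> {u..<v}. ?H n}" by simp
    qed
    define r where "r = \<rho> * (real v - real u)"
    define E where "E = 5 * (4 / (c - 1) + 1) * A + 9 * A + A"
    have cnt': "\<bar>real (card {n \<in> {u..<v}. ?H n}) - r\<bar> \<le> E"
      unfolding r_def E_def by (rule order_trans[OF cnt]) (intro add_mono T1 T2 T3)
    have S': "real (card {n \<in> {u..<v}. ?H n}) \<le> real (card {n. 1 \<le> n \<and> real n \<le> x \<and> ?H n})"
      "real (card {n. 1 \<le> n \<and> real n \<le> x \<and> ?H n}) \<le> real u + real (card {n \<in> {u..<v}. ?H n})"
      using S by linarith+
    have "\<bar>r - \<rho> * x\<bar> \<le> 1 * (real u + 1)"
    proof -
      have "r - \<rho> * x = \<rho> * (real v - real u - x)" by (simp add: r_def algebra_simps)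
      moreover have "\<bar>real v - real u - x\<bar> \<le> real u + 1" using v by linarith
      ultimately show ?thesis using \<rho> by (simp only: abs_mult) (intro mult_mono, auto)
    qed
    hence "\<bar>real (card {n. 1 \<le> n \<and> real n \<le> x \<and> ?H n}) - \<rho> * x\<bar> \<le> E + 2 * real u + 1"
      using cnt' S' by (simp only: abs_le_iff) argo
    also have "\<dots> \<le> C * A" using u A by (simp add: E_def C_def algebra_simps)
    finally show ?thesis by (simp add: \<rho>_def A_def P_def)
  qed
  show ?thesis by (rule that[of C]) (use c main in \<open>auto simp: C_def\<close>)
qed

section \<open>The Moebius function and the asymptotic formula\<close>

definition moebius :: "nat \<Rightarrow> real" where
  "moebius n = (if squarefree n then (- 1) ^ card (prime_factors n) else 0)"

lemma moebius_1 [simp]: "moebius 1 = 1" "moebius (Suc 0) = 1"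
  using squarefree_1[where 'a = nat] by (simp_all add: moebius_def)

lemma abs_moebius_le_1: "\<bar>moebius n\<bar> \<le> 1"
  by (simp add: moebius_def power_abs)

lemma moebius_prime_mult:
  assumes "prime p" "\<not> p dvd d"
  shows "moebius (p * d) = - moebius d"
proof -
  have d: "d \<noteq> 0" using assms(2) by (cases d) auto
  have cop: "coprime p d" using assms by (simp add: prime_imp_coprime)
  have sf: "squarefree (p * d) \<longleftrightarrow> squarefree d"
    using squarefree_mult_coprime[OF cop squarefree_prime[OF assms(1)]] squarefree_multD(2) by blast
  have "prime_factors (p * d) = insert p (prime_factors d)"
    using assms d by (simp add: prime_factors_product prime_prime_factors)
  moreover have "p \<notin> prime_factors d" using assms by auto
  ultimately show ?thesis using sf by (simp add: moebius_def)
qed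

text \<open>Fix a prime \<open>p\<close> dividing \<open>n\<close>. Multiplication by
  \<open>p\<close> matches the squarefree divisors prime to \<open>p\<close> with those divisible by
  \<open>p\<close>, and reverses the sign.\<close>

lemma sum_moebius_divisors:
  assumes "n \<noteq> 0"
  shows "(\<Sum>d | d dvd n. moebius d) = (if n = 1 then 1 else 0)"
proof (cases "n = 1")
  case False
  then obtain p where p: "prime p" "p dvd n" using prime_factor_nat by blast
  let ?A = "{d. d dvd n \<and> \<not> p dvd d}" and ?B = "{d. d dvd n \<and> p dvd d \<and> squarefree d}"
  let ?A' = "{d. d dvd n \<and> \<not> p dvd d \<and> squarefree d}"
  have fin: "finite {d. d dvd n}" using assms by simp
  have "(\<Sum>d | d dvd n. moebius d) = (\<Sum>d\<in>?A' \<union> ?B. moebius d)"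
    by (rule sum.mono_neutral_right[OF fin]) (auto simp: moebius_def)
  also have "\<dots> = (\<Sum>d\<in>?A'. moebius d) + (\<Sum>d\<in>?B. moebius d)"
    by (rule sum.union_disjoint) (auto intro: finite_subset[OF _ fin])
  also have "(\<Sum>d\<in>?B. moebius d) = (\<Sum>d\<in>?A'. - moebius d)"
  proof (rule sum.reindex_bij_witness[where i = "\<lambda>d. p * d" and j = "\<lambda>d. d div p"])
    fix d assume d: "d \<in> ?B"
    then obtain e where e: "d = p * e" by auto
    have p0: "p \<noteq> 0" using p by auto
    show "p * (d div p) = d" using d by simp
    have "\<not> p dvd e"
    proof
      assume "p dvd e"
      hence "p ^ 2 dvd d" by (simp add: e power2_eq_square)
      hence "p dvd 1" using d squarefreeD by blast
      thus False using p by simp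
    qed
    moreover have "squarefree e" using d e squarefree_multD(2) by blast
    moreover have "e dvd n" using d e by (metis (mono_tags, lifting) dvd_mult_right mem_Collect_eq)
    ultimately show "d div p \<in> ?A'" using e p0 by simp
    show "- moebius (d div p) = moebius d"
      using moebius_prime_mult[OF p(1) \<open>\<not> p dvd e\<close>] e p0 by simp
  next
    fix d assume d: "d \<in> ?A'"
    have p0: "p \<noteq> 0" using p by auto
    show "p * d div p = d" using p0 by simp
    have cop: "coprime p d" using p d by (simp add: prime_imp_coprime)
    have "p * d dvd n" using p d cop by (simp add: divides_mult)
    moreover have "squarefree (p * d)" using d cop p by (simp add: squarefree_mult_coprime squarefree_prime)
    ultimately show "p * d \<in> ?B" by simp
  qed
  finally show ?thesis using False by (simp add: sum_negf)
qed simp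

text \<open>\<open>d\<^sup>2\<close> divides \<open>k\<close> exactly when \<open>d\<close> divides
  the square part of \<open>k\<close>, and \<open>k\<close> is squarefree exactly when that part is
  1; so the divisor sum of the Moebius function applies.\<close>

lemma sum_moebius_square_divisors:
  assumes "0 < (k::int)"
  shows "finite {d::nat. (int d)\<^sup>2 dvd k}"
    and "(\<Sum>d | (int d)\<^sup>2 dvd k. moebius d) = (if squarefree k then 1 else 0)"
proof -
  define b where "b = nat (square_part k)"
  have k: "k \<noteq> 0" using assms by simp
  have nn: "0 \<le> square_part k" using normalize_square_part[of k] by (metis abs_ge_zero normalize_int_def)
  have b: "int b = square_part k" using nn by (simp add: b_def)
  have b0: "b \<noteq> 0" using b k by (metis of_nat_0 square_part_0_iff)
  have eq: "{d::nat. (int d)\<^sup>2 dvd k} = {d. d dvd b}"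
    by (simp flip: dvd_square_part_iff b)
  show "finite {d::nat. (int d)\<^sup>2 dvd k}" unfolding eq using b0 by simp
  have "squarefree k \<longleftrightarrow> b = 1"
  proof
    assume "squarefree k"
    hence "square_part k dvd 1" using squarefreeD square_part_square_dvd by blast
    thus "b = 1" using b by (metis int_dvd_int_iff nat_dvd_1_iff_1 of_nat_1)
  next
    assume "b = 1"
    hence s: "square_part k = 1" using b by simp
    show "squarefree k" by (rule squarefreeI) (use s dvd_square_part_iff[of _ k] in auto)
  qed
  thus "(\<Sum>d | (int d)\<^sup>2 dvd k. moebius d) = (if squarefree k then 1 else 0)"
    unfolding eq using sum_moebius_divisors[OF b0] by simp
qed

text \<open>The tail is compared with the telescoping series of \<open>1 / (k * (k + 1))\<close>;
  the limit is Euler's value of the sum of inverse squares.\<close>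

lemma zeta2_partial_sum:
  assumes "1 \<le> m"
  shows "(\<Sum>k = 1..m. 1 / (real k)\<^sup>2) \<le> pi\<^sup>2 / 6" "pi\<^sup>2 / 6 \<le> (\<Sum>k = 1..m. 1 / (real k)\<^sup>2) + 1 / real m"
proof -
  define Z where "Z = (\<lambda>n::nat. \<Sum>k = 1..n. 1 / (real k)\<^sup>2)"
  have Zeq: "Z n = (\<Sum>k<n. 1 / real ((k + 1)\<^sup>2))" for n
    unfolding Z_def by (rule sum.reindex_bij_witness[of _ Suc "\<lambda>k. k - 1"]) auto
  have lim: "Z \<longlonglongrightarrow> pi\<^sup>2 / 6"
    using inverse_squares_sums unfolding sums_def Zeq[symmetric] .
  have mono: "Z m \<le> Z n" if "m \<le> n" for n unfolding Z_def using that by (intro sum_mono2) auto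
  have "Z m \<le> pi\<^sup>2 / 6"
    by (rule LIMSEQ_le_const[OF lim], intro exI[of _ m] allI impI mono)
  thus "(\<Sum>k = 1..m. 1 / (real k)\<^sup>2) \<le> pi\<^sup>2 / 6" by (simp only: Z_def)
  have up: "Z n \<le> Z m + 1 / real m - 1 / real n" if "m \<le> n" for n
    using that
  proof (induction n rule: dec_induct)
    case (step n)
    have n: "1 \<le> real n" using step assms by auto
    have "1 / (real (Suc n))\<^sup>2 \<le> 1 / (real n * real (Suc n))"
      using n by (intro divide_left_mono) (auto simp: power2_eq_square)
    also have "\<dots> = 1 / real n - 1 / real (Suc n)" using n by (simp add: field_simps)
    finally show ?case using step by (simp add: Z_def)
  qed simp
  have "pi\<^sup>2 / 6 \<le> Z m + 1 / real m"
  proof (rule LIMSEQ_le_const2[OF lim], intro exI allI impI)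
    fix n assume "m \<le> n"
    have "0 \<le> 1 / real n" by simp
    thus "Z n \<le> Z m + 1 / real m" using up[OF \<open>m \<le> n\<close>] by linarith
  qed
  thus "pi\<^sup>2 / 6 \<le> (\<Sum>k = 1..m. 1 / (real k)\<^sup>2) + 1 / real m" by (simp only: Z_def)
qed

text \<open>Finite inversion instead of Dirichlet series: weighting each term with the partial sum
  \<open>?Z (n div d)\<close> gives exactly 1. Replacing these weights by their limit
  \<open>?z\<close> costs at most \<open>2 * d / n\<close> each, and the resulting harmonic sum
  explains the logarithm.\<close>

lemma sum_moebius_over_squares:
  assumes n: "1 \<le> n"
  shows "\<bar>(\<Sum>d = 1..n. moebius d / (real d)\<^sup>2) - 6 / pi\<^sup>2\<bar> \<le> 2 * (1 + ln (real n)) / real n"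
proof -
  let ?z = "pi\<^sup>2 / 6" and ?Z = "\<lambda>m::nat. \<Sum>k = 1..m. 1 / (real k)\<^sup>2"
  let ?g = "\<lambda>d::nat. moebius d / (real d)\<^sup>2"
  have "(\<Sum>d = 1..n. ?g d * ?Z (n div d)) = (\<Sum>d = 1..n. \<Sum>k = 1..n div d. moebius d / (real (d * k))\<^sup>2)"
    by (simp add: sum_distrib_left power_mult_distrib)
  also have "\<dots> = (\<Sum>(d, k)\<in>Sigma {1..n} (\<lambda>d. {1..n div d}). moebius d / (real (d * k))\<^sup>2)"
    by (rule sum.Sigma) auto
  \<comment> \<open>Regrouping by the product \<open>m = d * k\<close> makes the inner sum a divisor
    sum, which vanishes except at \<open>m = 1\<close>.\<close>
  also have "\<dots> = (\<Sum>(m, d)\<in>Sigma {1..n} (\<lambda>m. {d. d dvd m}). moebius d / (real m)\<^sup>2)"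
  proof (rule sum.reindex_bij_witness[where i = "\<lambda>(m, d). (d, m div d)" and j = "\<lambda>(d, k). (d * k, d)"])
    fix p assume p: "p \<in> Sigma {1..n} (\<lambda>d. {1..n div d})"
    then obtain d k where dk: "p = (d, k)" "1 \<le> d" "1 \<le> k" "k \<le> n div d" by auto
    have "d * k \<le> n" using dk by (metis Suc_le_eq less_eq_div_iff_mult_less_eq mult.commute One_nat_def)
    moreover have "1 \<le> d * k" using dk by simp
    ultimately show "(case p of (d, k) \<Rightarrow> (d * k, d)) \<in> Sigma {1..n} (\<lambda>m. {d. d dvd m})" using dk by simp
    show "(case case p of (d, k) \<Rightarrow> (d * k, d) of (m, d) \<Rightarrow> (d, m div d)) = p" using dk by simp
    show "(case case p of (d, k) \<Rightarrow> (d * k, d) of (m, d) \<Rightarrow> moebius d / (real m)\<^sup>2) = (case p of (d, k) \<Rightarrow> moebius d / (real (d * k))\<^sup>2)"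
      using dk by simp
  next
    fix p assume p: "p \<in> Sigma {1..n} (\<lambda>m. {d. d dvd m})"
    then obtain m d where md: "p = (m, d)" "1 \<le> m" "m \<le> n" "d dvd m" by auto
    then obtain k where k: "m = d * k" by auto
    have d0: "1 \<le> d" "1 \<le> k" using md k by (auto simp: Suc_le_eq)
    show "(case case p of (m, d) \<Rightarrow> (d, m div d) of (d, k) \<Rightarrow> (d * k, d)) = p" using md by simp
    have "k \<le> n div d" using md k d0 by (metis Suc_le_eq less_eq_div_iff_mult_less_eq mult.commute One_nat_def)
    moreover have "d \<le> n" using md by (meson dvd_imp_le le_trans less_le_trans zero_less_one)
    ultimately show "(case p of (m, d) \<Rightarrow> (d, m div d)) \<in> Sigma {1..n} (\<lambda>d. {1..n div d})" using md k d0 by simp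
  qed
  also have "\<dots> = (\<Sum>m = 1..n. \<Sum>d | d dvd m. moebius d / (real m)\<^sup>2)"
    by (rule sum.Sigma[symmetric]) auto
  also have "\<dots> = (\<Sum>m = 1..n. if m = 1 then 1 else 0)"
  proof (rule sum.cong[OF refl])
    fix m assume "m \<in> {1..n}"
    hence "(\<Sum>d | d dvd m. moebius d) = (if m = 1 then 1 else 0)" by (intro sum_moebius_divisors) auto
    thus "(\<Sum>d | d dvd m. moebius d / (real m)\<^sup>2) = (if m = 1 then 1 else 0)"
      by (simp flip: sum_divide_distrib)
  qed
  also have "\<dots> = 1" using n by simp
  finally have one: "(\<Sum>d = 1..n. ?g d * ?Z (n div d)) = 1" .
  have "(\<Sum>d = 1..n. ?g d) * ?z - (\<Sum>d = 1..n. ?g d * ?Z (n div d)) = (\<Sum>d = 1..n. ?g d * (?z - ?Z (n div d)))"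
    by (simp only: sum_distrib_right right_diff_distrib sum_subtractf)
  hence "\<bar>(\<Sum>d = 1..n. ?g d) * ?z - 1\<bar> = \<bar>\<Sum>d = 1..n. ?g d * (?z - ?Z (n div d))\<bar>"
    by (simp only: one)
  also have "\<dots> \<le> (\<Sum>d = 1..n. \<bar>?g d * (?z - ?Z (n div d))\<bar>)" by (rule sum_abs)
  also have "\<dots> \<le> (\<Sum>d = 1..n. 2 / real n * (1 / real d))"
  proof (rule sum_mono)
    fix d assume d: "d \<in> {1..n}"
    have nd: "1 \<le> n div d" using d by (simp add: div_greater_zero_iff Suc_le_eq)
    have "\<bar>?z - ?Z (n div d)\<bar> \<le> 1 / real (n div d)" using zeta2_partial_sum[OF nd] by linarith
    \<comment> \<open>Since \<open>n div d\<close> is at least 1, rounding down loses at most a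
      factor 2.\<close>
    also have "\<dots> \<le> 2 * real d / real n"
    proof -
      have "n < d * (n div d) + d" using d by (metis atLeastAtMost_iff div_mult_mod_eq mod_less_divisor mult.commute nat_add_left_cancel_less not_less_eq_eq One_nat_def Suc_le_eq)
      also have "\<dots> \<le> 2 * (d * (n div d))" using nd by simp
      finally have "real n \<le> 2 * real d * real (n div d)" by (metis less_imp_le of_nat_le_iff of_nat_mult of_nat_numeral mult.assoc)
      thus ?thesis using nd n by (simp add: field_simps)
    qed
    finally have "\<bar>?g d\<bar> * \<bar>?z - ?Z (n div d)\<bar> \<le> (1 / (real d)\<^sup>2) * (2 * real d / real n)"
      using abs_moebius_le_1[of d] by (intro mult_mono) (auto simp: divide_right_mono)
    also have "\<dots> = 2 / real n * (1 / real d)" using d by (simp add: power2_eq_square)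
    finally show "\<bar>?g d * (?z - ?Z (n div d))\<bar> \<le> 2 / real n * (1 / real d)" by (simp add: abs_mult)
  qed
  also have "\<dots> = 2 / real n * (\<Sum>d = 1..n. 1 / real d)" by (simp add: sum_distrib_left)
  also have "\<dots> \<le> 2 / real n * (1 + ln (real n))" using sum_inverse_le_ln[OF n] by (intro mult_left_mono) auto
  finally have main: "\<bar>(\<Sum>d = 1..n. ?g d) * ?z - 1\<bar> \<le> 2 / real n * (1 + ln (real n))" .
  have z1: "1 \<le> ?z" using zeta2_partial_sum(1)[of 1] by simp
  have "(\<Sum>d = 1..n. ?g d) * ?z - 1 = ?z * ((\<Sum>d = 1..n. ?g d) - 6 / pi\<^sup>2)" by (simp add: field_simps)
  hence "\<bar>(\<Sum>d = 1..n. ?g d) * ?z - 1\<bar> = ?z * \<bar>(\<Sum>d = 1..n. ?g d) - 6 / pi\<^sup>2\<bar>" by (simp only: abs_mult) (use z1 in simp)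
  moreover have "1 * \<bar>(\<Sum>d = 1..n. ?g d) - 6 / pi\<^sup>2\<bar> \<le> ?z * \<bar>(\<Sum>d = 1..n. ?g d) - 6 / pi\<^sup>2\<bar>"
    using z1 by (intro mult_right_mono) auto
  ultimately show ?thesis using main by simp
qed

section \<open>Moebius inversion for the counting function and the final estimate\<close>

lemma floor_powr_pos:
  assumes "1 \<le> (n::nat)" "0 \<le> c"
  shows "0 < \<lfloor>real n powr c\<rfloor>"
proof -
  have "1 \<le> real n powr c" using assms by (intro ge_one_powr_ge_zero) auto
  thus ?thesis by simp
qed

text \<open>Divisors above \<open>y\<close> enter only through the bound 1 for the Moebius function,
  so their contribution is at most the number of pairs.\<close>

lemma squarefree_floor_count_moebius:
  fixes c x y :: real
  assumes c: "0 \<le> c" and x: "0 \<le> x"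
  shows "\<bar>real (squarefree_floor_count c x)
      - (\<Sum>d = 1..nat \<lfloor>y\<rfloor>. moebius d * real (card (square_multiples c x d)))\<bar>
    \<le> real (card {(n, d). 1 \<le> n \<and> real n \<le> x \<and> y < real d \<and> square_divides c n d})"
proof -
  define k where "k = (\<lambda>n::nat. \<lfloor>real n powr c\<rfloor>)"
  define N where "N = {n::nat. 1 \<le> n \<and> real n \<le> x}"
  define T where "T = (\<lambda>n. {d::nat. (int d)\<^sup>2 dvd k n})"
  have fN: "finite N" unfolding N_def by (rule card_nat_interval_le(1)[OF x]) auto
  have k0: "0 < k n" if "n \<in> N" for n using floor_powr_pos[of n c] that c by (auto simp: k_def N_def)
  have fT: "finite (T n)" if "n \<in> N" for n using sum_moebius_square_divisors(1)[OF k0[OF that]] by (simp add: T_def)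
  have T1: "1 \<le> d" if "n \<in> N" "d \<in> T n" for n d using k0[OF that(1)] that(2) by (cases d) (auto simp: T_def)
  let ?small = "\<lambda>n. \<Sum>d | d \<in> T n \<and> real d \<le> y. moebius d" and ?large = "\<lambda>n. \<Sum>d | d \<in> T n \<and> y < real d. moebius d"
  have "real (squarefree_floor_count c x) = real (card {n \<in> N. squarefree (k n)})"
    by (simp add: squarefree_floor_count_def N_def k_def conj_assoc)
  also have "\<dots> = (\<Sum>n\<in>N. if squarefree (k n) then 1 else 0)" using fN by (simp add: sum.If_cases Int_def)
  also have "\<dots> = (\<Sum>n\<in>N. \<Sum>d\<in>T n. moebius d)"
    by (rule sum.cong[OF refl]) (use sum_moebius_square_divisors(2)[OF k0] in \<open>simp add: T_def\<close>)
  also have "\<dots> = (\<Sum>n\<in>N. ?small n + ?large n)"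
  proof (rule sum.cong[OF refl])
    fix n assume n: "n \<in> N"
    have "T n = {d. d \<in> T n \<and> real d \<le> y} \<union> {d. d \<in> T n \<and> y < real d}" by auto
    hence "(\<Sum>d\<in>T n. moebius d) = (\<Sum>d\<in>{d. d \<in> T n \<and> real d \<le> y} \<union> {d. d \<in> T n \<and> y < real d}. moebius d)" by (rule arg_cong)
    also have "\<dots> = ?small n + ?large n" by (rule sum.union_disjoint) (use fT[OF n] in auto)
    finally show "(\<Sum>d\<in>T n. moebius d) = ?small n + ?large n" .
  qed
  also have "\<dots> = (\<Sum>n\<in>N. ?small n) + (\<Sum>n\<in>N. ?large n)" by (rule sum.distrib)
  finally have eq: "real (squarefree_floor_count c x) = (\<Sum>n\<in>N. ?small n) + (\<Sum>n\<in>N. ?large n)" .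
  have "(\<Sum>n\<in>N. ?small n) = (\<Sum>n\<in>N. \<Sum>d | d \<in> {1..nat \<lfloor>y\<rfloor>} \<and> (int d)\<^sup>2 dvd k n. moebius d)"
  proof (rule sum.cong[OF refl], rule sum.cong)
    fix n assume n: "n \<in> N"
    have "real d \<le> y \<longleftrightarrow> d \<le> nat \<lfloor>y\<rfloor>" if "1 \<le> d" for d using that by (auto simp: le_nat_floor) linarith
    thus "{d. d \<in> T n \<and> real d \<le> y} = {d. d \<in> {1..nat \<lfloor>y\<rfloor>} \<and> (int d)\<^sup>2 dvd k n}"
      using T1[OF n] by (auto simp: T_def)
  qed simp
  also have "\<dots> = (\<Sum>d = 1..nat \<lfloor>y\<rfloor>. \<Sum>n | n \<in> N \<and> (int d)\<^sup>2 dvd k n. moebius d)"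
    by (rule sum.swap_restrict[OF fN]) simp
  also have "\<dots> = (\<Sum>d = 1..nat \<lfloor>y\<rfloor>. moebius d * real (card (square_multiples c x d)))"
    by (simp add: N_def k_def conj_assoc mult.commute)
  finally have small: "(\<Sum>n\<in>N. ?small n) = \<dots>" .
  have "\<bar>\<Sum>n\<in>N. ?large n\<bar> \<le> (\<Sum>n\<in>N. \<bar>?large n\<bar>)" by (rule sum_abs)
  also have "\<dots> \<le> (\<Sum>n\<in>N. real (card {d. d \<in> T n \<and> y < real d}))"
  proof (rule sum_mono)
    fix n
    have "\<bar>?large n\<bar> \<le> (\<Sum>d | d \<in> T n \<and> y < real d. \<bar>moebius d\<bar>)" by (rule sum_abs)
    also have "\<dots> \<le> (\<Sum>d | d \<in> T n \<and> y < real d. 1)" by (intro sum_mono abs_moebius_le_1)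
    finally show "\<bar>?large n\<bar> \<le> real (card {d. d \<in> T n \<and> y < real d})" by simp
  qed
  also have "\<dots> = real (\<Sum>n\<in>N. card {d. d \<in> T n \<and> y < real d})" by simp
  also have "(\<Sum>n\<in>N. card {d. d \<in> T n \<and> y < real d}) = card (Sigma N (\<lambda>n. {d. d \<in> T n \<and> y < real d}))"
    by (rule card_SigmaI[symmetric]) (use fN fT in auto)
  also have "Sigma N (\<lambda>n. {d. d \<in> T n \<and> y < real d})
      = {(n, d). 1 \<le> n \<and> real n \<le> x \<and> y < real d \<and> square_divides c n d}"
    by (auto simp: N_def T_def k_def)
  finally show ?thesis using eq small by simp
qed

theorem squarefree_floor_count_asymptotic:
  fixes c :: real
  assumes c: "1 < c" "c < 12 / 7"
  obtains \<epsilon>0 K :: real where "0 < \<epsilon>0" "\<And>x. 1 \<le> x \<Longrightarrow> \<bar>real (squarefree_floor_count c x) - 6 / pi\<^sup>2 * x\<bar> \<le> K * x powr (1 - \<epsilon>0)"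
proof -
  define \<delta> where "\<delta> = (2 - c) / 28"
  have \<delta>: "0 < \<delta>" "28 * \<delta> \<le> 2 - c" using c by (auto simp: \<delta>_def)
  obtain C1 where C1: "0 \<le> C1" and small:
    "\<And>x d. 1 \<le> x \<Longrightarrow> 1 \<le> d \<Longrightarrow> real d \<le> x powr \<delta> \<Longrightarrow>
      \<bar>real (card (square_multiples c x d)) - x / (real d)\<^sup>2\<bar> \<le> C1 * x powr (1 - 2 * \<delta>)"
    by (rule card_small_square_divisor[of c \<delta>]) (use c \<delta> in auto)
  obtain \<eta> C2 where \<eta>: "0 < \<eta>" and C2: "0 \<le> C2" and large:
    "\<And>x. 1 \<le> x \<Longrightarrow> real (card {(n, d). 1 \<le> n \<and> real n \<le> x \<and> real n powr \<delta> < real d \<and> square_divides c n d}) \<le> C2 * x powr (1 - \<eta>)"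
    by (rule card_large_square_divisors[OF c \<delta>(1)]) (rule that)
  \<comment> \<open>\<eta> comes from the large divisors and \<delta> from the small ones;
    completing the Moebius sum would also save \<delta>, and half of that is given up to absorb the
    logarithm.\<close>
  define \<epsilon>0 where "\<epsilon>0 = min \<eta> (\<delta> / 2)"
  have \<epsilon>0: "0 < \<epsilon>0" using \<eta> \<delta> by (simp add: \<epsilon>0_def)
  define K where "K = C2 + C1 + 4 * (1 + 2 / \<delta>)"
  have main: "\<bar>real (squarefree_floor_count c x) - 6 / pi\<^sup>2 * x\<bar> \<le> K * x powr (1 - \<epsilon>0)" if x: "1 \<le> x" for x
  proof -
    define y where "y = x powr \<delta>"
    have y: "1 \<le> y" using x \<delta> by (simp add: y_def ge_one_powr_ge_zero)
    define m where "m = nat \<lfloor>y\<rfloor>"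
    have m: "1 \<le> m" "real m \<le> y" "y / 2 \<le> real m" unfolding m_def using nat_floor_bounds[OF y] by auto
    let ?A = "\<lambda>d::nat. real (card (square_multiples c x d))"
    let ?S = "\<Sum>d = 1..m. moebius d / (real d)\<^sup>2"
    have P: "x powr (1 - \<eta>) \<le> x powr (1 - \<epsilon>0)" "x powr (1 - \<delta>) \<le> x powr (1 - \<epsilon>0)" "x powr (1 - \<delta> / 2) \<le> x powr (1 - \<epsilon>0)"
      using x \<delta> by (auto simp: \<epsilon>0_def intro!: powr_mono)
    have 1: "\<bar>real (squarefree_floor_count c x) - (\<Sum>d = 1..m. moebius d * ?A d)\<bar> \<le> C2 * x powr (1 - \<eta>)"
    proof -
      have fin: "finite {(n, d). 1 \<le> n \<and> real n \<le> x \<and> real n powr \<delta> < real d \<and> square_divides c n d}"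
        by (rule finite_square_divisor_pairs(1)[of c x]) (use c x in auto)
      have "\<bar>real (squarefree_floor_count c x) - (\<Sum>d = 1..m. moebius d * ?A d)\<bar>
          \<le> real (card {(n, d). 1 \<le> n \<and> real n \<le> x \<and> y < real d \<and> square_divides c n d})"
        unfolding m_def by (rule squarefree_floor_count_moebius) (use c x in auto)
      \<comment> \<open>Replacing the cutoff \<open>x powr \<delta>\<close> by the smaller
        \<open>n powr \<delta>\<close> only adds pairs and makes the condition local to each dyadic
        range of \<open>n\<close>.\<close>
      also have "\<dots> \<le> real (card {(n, d). 1 \<le> n \<and> real n \<le> x \<and> real n powr \<delta> < real d \<and> square_divides c n d})"
      proof (intro of_nat_mono card_mono[OF fin] subsetI)
        fix p assume "p \<in> {(n, d). 1 \<le> n \<and> real n \<le> x \<and> y < real d \<and> square_divides c n d}"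
        then obtain n d where p: "p = (n, d)" "1 \<le> n" "real n \<le> x" "y < real d" "square_divides c n d" by auto
        have "real n powr \<delta> \<le> y" unfolding y_def using p \<delta> by (intro powr_mono2) auto
        thus "p \<in> {(n, d). 1 \<le> n \<and> real n \<le> x \<and> real n powr \<delta> < real d \<and> square_divides c n d}" using p by simp
      qed
      also have "\<dots> \<le> C2 * x powr (1 - \<eta>)" by (rule large[OF x])
      finally show ?thesis .
    qed
    have 2: "\<bar>(\<Sum>d = 1..m. moebius d * ?A d) - x * ?S\<bar> \<le> C1 * x powr (1 - \<delta>)"
    proof -
      have "(\<Sum>d = 1..m. moebius d * ?A d) - x * ?S = (\<Sum>d = 1..m. moebius d * (?A d - x / (real d)\<^sup>2))"
        by (simp add: sum_distrib_left right_diff_distrib sum_subtractf mult.commute)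
      also have "\<bar>\<dots>\<bar> \<le> (\<Sum>d = 1..m. \<bar>moebius d * (?A d - x / (real d)\<^sup>2)\<bar>)" by (rule sum_abs)
      also have "\<dots> \<le> (\<Sum>d = 1..m. C1 * x powr (1 - 2 * \<delta>))"
      proof (rule sum_mono)
        fix d assume d: "d \<in> {1..m}"
        have "real d \<le> real m" using d by simp
        hence "real d \<le> x powr \<delta>" using m(2) unfolding y_def by linarith
        hence "\<bar>?A d - x / (real d)\<^sup>2\<bar> \<le> C1 * x powr (1 - 2 * \<delta>)" using d by (intro small[OF x]) auto
        hence "\<bar>moebius d\<bar> * \<bar>?A d - x / (real d)\<^sup>2\<bar> \<le> 1 * (C1 * x powr (1 - 2 * \<delta>))"
          using abs_moebius_le_1[of d] by (intro mult_mono) auto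
        thus "\<bar>moebius d * (?A d - x / (real d)\<^sup>2)\<bar> \<le> C1 * x powr (1 - 2 * \<delta>)" by (simp add: abs_mult)
      qed
      also have "\<dots> = real m * (C1 * x powr (1 - 2 * \<delta>))" by simp
      also have "\<dots> \<le> y * (C1 * x powr (1 - 2 * \<delta>))" using m C1 by (intro mult_right_mono) auto
      also have "\<dots> = C1 * (x powr \<delta> * x powr (1 - 2 * \<delta>))" by (simp add: y_def)
      also have "x powr \<delta> * x powr (1 - 2 * \<delta>) = x powr (1 - \<delta>)" by (simp flip: powr_add)
      finally show ?thesis .
    qed
    have 3: "\<bar>x * ?S - 6 / pi\<^sup>2 * x\<bar> \<le> 4 * (1 + 2 / \<delta>) * x powr (1 - \<delta> / 2)"
    proof -
      have ln: "1 + ln (real m) \<le> (1 + 2 / \<delta>) * x powr (\<delta> / 2)"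
      proof -
        have "y \<le> x" unfolding y_def using x \<delta> c powr_mono[of \<delta> 1 x] by (simp add: \<delta>_def)
        hence "ln (real m) \<le> ln x" using m by (intro ln_mono) auto
        thus ?thesis using one_plus_ln_le[OF x, of "\<delta> / 2"] \<delta> by simp
      qed
      have "2 * (1 + ln (real m)) / real m \<le> 2 * ((1 + 2 / \<delta>) * x powr (\<delta> / 2)) / (y / 2)"
        using ln m y \<delta> x by (intro frac_le mult_left_mono) auto
      also have "\<dots> = 4 * (1 + 2 / \<delta>) * (x powr (\<delta> / 2) / x powr \<delta>)" by (simp add: y_def)
      also have "x powr (\<delta> / 2) / x powr \<delta> = x powr (- \<delta> / 2)" by (simp flip: powr_diff)
      finally have b: "2 * (1 + ln (real m)) / real m \<le> 4 * (1 + 2 / \<delta>) * x powr (- \<delta> / 2)" .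
      have "x * ?S - 6 / pi\<^sup>2 * x = x * (?S - 6 / pi\<^sup>2)" by (simp add: algebra_simps)
      hence "\<bar>x * ?S - 6 / pi\<^sup>2 * x\<bar> = x * \<bar>?S - 6 / pi\<^sup>2\<bar>" using x by (simp add: abs_mult)
      also have "\<dots> \<le> x * (4 * (1 + 2 / \<delta>) * x powr (- \<delta> / 2))"
        using sum_moebius_over_squares[OF m(1)] b x by (intro mult_left_mono) auto
      also have "\<dots> = 4 * (1 + 2 / \<delta>) * (x powr 1 * x powr (- \<delta> / 2))" using x by simp
      also have "x powr 1 * x powr (- \<delta> / 2) = x powr (1 - \<delta> / 2)" unfolding powr_add[symmetric] by simp
      finally show ?thesis .
    qed
    have "C2 * x powr (1 - \<eta>) + C1 * x powr (1 - \<delta>) + 4 * (1 + 2 / \<delta>) * x powr (1 - \<delta> / 2)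
       \<le> C2 * x powr (1 - \<epsilon>0) + C1 * x powr (1 - \<epsilon>0) + 4 * (1 + 2 / \<delta>) * x powr (1 - \<epsilon>0)"
      using P C1 C2 \<delta> by (intro add_mono mult_left_mono) auto
    also have "\<dots> = K * x powr (1 - \<epsilon>0)" by (simp add: K_def algebra_simps)
    finally show ?thesis using 1 2 3 by linarith
  qed
  show ?thesis by (rule that[OF \<epsilon>0 main])
qed

theorem theorem4:
  fixes c :: real
  assumes "1 < c" and "c < 149 / 87"
  shows "\<exists>\<epsilon>\<^sub>0>0. \<forall>\<epsilon>::real. 0 < \<epsilon> \<and> \<epsilon> < \<epsilon>\<^sub>0 \<longrightarrow>
           (\<exists>K::real. \<forall>x\<ge>1.
              \<bar>real (squarefree_floor_count c x) - 6 / pi\<^sup>2 * x\<bar> \<le> K * x powr (1 - \<epsilon>))"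
proof -
  \<comment> \<open>149/87 lies just below 12/7: 149 * 7 = 1043 and 87 * 12 = 1044.\<close>
  have c: "1 < c" "c < 12 / 7" using assms by auto
  obtain \<epsilon>0 K :: real where \<epsilon>0: "0 < \<epsilon>0"
    and K: "\<And>x. 1 \<le> x \<Longrightarrow> \<bar>real (squarefree_floor_count c x) - 6 / pi\<^sup>2 * x\<bar> \<le> K * x powr (1 - \<epsilon>0)"
    by (rule squarefree_floor_count_asymptotic[OF c]) (rule that)
  have "\<exists>K::real. \<forall>x\<ge>1. \<bar>real (squarefree_floor_count c x) - 6 / pi\<^sup>2 * x\<bar> \<le> K * x powr (1 - \<epsilon>)"
    if "0 < \<epsilon> \<and> \<epsilon> < \<epsilon>0" for \<epsilon>
  proof (intro exI[of _ "\<bar>K\<bar>"] allI impI)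
    fix x :: real assume x: "1 \<le> x"
    have "K * x powr (1 - \<epsilon>0) \<le> \<bar>K\<bar> * x powr (1 - \<epsilon>)" using that x by (intro mult_mono powr_mono) auto
    thus "\<bar>real (squarefree_floor_count c x) - 6 / pi\<^sup>2 * x\<bar> \<le> \<bar>K\<bar> * x powr (1 - \<epsilon>)" using K[OF x] by linarith
  qed
  thus ?thesis using \<epsilon>0 by blast
qed

end
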